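(* Let $\Omega\subset\mathbb{R}^3$ be open, bounded and convex with $\mathcal{L}^3(\Omega)=1$, and fix $N\in\mathbb{N}$ with $N\geq 2$. For any $T\in(0,\infty)$ and any well-prepared discrete probability measure $\overline{\alpha}\in\mathcal{Q}^N(\mathbb{R}^3)$, there exists a unique continuously differentiable discrete geostrophic solution $\alpha\in C([0,T];\mathcal{P}_c(\mathbb{R}^3))$ with initial measure $\overline{\alpha}$. Moreover, this solution is energy-conserving.
   Context: $\mathcal{L}^3$ is Lebesgue measure, $\mathcal{L}^3\llcorner\Omega$ its restriction to $\Omega$. $\mathcal{P}_c(\mathbb{R}^3)$ is the set of compactly supported Borel probability measures on $\mathbb{R}^3$, equipped with the Wasserstein 2-distance $W_2$; $C([0,T];\mathcal{P}_c(\mathbb{R}^3))$ denotes continuous maps $t\mapsto\alpha_t$ w.r.t. $W_2$. For a probability measure $\nu$ with finite second moment, $\mathcal{B}[\nu]$ denotes the unique mean-zero convex function in $H^1(\Omega)$ whose gradient is the optimal transport map from $\mathcal{L}^3\llcorner\Omega$ to $\nu$ for the cost $|x-y|^2$. $J$ is the $3\times 3$ matrix with rows $(0,-1,0),(1,0,0),(0,0,0)$; $e_3=(0,0,1)$. $\mathcal{Q}^N(\mathbb{R}^3)$ is the set of measures $\sum_{i=1}^N m_i\delta_{z_i}$ with $m_i>0$, $\sum_i m_i=1$, and $z_i\neq z_j$ for $i\neq j$. Such a measure is well-prepared if there is $r>0$ with $|(z_i-z_j)\cdot e_3|\geq r$ for all $i\neq j$. A map $\alpha\in C([0,T];\mathcal{P}_c(\mathbb{R}^3))$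 is a geostrophic solution on $[0,T]$ with initial measure $\overline{\alpha}\in\mathcal{P}_c(\mathbb{R}^3)$ if for all $\varphi\in C_c^\infty(\mathbb{R}^3\times\mathbb{R})$, $$\int_0^T\!\!\int_{\mathbb{R}^3}\big(\partial_t\varphi(z,t)+Jz\cdot\nabla\varphi(z,t)\big)\,d\alpha_t(z)\,dt-\int_0^T\!\!\int_\Omega Jx\cdot\nabla\varphi\big(\nabla\mathcal{B}[\alpha_t](x),t\big)\,dx\,dt=\int_{\mathbb{R}^3}\varphi(z,T)\,d\alpha_T(z)-\int_{\mathbb{R}^3}\varphi(z,0)\,d\overline{\alpha}(z),$$ where $\nabla\varphi$ is the gradient in the spatial variable. It is a continuously differentiable discrete geostrophic solution if moreover there exist $N$, a mass vector $(m_1,\dots,m_N)$ ($m_i>0$, $\sum m_i=1$) and a continuously differentiable map $(z_1,\dots,z_N):[0,T]\to\mathbb{R}^{3N}$ with $\alpha_t=\sum_i m_i\delta_{z_i(t)}\in\mathcal{Q}^N(\mathbb{R}^3)$ for all $t\in[0,T]$. The geostrophic energy of $\nu\in\mathcal{P}_c(\mathbb{R}^3)$ is $E[\nu]=\int_\Omega\big(\tfrac12((\partial_1\mathcal{B}[\nu](x)-x_1)^2+(\partial_2\mathcal{B}[\nu](x)-x_2)^2)-x_3\partial_3\mathcal{B}[\nu](x)\big)\,dx$; a solution is energy-conserving if $t\mapsto E[\alpha_t]$ is constant. *)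

theory Defs
  imports "HOL-Probability.Probability"
begin

type_synonym R3 = "real^3"

definition Jmat :: "real^3^3" where
  "Jmat = vector [vector [0, -1, 0], vector [1, 0, 0], vector [0, 0, 0]]"

definition e3 :: R3 where "e3 = axis 3 1"

definition grad :: "(R3 \<Rightarrow> real) \<Rightarrow> R3 \<Rightarrow> R3" where
  "grad f x = (SOME g. (f has_derivative (\<lambda>h. g \<bullet> h)) (at x))"

definition Leb_on :: "R3 set \<Rightarrow> R3 measure" where
  "Leb_on \<Omega> = density lborel (indicator \<Omega>)"

definition Pc :: "R3 measure \<Rightarrow> bool" where
  "Pc \<mu> \<longleftrightarrow> prob_space \<mu> \<and> sets \<mu> = sets borel \<and>
     (\<exists>K. compact K \<and> emeasure \<mu> (UNIV - K) = 0)"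

definition finite_second_moment :: "R3 measure \<Rightarrow> bool" where
  "finite_second_moment \<mu> \<longleftrightarrow> (\<integral>\<^sup>+ z. ennreal ((norm z)\<^sup>2) \<partial>\<mu>) < \<infinity>"

definition Couplings :: "R3 measure \<Rightarrow> R3 measure \<Rightarrow> (R3 \<times> R3) measure set" where
  "Couplings \<mu> \<nu> = {\<pi>. sets \<pi> = sets (borel :: (R3 \<times> R3) measure) \<and>
      (\<forall>A \<in> sets (borel :: R3 measure). emeasure \<pi> (A \<times> UNIV) = emeasure \<mu> A
                                     \<and> emeasure \<pi> (UNIV \<times> A) = emeasure \<nu> A)}"

definition transport_cost :: "(R3 \<times> R3) measure \<Rightarrow> ennreal" where
  "transport_cost \<pi> = (\<integral>\<^sup>+ p. ennreal ((dist (fst p) (snd p))\<^sup>2) \<partial>\<pi>)"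

definition W2 :: "R3 measure \<Rightarrow> R3 measure \<Rightarrow> real" where
  "W2 \<mu> \<nu> = sqrt (enn2real (INF \<pi> \<in> Couplings \<mu> \<nu>. transport_cost \<pi>))"

definition is_brenier :: "R3 set \<Rightarrow> R3 measure \<Rightarrow> (R3 \<Rightarrow> real) \<Rightarrow> bool" where
  "is_brenier \<Omega> \<nu> \<phi> \<longleftrightarrow>
     (\<forall>x. x \<notin> \<Omega> \<longrightarrow> \<phi> x = 0) \<and>
     convex_on \<Omega> \<phi> \<and>
     \<comment> \<open>H^1(Omega)\<close>
     \<phi> \<in> borel_measurable (lebesgue_on \<Omega>) \<and>
     integrable (lebesgue_on \<Omega>) (\<lambda>x. (\<phi> x)\<^sup>2) \<and>
     (AE x in lebesgue_on \<Omega>. \<phi> differentiable at x) \<and>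
     grad \<phi> \<in> lebesgue_on \<Omega> \<rightarrow>\<^sub>M borel \<and>
     (\<forall>i. integrable (lebesgue_on \<Omega>) (\<lambda>x. (grad \<phi> x $ i)\<^sup>2)) \<and>
     \<comment> \<open>mean zero\<close>
     integrable (lebesgue_on \<Omega>) \<phi> \<and> integral\<^sup>L (lebesgue_on \<Omega>) \<phi> = 0 \<and>
     \<comment> \<open>grad phi pushes L^3 restricted to Omega forward to nu\<close>
     (\<forall>A \<in> sets (borel :: R3 measure).
        emeasure \<nu> A = emeasure lebesgue {x \<in> \<Omega>. grad \<phi> x \<in> A}) \<and>
     \<comment> \<open>and is optimal for the cost |x-y|^2\<close>
     (\<forall>\<pi> \<in> Couplings (Leb_on \<Omega>) \<nu>.
        (\<integral>\<^sup>+ x. ennreal ((dist x (grad \<phi> x))\<^sup>2) \<partial>(lebesgue_on \<Omega>)) \<le> transport_cost \<pi>)"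

definition brenier :: "R3 set \<Rightarrow> R3 measure \<Rightarrow> R3 \<Rightarrow> real" where
  "brenier \<Omega> \<nu> = (THE \<phi>. is_brenier \<Omega> \<nu> \<phi>)"

primrec Ck :: "nat \<Rightarrow> (R3 \<times> real \<Rightarrow> real) \<Rightarrow> bool" where
  "Ck 0 f = continuous_on UNIV f"
| "Ck (Suc k) f = ((\<forall>p. f differentiable (at p)) \<and>
                   (\<forall>v. Ck k (\<lambda>p. frechet_derivative f (at p) v)))"

definition test_function :: "(R3 \<times> real \<Rightarrow> real) \<Rightarrow> bool" where
  "test_function f \<longleftrightarrow> (\<forall>k. Ck k f) \<and> compact (closure {p. f p \<noteq> 0})"

definition W2_continuous :: "real \<Rightarrow> (real \<Rightarrow> R3 measure) \<Rightarrow> bool" where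
  "W2_continuous T \<alpha> \<longleftrightarrow>
     (\<forall>t \<in> {0..T}. ((\<lambda>s. W2 (\<alpha> s) (\<alpha> t)) \<longlongrightarrow> 0) (at t within {0..T}))"

definition geostrophic_solution ::
    "R3 set \<Rightarrow> real \<Rightarrow> R3 measure \<Rightarrow> (real \<Rightarrow> R3 measure) \<Rightarrow> bool" where
  "geostrophic_solution \<Omega> T \<alpha>0 \<alpha> \<longleftrightarrow>
     (\<forall>t \<in> {0..T}. Pc (\<alpha> t)) \<and> W2_continuous T \<alpha> \<and>
     (\<forall>\<phi>. test_function \<phi> \<longrightarrow>
        (LINT t:{0..T}|lborel. LINT z|\<alpha> t.
            frechet_derivative \<phi> (at (z, t)) (0, 1)
          + frechet_derivative \<phi> (at (z, t)) (Jmat *v z, 0))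
      - (LINT t:{0..T}|lborel. LINT x|lebesgue_on \<Omega>.
            frechet_derivative \<phi> (at (grad (brenier \<Omega> (\<alpha> t)) x, t)) (Jmat *v x, 0))
      = (LINT z|\<alpha> T. \<phi> (z, T)) - (LINT z|\<alpha>0. \<phi> (z, 0)))"

text \<open>sum_{i<N} m_i delta_{z_i}\<close>
definition discr :: "nat \<Rightarrow> (nat \<Rightarrow> real) \<Rightarrow> (nat \<Rightarrow> R3) \<Rightarrow> R3 measure" where
  "discr N m z = distr (density (count_space {..<N}) (\<lambda>i. ennreal (m i))) borel z"

definition mass_vector :: "nat \<Rightarrow> (nat \<Rightarrow> real) \<Rightarrow> bool" where
  "mass_vector N m \<longleftrightarrow> (\<forall>i<N. m i > 0) \<and> (\<Sum>i<N. m i) = 1"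

definition QN :: "nat \<Rightarrow> R3 measure \<Rightarrow> bool" where
  "QN N \<mu> \<longleftrightarrow> (\<exists>m z. mass_vector N m \<and> inj_on z {..<N} \<and> \<mu> = discr N m z)"

definition well_prepared :: "nat \<Rightarrow> R3 measure \<Rightarrow> bool" where
  "well_prepared N \<mu> \<longleftrightarrow> (\<exists>m z r. mass_vector N m \<and> inj_on z {..<N} \<and> \<mu> = discr N m z \<and>
      r > 0 \<and> (\<forall>i<N. \<forall>j<N. i \<noteq> j \<longrightarrow> \<bar>(z i - z j) \<bullet> e3\<bar> \<ge> r))"

definition C1_discrete_geostrophic_solution ::
    "R3 set \<Rightarrow> real \<Rightarrow> R3 measure \<Rightarrow> (real \<Rightarrow> R3 measure) \<Rightarrow> bool" where
  "C1_discrete_geostrophic_solution \<Omega> T \<alpha>0 \<alpha> \<longleftrightarrow>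
     geostrophic_solution \<Omega> T \<alpha>0 \<alpha> \<and>
     (\<exists>(N::nat) m (z :: nat \<Rightarrow> real \<Rightarrow> R3). mass_vector N m \<and>
        (\<exists>z'. \<forall>i<N. continuous_on {0..T} (z' i) \<and>
               (\<forall>t \<in> {0..T}. (z i has_vector_derivative z' i t) (at t within {0..T}))) \<and>
        (\<forall>t \<in> {0..T}. inj_on (\<lambda>i. z i t) {..<N} \<and> \<alpha> t = discr N m (\<lambda>i. z i t)))"

definition energy :: "R3 set \<Rightarrow> R3 measure \<Rightarrow> real" where
  "energy \<Omega> \<nu> = (LINT x|lebesgue_on \<Omega>.
      (1/2) * ((grad (brenier \<Omega> \<nu>) x $ 1 - x $ 1)\<^sup>2 + (grad (brenier \<Omega> \<nu>) x $ 2 - x $ 2)\<^sup>2)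
      - x $ 3 * grad (brenier \<Omega> \<nu>) x $ 3)"

definition energy_conserving :: "R3 set \<Rightarrow> real \<Rightarrow> (real \<Rightarrow> R3 measure) \<Rightarrow> bool" where
  "energy_conserving \<Omega> T \<alpha> \<longleftrightarrow>
     (\<forall>s \<in> {0..T}. \<forall>t \<in> {0..T}. energy \<Omega> (\<alpha> s) = energy \<Omega> (\<alpha> t))"

end

theory Submission
  imports Defs
begin

text \<open>For a discrete measure \<open>\<Sum> m\<^sub>i \<delta>(z\<^sub>i)\<close> the Brenier potential is a maximum of affine functions
  \<open>x \<bullet> z\<^sub>i - w\<^sub>i\<close>, with weights obtained by minimising the Kantorovich dual functional, so the weak
  formulation reduces to the system \<open>z\<^sub>i' = J (z\<^sub>i - c\<^sub>i / m\<^sub>i)\<close>, where \<open>c\<^sub>i\<close> is the first moment of the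
  Laguerre cell of \<open>z\<^sub>i\<close>. The optimal correlation \<open>G(z) = \<Sum> c\<^sub>i \<bullet> z\<^sub>i\<close> is a supremum of linear functions of
  \<open>z\<close> with subgradient \<open>c\<close>. Evaluating the dual functional at nearby points with frozen weights, and
  bounding the volume of slabs, shows that \<open>G\<close> is semiconcave as long as the points stay separated;
  hence \<open>c\<close> is Lipschitz. As \<open>J\<close> annihilates heights, well-prepared data keep their vertical
  separation, and the system is globally Lipschitz along solutions. The energy equals
  \<open>\<Sum> m\<^sub>i (z\<^sub>i\<^sub>1\<^sup>2 + z\<^sub>i\<^sub>2\<^sup>2) / 2 - G(z)\<close> up to a constant; it is conserved because \<open>J\<close> is antisymmetric.\<close>

section \<open>Laguerre cells of a bounded convex domain\<close>

text \<open>The weights are never differentiated: a smooth dependence of the weights on the points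
  would need invertibility of the Hessian of the dual functional. The moments are instead treated as
  the gradient of an optimal value, and a convex function with a quadratic upper bound at every
  point has a Lipschitz gradient. The only geometric input is the volume of slabs, where the
  separation enters as its reciprocal, so the obstacle is collision of points; vertical separation
  is the one kind of separation that the flow cannot destroy. Since \<open>brenier\<close> is a
  definite description, the weak formulation says nothing until existence and uniqueness of the
  potential are settled. Uniqueness of the gradient comes from complementary slackness, uniqueness
  of the potential from connectedness of the domain. A competing solution may have its own number of
  points, masses and labelling, and it meets the initial measure only through test functions.
  Explicit bump functions are therefore used twice: to turn the weak formulation into a pointwise
  equation, and to match the initial atoms.\<close>

lemma measure_slab_le:
  fixes u :: "real^3"
  assumes "u \<noteq> 0" "\<epsilon> \<ge> 0" "R \<ge> 0"
  shows "{x. norm x \<le> R \<and> \<bar>x \<bullet> u - b\<bar> \<le> \<epsilon>} \<in> lmeasurable"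
    and "measure lebesgue {x. norm x \<le> R \<and> \<bar>x \<bullet> u - b\<bar> \<le> \<epsilon>} \<le> 8 * R\<^sup>2 * \<epsilon> / norm u"
proof -
  let ?S = "{x. norm x \<le> R \<and> \<bar>x \<bullet> u - b\<bar> \<le> \<epsilon>}"
  \<comment> \<open>An orthogonal map taking the first axis to the direction of \<open>u\<close>
    places the slab inside the image of a box with sides \<open>2 * \<epsilon> / norm u\<close>,
    \<open>2 * R\<close> and \<open>2 * R\<close>.\<close>
  define a :: "real^3" where "a = axis 1 (norm u)"
  have "norm a = norm u" by (simp add: a_def norm_eq_sqrt_inner inner_axis_axis)
  then obtain f where f: "orthogonal_transformation f" "f a = u"
    using orthogonal_transformation_exists by blast
  define B :: "(real^3) set" where
    "B = cbox (vector [(b - \<epsilon>) / norm u, - R, - R]) (vector [(b + \<epsilon>) / norm u, R, R])"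
  have clos: "closed ?S"
    by (intro closed_Collect_conj closed_Collect_le continuous_intros)
  have "bounded ?S" by (rule bounded_subset[of "cball 0 R"]) auto
  with clos show S: "?S \<in> lmeasurable" by (intro lmeasurable_compact) (simp add: compact_eq_bounded_closed)
  have sub: "?S \<subseteq> f ` B"
  proof
    fix x assume x: "x \<in> ?S"
    obtain y where y: "x = f y"
      using orthogonal_transformation_surj[OF f(1)] by (metis surjD)
    have n: "norm y \<le> R" using x y orthogonal_transformation_norm[OF f(1), of y] by auto
    have "x \<bullet> u = y \<bullet> a" using f y by (metis orthogonal_transformation_def)
    also have "\<dots> = y $ 1 * norm u" by (simp add: a_def inner_axis)
    finally have "\<bar>y $ 1 * norm u - b\<bar> \<le> \<epsilon>" using x by auto
    then have "(b - \<epsilon>) / norm u \<le> y $ 1" "y $ 1 \<le> (b + \<epsilon>) / norm u"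
      using \<open>u \<noteq> 0\<close> by (auto simp: field_simps abs_le_iff)
    moreover have "\<bar>y $ 2\<bar> \<le> R" "\<bar>y $ 3\<bar> \<le> R"
      using n component_le_norm_cart order_trans by blast+
    ultimately have "y \<in> B"
      by (auto simp: B_def mem_box_cart forall_3)
    then show "x \<in> f ` B" using y by auto
  qed
  have ne: "B \<noteq> {}" using assms
    by (auto simp: B_def interval_ne_empty_cart forall_3 divide_right_mono)
  have B: "B \<in> lmeasurable" by (simp add: B_def)
  have "measure lebesgue ?S \<le> measure lebesgue (f ` B)"
    using sub S measurable_orthogonal_image[OF f(1) B] by (intro measure_mono_fmeasurable) auto
  also have "\<dots> = measure lebesgue B" by (rule measure_orthogonal_image[OF f(1) B])
  also have "\<dots> = (\<Prod>i\<in>UNIV. (vector [(b + \<epsilon>) / norm u, R, R] :: real^3) $ i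
       - (vector [(b - \<epsilon>) / norm u, - R, - R] :: real^3) $ i)"
    using ne unfolding B_def by (simp add: content_cbox_cart)
  also have "\<dots> = ((b + \<epsilon>) / norm u - (b - \<epsilon>) / norm u) * (2 * R) * (2 * R)"
    unfolding UNIV_3 by simp
  also have "\<dots> = 8 * R\<^sup>2 * \<epsilon> / norm u"
    by (simp add: power2_eq_square flip: diff_divide_distrib)
  finally show "measure lebesgue ?S \<le> 8 * R\<^sup>2 * \<epsilon> / norm u" .
qed

text \<open>Linear form of a power diagram: minimising |x - z_i|^2 - p_i over i is maximising x .
  z_i - w_i with w_i = (|z_i|^2 - p_i) / 2.\<close>

definition max_affine :: "nat \<Rightarrow> (nat \<Rightarrow> R3) \<Rightarrow> (nat \<Rightarrow> real) \<Rightarrow> R3 \<Rightarrow> real" where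
  "max_affine N z w x = Max ((\<lambda>i. x \<bullet> z i - w i) ` {..<N})"

lemma max_affine_ge: "i < N \<Longrightarrow> x \<bullet> z i - w i \<le> max_affine N z w x"
  by (simp add: max_affine_def)

lemma max_affine_le: "N > 0 \<Longrightarrow> (\<And>i. i < N \<Longrightarrow> x \<bullet> z i - w i \<le> c) \<Longrightarrow> max_affine N z w x \<le> c"
  unfolding max_affine_def by (rule Max.boundedI) auto

lemma max_affine_attained:
  assumes "N > 0" obtains i where "i < N" "max_affine N z w x = x \<bullet> z i - w i"
proof -
  have "max_affine N z w x \<in> (\<lambda>i. x \<bullet> z i - w i) ` {..<N}"
    unfolding max_affine_def using assms by (intro Max_in) auto
  with that show thesis by auto
qed

lemma max_affine_cong:
  "(\<And>i. i < N \<Longrightarrow> w i = w' i) \<Longrightarrow> (\<And>i. i < N \<Longrightarrow> z i = z' i) \<Longrightarrow> max_affine N z w = max_affine N z' w'"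
  unfolding max_affine_def by (intro ext arg_cong[where f=Max] image_cong) auto

lemma max_affine_measurable [measurable]: "max_affine N z w \<in> borel_measurable borel"
  unfolding max_affine_def by (intro borel_measurable_Max) auto

lemma max_affine_diff_le:
  assumes "N > 0" "\<And>i. i < N \<Longrightarrow> \<bar>(x \<bullet> z i - w i) - (x \<bullet> z' i - w' i)\<bar> \<le> e"
  shows "\<bar>max_affine N z w x - max_affine N z' w' x\<bar> \<le> e"
proof -
  have "max_affine N z w x \<le> max_affine N z' w' x + e"
    using assms(2) max_affine_ge[of _ N x z' w'] by (intro max_affine_le[OF assms(1)]) (smt (verit))
  moreover have "max_affine N z' w' x \<le> max_affine N z w x + e"
    using assms(2) max_affine_ge[of _ N x z w] by (intro max_affine_le[OF assms(1)]) (smt (verit))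
  ultimately show ?thesis by linarith
qed

lemma convex_on_max_affine:
  assumes "N > 0" "convex S" shows "convex_on S (max_affine N z w)"
  unfolding convex_on_def
proof (intro conjI ballI allI impI)
  fix x y and u v :: real assume uv: "0 \<le> u" "0 \<le> v" "u + v = 1"
  show "max_affine N z w (u *\<^sub>R x + v *\<^sub>R y) \<le> u * max_affine N z w x + v * max_affine N z w y"
  proof (rule max_affine_le[OF assms(1)])
    fix i assume i: "i < N"
    have "(u *\<^sub>R x + v *\<^sub>R y) \<bullet> z i - w i = u * (x \<bullet> z i - w i) + v * (y \<bullet> z i - w i)"
      using uv(3) by (simp add: inner_add_left algebra_simps) (metis distrib_right mult_1)
    also have "\<dots> \<le> u * max_affine N z w x + v * max_affine N z w y"
      using uv i by (intro add_mono mult_left_mono max_affine_ge) auto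
    finally show "(u *\<^sub>R x + v *\<^sub>R y) \<bullet> z i - w i \<le> u * max_affine N z w x + v * max_affine N z w y" .
  qed
qed fact

text \<open>Weights are functions on all natural numbers, so the compact set for the minimisation is
  an infinite product and compactness is Tychonoff's theorem.\<close>

lemma compact_nat_box: "compact (PiE UNIV (\<lambda>_::nat. {0..B::real}))"
  using compactin_PiE[of "\<lambda>_::nat. euclidean :: real topology" UNIV "\<lambda>_. {0..B}"]
  by (simp add: euclidean_product_topology)

lemma separation:
  fixes z :: "nat \<Rightarrow> R3"
  assumes "inj_on z {..<N}"
  obtains \<delta> where "\<delta> > 0" "\<And>i j. i < N \<Longrightarrow> j < N \<Longrightarrow> i \<noteq> j \<Longrightarrow> norm (z i - z j) \<ge> \<delta>"
proof -
  \<comment> \<open>The extra element 1 keeps the set nonempty when there are fewer than two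
    points.\<close>
  define D where "D = insert 1 ((\<lambda>(i,j). norm (z i - z j)) ` ({(i,j). i < N \<and> j < N \<and> i \<noteq> j}))"
  have "finite {(i,j). i < N \<and> j < N \<and> i \<noteq> j}"
    by (rule finite_subset[of _ "{..<N} \<times> {..<N}"]) auto
  then have f: "finite D" by (simp add: D_def)
  have "\<And>d. d \<in> D \<Longrightarrow> d > 0" using assms by (auto simp: D_def dest: inj_onD)
  then have "Min D > 0" using f by (subst Min_gr_iff) (auto simp: D_def)
  moreover have "norm (z i - z j) \<ge> Min D" if "i < N" "j < N" "i \<noteq> j" for i j
    using f that by (intro Min_le) (auto simp: D_def)
  ultimately show thesis using that by blast
qed

text \<open>Stands in for the first-order condition at a minimum of a function that is only known to
  have a quadratic upper expansion; increments of both signs make it work.\<close>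

lemma quadratic_nonneg_imp_zero:
  fixes a C :: real
  assumes "\<And>t. 0 \<le> t * a + C * t\<^sup>2" shows "a = 0"
proof (rule ccontr)
  assume a: "a \<noteq> 0"
  define D where "D = \<bar>C\<bar> + 1"
  have D: "D > 0" "C < D" by (auto simp: D_def)
  \<comment> \<open>With \<open>D\<close> in place of \<open>C\<close> the value at t = -a/D would
    be exactly 0, and \<open>D\<close> is strictly larger than \<open>C\<close>.\<close>
  have "(-a/D) * a + C * (-a/D)\<^sup>2 < (-a/D) * a + D * (-a/D)\<^sup>2"
    using D a by (intro add_strict_left_mono mult_strict_right_mono) auto
  also have "\<dots> = 0" using D by (simp add: power2_eq_square field_simps)
  finally show False using assms[of "-a/D"] by linarith
qed

section \<open>Laguerre cells, their volumes and first moments\<close>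

locale source_domain =
  fixes \<Omega> :: "R3 set"
  assumes open_dom: "open \<Omega>" and bounded_dom: "bounded \<Omega>" and convex_dom: "convex \<Omega>"
    and emeasure_dom: "emeasure lebesgue \<Omega> = 1"
begin

abbreviation "M \<equiv> lebesgue_on \<Omega>"

lemma sets_dom: "\<Omega> \<in> sets lebesgue" "\<Omega> \<in> sets borel"
  using open_dom by (auto intro: borel_open)

lemma prob_space_M: "prob_space M"
  by standard (simp add: emeasure_restrict_space sets_dom emeasure_dom)

sublocale M: prob_space M by (rule prob_space_M)

lemma measure_M_UNIV: "measure M \<Omega> = 1"
  using M.prob_space by simp

definition rad :: real where "rad = (SOME R. R > 0 \<and> (\<forall>x\<in>\<Omega>. norm x \<le> R))"

lemma rad_pos: "rad > 0" and norm_le_rad: "x \<in> \<Omega> \<Longrightarrow> norm x \<le> rad"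
proof -
  have "\<exists>R. R > 0 \<and> (\<forall>x\<in>\<Omega>. norm x \<le> R)"
    using bounded_dom by (simp add: bounded_pos)
  from someI_ex[OF this] show "rad > 0" and "x \<in> \<Omega> \<Longrightarrow> norm x \<le> rad"
    unfolding rad_def by auto
qed

lemma measurable_M: "f \<in> borel \<rightarrow>\<^sub>M L \<Longrightarrow> f \<in> M \<rightarrow>\<^sub>M L"
  by (intro measurable_restrict_space1 measurable_completion) simp

lemma integrable_M:
  fixes f :: "R3 \<Rightarrow> 'b::{banach, second_countable_topology}"
  assumes "f \<in> borel_measurable borel" "\<And>x. x \<in> \<Omega> \<Longrightarrow> norm (f x) \<le> B"
  shows "integrable M f"
  by (rule M.integrable_const_bound[of _ B]) (use assms measurable_M in \<open>auto intro!: AE_I2\<close>)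

lemma AE_M_iff: "(AE x in M. P x) \<longleftrightarrow> (AE x in lebesgue. x \<in> \<Omega> \<longrightarrow> P x)"
  using sets_dom by (simp add: AE_restrict_space_iff)

lemma measure_M: "A \<subseteq> \<Omega> \<Longrightarrow> measure M A = measure lebesgue A"
  using sets_dom by (simp add: measure_restrict_space)

lemma emeasure_M: "A \<subseteq> \<Omega> \<Longrightarrow> emeasure M A = emeasure lebesgue A"
  using sets_dom by (simp add: emeasure_restrict_space)

text \<open>Strict inequalities make the cells open and disjoint, so the potential is affine near
  each of their points; the price is that they cover the domain only almost everywhere.\<close>

definition cell :: "nat \<Rightarrow> (nat \<Rightarrow> R3) \<Rightarrow> (nat \<Rightarrow> real) \<Rightarrow> nat \<Rightarrow> R3 set" where
  "cell N z w i = {x\<in>\<Omega>. \<forall>j<N. j \<noteq> i \<longrightarrow> x \<bullet> z j - w j < x \<bullet> z i - w i}"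

lemma cell_subset: "cell N z w i \<subseteq> \<Omega>"
  by (auto simp: cell_def)

lemma open_cell: "open (cell N z w i)"
proof -
  have "cell N z w i = \<Omega> \<inter> (\<Inter>j\<in>{..<N} - {i}. {x. x \<bullet> z j - w j < x \<bullet> z i - w i})"
    by (auto simp: cell_def)
  also have "open \<dots>"
    by (intro open_Int open_dom open_INT) (auto intro!: open_Collect_less continuous_intros)
  finally show ?thesis .
qed

lemma cell_measurable [measurable]: "cell N z w i \<in> sets borel"
  using open_cell by (rule borel_open)

lemma cell_disjoint: "x \<in> cell N z w i \<Longrightarrow> x \<in> cell N z w j \<Longrightarrow> i < N \<Longrightarrow> j < N \<Longrightarrow> i = j"
  unfolding cell_def by (metis (mono_tags, lifting) mem_Collect_eq not_less_iff_gr_or_eq)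

lemma max_affine_cell:
  assumes "x \<in> cell N z w i" "i < N" shows "max_affine N z w x = x \<bullet> z i - w i"
proof (rule antisym)
  show "max_affine N z w x \<le> x \<bullet> z i - w i"
    using assms by (intro max_affine_le) (force simp: cell_def)+
qed (use assms max_affine_ge in auto)

text \<open>A point in no cell has a tie between two maximisers, hence lies on one of finitely many
  hyperplanes; these are proper because the sites are distinct.\<close>

lemma AE_cell:
  assumes "N > 0" "inj_on z {..<N}"
  shows "AE x in M. \<exists>i<N. x \<in> cell N z w i"
proof -
  define H where "H = (\<Union>(i,j)\<in>{(i,j). i < N \<and> j < N \<and> i \<noteq> j}. {x. (z i - z j) \<bullet> x = w i - w j})"
  have fin: "finite {(i,j). i < N \<and> j < N \<and> i \<noteq> j}"
    by (rule finite_subset[of _ "{..<N} \<times> {..<N}"]) auto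
  have "negligible H"
    unfolding H_def using assms(2) fin
    by (auto intro!: negligible_Union negligible_hyperplane dest: inj_onD)
  then have "AE x in lebesgue. x \<notin> H"
    by (simp add: negligible_iff_null_sets AE_not_in)
  then have "AE x in M. x \<notin> H" by (auto simp: AE_M_iff)
  then show ?thesis
  proof (rule AE_mp[OF _ AE_I2], intro impI)
    fix x assume x: "x \<in> space M" "x \<notin> H"
    obtain i where i: "i < N" "max_affine N z w x = x \<bullet> z i - w i"
      using max_affine_attained[OF assms(1)] by blast
    have "x \<bullet> z j - w j < x \<bullet> z i - w i" if "j < N" "j \<noteq> i" for j
    proof -
      have "x \<bullet> z j - w j \<le> x \<bullet> z i - w i" using max_affine_ge[OF that(1)] i by metis
      moreover have "(z i - z j) \<bullet> x \<noteq> w i - w j" using x(2) that i unfolding H_def by blast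
      then have "x \<bullet> z j - w j \<noteq> x \<bullet> z i - w i" by (auto simp: inner_diff_left inner_diff_right inner_commute)
      ultimately show ?thesis by simp
    qed
    then have "x \<in> cell N z w i" using x by (auto simp: cell_def)
    with i show "\<exists>i<N. x \<in> cell N z w i" by auto
  qed
qed

lemma sum_indicator_cell:
  assumes "x \<in> cell N z w i" "i < N"
  shows "(\<Sum>j<N. indicator (cell N z w j) x *\<^sub>R f j) = (f i :: 'b::real_vector)"
proof -
  have "(\<Sum>j<N. indicator (cell N z w j) x *\<^sub>R f j) = (\<Sum>j<N. if j = i then f j else 0)"
    using assms by (intro sum.cong) (auto simp: indicator_def dest: cell_disjoint)
  then show ?thesis using assms by simp
qed

lemma sum_indicator_cell_real:
  assumes "x \<in> cell N z w i" "i < N"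
  shows "(\<Sum>j<N. indicator (cell N z w j) x * f j) = (f i :: real)"
  using sum_indicator_cell[OF assms, of f] by simp

definition moment :: "nat \<Rightarrow> (nat \<Rightarrow> R3) \<Rightarrow> (nat \<Rightarrow> real) \<Rightarrow> nat \<Rightarrow> R3" where
  "moment N z w i = (LINT x|M. indicator (cell N z w i) x *\<^sub>R x)"

lemma integrable_moment: "integrable M (\<lambda>x. indicator (cell N z w i) x *\<^sub>R x)"
  using norm_le_rad rad_pos by (intro integrable_M[of _ rad]) (auto simp: indicator_def)

lemma integrable_indicator_cell: "integrable M (\<lambda>x. indicator (cell N z w i) x :: real)"
  by (intro integrable_M[of _ 1]) (auto simp: indicator_def)

lemma integral_indicator_cell: "(LINT x|M. indicator (cell N z w i) x :: real) = measure lebesgue (cell N z w i)"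
proof -
  have "cell N z w i \<in> sets M"
    using cell_subset sets_dom by (auto simp: sets_restrict_space_iff)
  then show ?thesis using measure_M[OF cell_subset] by (simp add: Int_absorb2 cell_subset)
qed

lemma integral_cell_affine:
  "integrable M (\<lambda>x. indicator (cell N z w i) x * (x \<bullet> h - k))"
  "(LINT x|M. indicator (cell N z w i) x * (x \<bullet> h - k)) = moment N z w i \<bullet> h - k * measure lebesgue (cell N z w i)"
proof -
  have eq: "indicator (cell N z w i) x * (x \<bullet> h - k) = (indicator (cell N z w i) x *\<^sub>R x) \<bullet> h - k * indicator (cell N z w i) x" for x
    by (auto simp: indicator_def)
  show "integrable M (\<lambda>x. indicator (cell N z w i) x * (x \<bullet> h - k))"
    unfolding eq by (intro Bochner_Integration.integrable_diff integrable_inner_left integrable_mult_right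
      integrable_moment integrable_indicator_cell)
  show "(LINT x|M. indicator (cell N z w i) x * (x \<bullet> h - k)) = moment N z w i \<bullet> h - k * measure lebesgue (cell N z w i)"
    unfolding eq moment_def integral_indicator_cell[symmetric]
    by (subst Bochner_Integration.integral_diff) (auto intro!: integrable_moment integrable_indicator_cell integral_inner_left simp del: integral_indicator inner_scaleR_left)
qed

section \<open>The dual functional and its quadratic upper expansion\<close>

definition dual :: "nat \<Rightarrow> (nat \<Rightarrow> R3) \<Rightarrow> (nat \<Rightarrow> real) \<Rightarrow> real" where
  "dual N z w = (LINT x|M. max_affine N z w x)"

lemma abs_inner_le: "x \<in> \<Omega> \<Longrightarrow> \<bar>x \<bullet> u\<bar> \<le> rad * norm u"
  using Cauchy_Schwarz_ineq2[of x u] norm_le_rad[of x] mult_right_mono[of "norm x" rad "norm u"] by force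

lemma integrable_max_affine:
  assumes "N > 0" shows "integrable M (max_affine N z w)"
proof (rule integrable_M)
  fix x assume x: "x \<in> \<Omega>"
  let ?B = "(\<Sum>i<N. rad * norm (z i) + \<bar>w i\<bar>)"
  obtain i where i: "i < N" "max_affine N z w x = x \<bullet> z i - w i"
    using max_affine_attained[OF assms] by blast
  have "\<bar>x \<bullet> z i - w i\<bar> \<le> rad * norm (z i) + \<bar>w i\<bar>" using abs_inner_le[OF x, of "z i"] by linarith
  also have "\<dots> \<le> ?B" using i rad_pos by (intro member_le_sum) auto
  finally show "norm (max_affine N z w x) \<le> ?B" using i by simp
qed simp

text \<open>Away from the slabs around the cell boundaries a perturbation of size \<open>\<epsilon>\<close> does not
  change the maximising index; the slabs have volume \<open>O(\<epsilon>)\<close>, whence the quadratic error.\<close>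

lemma dual_perturb:
  assumes N: "N > 0" and \<delta>: "\<delta> > 0" "\<And>i j. i < N \<Longrightarrow> j < N \<Longrightarrow> i \<noteq> j \<Longrightarrow> norm (z i - z j) \<ge> \<delta>"
    and \<epsilon>: "\<epsilon> \<ge> 0" "\<And>x i. x \<in> \<Omega> \<Longrightarrow> i < N \<Longrightarrow> \<bar>x \<bullet> h i - k i\<bar> \<le> \<epsilon>"
  shows "dual N (\<lambda>i. z i + h i) (\<lambda>i. w i + k i) \<le> dual N z w
     + (\<Sum>i<N. moment N z w i \<bullet> h i - k i * measure lebesgue (cell N z w i)) + 32 * (real N)\<^sup>2 * rad\<^sup>2 * \<epsilon>\<^sup>2 / \<delta>"
proof -
  have inj: "inj_on z {..<N}" using \<delta> by (force intro!: inj_onI)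
  define P where "P = {(i,j). i < N \<and> j < N \<and> i \<noteq> j}"
  have P: "finite P" "card P \<le> N * N"
  proof -
    have s: "P \<subseteq> {..<N} \<times> {..<N}" by (auto simp: P_def)
    then show "finite P" by (rule finite_subset) auto
    show "card P \<le> N * N" using card_mono[OF _ s] by (simp add: card_cartesian_product)
  qed
  \<comment> \<open>A rival can gain at most \<open>\<epsilon>\<close> while the leader loses at
    most \<open>\<epsilon>\<close>, so the maximiser can change only where the gap is at most
    \<open>2 * \<epsilon>\<close>.\<close>
  define S where "S = (\<lambda>(i,j). {x\<in>\<Omega>. \<bar>x \<bullet> (z i - z j) - (w i - w j)\<bar> \<le> 2 * \<epsilon>})"
  have Sb: "S p \<in> sets borel" for p
  proof -
    obtain i j where p: "p = (i,j)" by (cases p)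
    have "S p = \<Omega> \<inter> {x. \<bar>x \<bullet> (z i - z j) - (w i - w j)\<bar> \<le> 2 * \<epsilon>}" by (auto simp: S_def p)
    also have "\<dots> \<in> sets borel" using sets_dom
      by (intro sets.Int sets_dom borel_closed closed_Collect_le continuous_intros)
    finally show ?thesis .
  qed
  have Si: "integrable M (\<lambda>x. indicator (S p) x :: real)" for p
    using Sb by (intro integrable_M[of _ 1]) (auto simp: indicator_def)
  have Sle: "(LINT x|M. indicator (S p) x) \<le> 16 * rad\<^sup>2 * \<epsilon> / \<delta>" if p: "p \<in> P" for p
  proof -
    obtain i j where ij: "p = (i,j)" "i < N" "j < N" "i \<noteq> j" using p by (auto simp: P_def)
    have S\<Omega>: "S p \<subseteq> \<Omega>" by (auto simp: S_def ij)
    have n: "z i - z j \<noteq> 0" "norm (z i - z j) \<ge> \<delta>" using \<delta> ij(2-) by fastforce+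
    let ?T = "{x. norm x \<le> rad \<and> \<bar>x \<bullet> (z i - z j) - (w i - w j)\<bar> \<le> 2 * \<epsilon>}"
    have "S p \<in> sets M" using S\<Omega> Sb sets_dom by (auto simp: sets_restrict_space_iff)
    then have "(LINT x|M. indicator (S p) x) = measure lebesgue (S p)"
      using S\<Omega> measure_M[OF S\<Omega>] by (simp add: Int_absorb2)
    also have "\<dots> \<le> measure lebesgue ?T"
      using measure_slab_le(1)[OF n(1), of "2*\<epsilon>" rad "w i - w j"] Sb rad_pos \<epsilon> norm_le_rad
      by (intro measure_mono_fmeasurable) (auto simp: S_def ij)
    also have "\<dots> \<le> 8 * rad\<^sup>2 * (2 * \<epsilon>) / norm (z i - z j)"
      using n \<epsilon> rad_pos by (intro measure_slab_le) auto
    also have "\<dots> \<le> 8 * rad\<^sup>2 * (2 * \<epsilon>) / \<delta>"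
      using n \<epsilon> \<delta> by (intro divide_left_mono) auto
    finally show ?thesis by simp
  qed
  let ?b = "\<lambda>x. \<Sum>i<N. indicator (cell N z w i) x * (x \<bullet> h i - k i)"
  \<comment> \<open>Inside a slab the maximum rises by at most \<open>\<epsilon>\<close> while the
    linear term is at least \<open>- \<epsilon>\<close>; hence a penalty of
    \<open>2 * \<epsilon>\<close> for each slab containing the point.\<close>
  have pw: "AE x in M. max_affine N (\<lambda>i. z i + h i) (\<lambda>i. w i + k i) x
      \<le> max_affine N z w x + ?b x + 2 * \<epsilon> * (\<Sum>p\<in>P. indicator (S p) x)"
    using AE_cell[OF N inj]
  proof (rule AE_mp[OF _ AE_I2], intro impI)
    fix x assume x: "x \<in> space M" and "\<exists>i<N. x \<in> cell N z w i"
    then obtain i where i: "i < N" "x \<in> cell N z w i" by blast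
    have \<epsilon>': "\<bar>x \<bullet> h j - k j\<bar> \<le> \<epsilon>" if "j < N" for j using \<epsilon> x that by auto
    have b: "?b x = x \<bullet> h i - k i"
      using sum_indicator_cell_real[OF i(2,1), of "\<lambda>i. x \<bullet> h i - k i"] by simp
    have m: "max_affine N z w x = x \<bullet> z i - w i" using max_affine_cell i by blast
    show "max_affine N (\<lambda>i. z i + h i) (\<lambda>i. w i + k i) x
      \<le> max_affine N z w x + ?b x + 2 * \<epsilon> * (\<Sum>p\<in>P. indicator (S p) x)"
    proof (cases "\<exists>j<N. j \<noteq> i \<and> x \<in> S (i,j)")
      case False
      have "max_affine N (\<lambda>i. z i + h i) (\<lambda>i. w i + k i) x \<le> (x \<bullet> z i - w i) + (x \<bullet> h i - k i)"
      proof (rule max_affine_le[OF N])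
        fix j assume j: "j < N"
        show "x \<bullet> (z j + h j) - (w j + k j) \<le> (x \<bullet> z i - w i) + (x \<bullet> h i - k i)"
        proof (cases "j = i")
          case False
          then have "\<not> \<bar>x \<bullet> (z i - z j) - (w i - w j)\<bar> \<le> 2 * \<epsilon>"
            using \<open>\<not> (\<exists>j<N. j \<noteq> i \<and> x \<in> S (i,j))\<close> j x by (auto simp: S_def)
          moreover have "x \<bullet> z j - w j < x \<bullet> z i - w i" using i j False by (auto simp: cell_def)
          ultimately show ?thesis using \<epsilon>'[OF j] \<epsilon>'[OF i(1)]
            by (simp add: inner_add_right inner_diff_right abs_le_iff)
        qed (simp add: inner_add_right)
      qed
      also have "\<dots> \<le> max_affine N z w x + ?b x + 2 * \<epsilon> * (\<Sum>p\<in>P. indicator (S p) x)"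
        unfolding m b using \<epsilon>(1) by (simp add: sum_nonneg)
      finally show ?thesis .
    next
      case True
      then obtain j where j: "j < N" "j \<noteq> i" "x \<in> S (i,j)" by blast
      have "max_affine N (\<lambda>i. z i + h i) (\<lambda>i. w i + k i) x \<le> max_affine N z w x + \<epsilon>"
        using max_affine_diff_le[OF N, of x "\<lambda>i. z i + h i" "\<lambda>i. w i + k i" z w \<epsilon>] \<epsilon>'
        by (simp add: inner_add_right)
      moreover have "- \<epsilon> \<le> ?b x" unfolding b using \<epsilon>'[OF i(1)] by linarith
      moreover have "1 \<le> (\<Sum>p\<in>P. indicator (S p) x :: real)"
      proof -
        have "(indicator (S (i,j)) x :: real) \<le> (\<Sum>p\<in>P. indicator (S p) x)"
          using P i j by (intro member_le_sum) (auto simp: P_def)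
        then show ?thesis using j by simp
      qed
      then have "2 * \<epsilon> * 1 \<le> 2 * \<epsilon> * (\<Sum>p\<in>P. indicator (S p) x)"
        using \<epsilon>(1) by (intro mult_left_mono) auto
      ultimately show ?thesis by linarith
    qed
  qed
  define g where "g i x = indicator (cell N z w i) x * (x \<bullet> h i - k i)" for i x
  define s where "s p x = (indicator (S p) x :: real)" for p x
  have g: "integrable M (g i)" "(LINT x|M. g i x) = moment N z w i \<bullet> h i - k i * measure lebesgue (cell N z w i)" for i
    unfolding g_def by (rule integral_cell_affine)+
  have s: "integrable M (s p)" for p unfolding s_def by (rule Si)
  have pw': "AE x in M. max_affine N (\<lambda>i. z i + h i) (\<lambda>i. w i + k i) x
      \<le> max_affine N z w x + (\<Sum>i<N. g i x) + 2 * \<epsilon> * (\<Sum>p\<in>P. s p x)"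
    using pw unfolding g_def s_def .
  have "dual N (\<lambda>i. z i + h i) (\<lambda>i. w i + k i) \<le>
     (LINT x|M. max_affine N z w x + (\<Sum>i<N. g i x) + 2 * \<epsilon> * (\<Sum>p\<in>P. s p x))"
    unfolding dual_def
    by (rule integral_mono_AE[OF _ _ pw'])
       (intro Bochner_Integration.integrable_add integrable_mult_right Bochner_Integration.integrable_sum
          integrable_max_affine N g s)+
  also have "\<dots> = dual N z w + (\<Sum>i<N. moment N z w i \<bullet> h i - k i * measure lebesgue (cell N z w i))
     + 2 * \<epsilon> * (\<Sum>p\<in>P. (LINT x|M. s p x))"
    unfolding dual_def by (simp add: integrable_max_affine N g s)
  \<comment> \<open>At most \<open>N * N\<close> slabs, each of volume at most
    \<open>16 * rad\<^sup>2 * \<epsilon> / \<delta>\<close> and penalty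
    \<open>2 * \<epsilon>\<close>: this is the constant 32.\<close>
  also have "\<dots> \<le> dual N z w + (\<Sum>i<N. moment N z w i \<bullet> h i - k i * measure lebesgue (cell N z w i))
     + 2 * \<epsilon> * (real (N * N) * (16 * rad\<^sup>2 * \<epsilon> / \<delta>))"
  proof -
    have "(\<Sum>p\<in>P. (LINT x|M. s p x)) \<le> (\<Sum>p\<in>P. 16 * rad\<^sup>2 * \<epsilon> / \<delta>)"
      unfolding s_def by (intro sum_mono Sle)
    also have "\<dots> \<le> real (N * N) * (16 * rad\<^sup>2 * \<epsilon> / \<delta>)"
      using P \<epsilon> \<delta> unfolding sum_constant by (intro mult_right_mono of_nat_mono) auto
    finally show ?thesis using \<epsilon>(1) by (intro add_left_mono mult_left_mono) auto
  qed
  finally show ?thesis by (simp add: power2_eq_square mult_ac)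
qed

section \<open>Weights with prescribed cell volumes\<close>

definition tessellates :: "nat \<Rightarrow> (nat \<Rightarrow> real) \<Rightarrow> (nat \<Rightarrow> R3) \<Rightarrow> (nat \<Rightarrow> real) \<Rightarrow> bool" where
  "tessellates N m z w \<longleftrightarrow> (\<forall>i<N. measure lebesgue (cell N z w i) = m i)"

lemma dual_diff_le:
  assumes "N > 0" shows "\<bar>dual N z w - dual N z w'\<bar> \<le> (\<Sum>i<N. \<bar>w i - w' i\<bar>)"
proof -
  have "dual N z w - dual N z w' = (LINT x|M. max_affine N z w x - max_affine N z w' x)"
    unfolding dual_def using assms by (simp add: integrable_max_affine)
  also have "\<bar>\<dots>\<bar> \<le> (LINT x|M. (\<Sum>i<N. \<bar>w i - w' i\<bar>))"
  proof (rule order_trans[OF integral_abs_bound integral_mono])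
    show "integrable M (\<lambda>x. \<bar>max_affine N z w x - max_affine N z w' x\<bar>)"
      using assms by (auto simp: integrable_max_affine)
    show "\<bar>max_affine N z w x - max_affine N z w' x\<bar> \<le> (\<Sum>i<N. \<bar>w i - w' i\<bar>)" for x
    proof (rule max_affine_diff_le[OF assms])
      fix i assume "i < N"
      then have "\<bar>w i - w' i\<bar> \<le> (\<Sum>i<N. \<bar>w i - w' i\<bar>)" by (intro member_le_sum) auto
      then show "\<bar>(x \<bullet> z i - w i) - (x \<bullet> z i - w' i)\<bar> \<le> (\<Sum>i<N. \<bar>w i - w' i\<bar>)" by simp
    qed
  qed simp
  finally show ?thesis by (simp add: measure_M_UNIV)
qed

lemma dual_shift:
  assumes "N > 0" shows "dual N z (\<lambda>i. w i - c) = dual N z w + c"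
proof -
  have "max_affine N z (\<lambda>i. w i - c) x = max_affine N z w x + c" for x
  proof (rule antisym)
    show "max_affine N z (\<lambda>i. w i - c) x \<le> max_affine N z w x + c"
      using max_affine_ge[of _ N x z w] by (intro max_affine_le[OF assms]) force
    have "max_affine N z w x \<le> max_affine N z (\<lambda>i. w i - c) x - c"
      using max_affine_ge[of _ N x z "\<lambda>i. w i - c"] by (intro max_affine_le[OF assms]) force
    then show "max_affine N z w x + c \<le> max_affine N z (\<lambda>i. w i - c) x" by simp
  qed
  then have "max_affine N z (\<lambda>i. w i - c) = (\<lambda>x. max_affine N z w x + c)" by blast
  then show ?thesis unfolding dual_def using assms by (simp add: integrable_max_affine measure_M_UNIV)
qed

text \<open>The dual functional is invariant under adding constants to the weights and coercive modulo
  constants.\<close>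

lemma dual_has_minimum:
  assumes N: "N > 0" and m: "mass_vector N m"
  obtains w where "\<And>w'. dual N z w + (\<Sum>i<N. m i * w i) \<le> dual N z w' + (\<Sum>i<N. m i * w' i)"
proof -
  define \<Psi> where "\<Psi> w = dual N z w + (\<Sum>i<N. m i * w i)" for w
  define Z where "Z = (\<Sum>i<N. rad * norm (z i))"
  have Z: "rad * norm (z i) \<le> Z" if "i < N" for i
    unfolding Z_def using that rad_pos by (intro member_le_sum) auto
  have mp: "m i > 0" if "i < N" for i using m that by (auto simp: mass_vector_def)
  define \<mu> where "\<mu> = Min (m ` {..<N})"
  have \<mu>: "\<mu> > 0" "\<And>i. i < N \<Longrightarrow> \<mu> \<le> m i"
    using mp N by (auto simp: \<mu>_def) (subst Min_gr_iff; auto)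
  \<comment> \<open>Chosen for coercivity: once the smallest weight is 0, a weight above
    \<open>B\<close> pushes the functional to at least \<open>- Z + \<mu> * B = Z\<close>, which is
    no better than the value at zero weights.\<close>
  define B where "B = 2 * Z / \<mu>"
  have "Z \<ge> 0" unfolding Z_def using rad_pos by (intro sum_nonneg) auto
  then have B: "B \<ge> 0" using \<mu> by (simp add: B_def)
  have diff: "\<bar>\<Psi> w' - \<Psi> w\<bar> \<le> (\<Sum>i<N. \<bar>w' i - w i\<bar>) + (\<Sum>i<N. m i * \<bar>w' i - w i\<bar>)" for w w'
  proof -
    have "\<Psi> w' - \<Psi> w = (dual N z w' - dual N z w) + (\<Sum>i<N. m i * (w' i - w i))"
      by (simp add: \<Psi>_def right_diff_distrib sum_subtractf)
    moreover have "\<bar>\<Sum>i<N. m i * (w' i - w i)\<bar> \<le> (\<Sum>i<N. m i * \<bar>w' i - w i\<bar>)"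
      by (rule order_trans[OF sum_abs]) (auto intro!: sum_mono simp: abs_mult dest: mp)
    ultimately show ?thesis using dual_diff_le[OF N, of z w' w] by linarith
  qed
  have cont: "continuous_on A \<Psi>" for A
    unfolding continuous_on_def
  proof
    fix w :: "nat \<Rightarrow> real"
    let ?F = "at w within A"
    have co: "((\<lambda>w'. w' i) \<longlongrightarrow> w i) ?F" for i
    proof -
      have "continuous_on UNIV (\<lambda>w :: nat \<Rightarrow> real. w i)" by (rule continuous_on_product_coordinates)
      then have "((\<lambda>w'. w' i) \<longlongrightarrow> w i) (at w)" by (auto simp: continuous_on_def)
      then show ?thesis by (rule tendsto_within_subset) auto
    qed
    have "((\<lambda>w'. (\<Sum>i<N. \<bar>w' i - w i\<bar>) + (\<Sum>i<N. m i * \<bar>w' i - w i\<bar>))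
       \<longlongrightarrow> (\<Sum>i<N. \<bar>w i - w i\<bar>) + (\<Sum>i<N. m i * \<bar>w i - w i\<bar>)) ?F"
      by (intro tendsto_intros co)
    then have "((\<lambda>w'. (\<Sum>i<N. \<bar>w' i - w i\<bar>) + (\<Sum>i<N. m i * \<bar>w' i - w i\<bar>)) \<longlongrightarrow> 0) ?F" by simp
    then have "((\<lambda>w'. \<Psi> w' - \<Psi> w) \<longlongrightarrow> 0) ?F"
      by (rule Lim_null_comparison[rotated]) (auto intro!: always_eventually diff)
    then show "(\<Psi> \<longlongrightarrow> \<Psi> w) ?F" by (rule Lim_null[THEN iffD2])
  qed
  let ?X = "PiE UNIV (\<lambda>_::nat. {0..B})"
  have 0: "(\<lambda>_. 0) \<in> ?X" using B by auto
  obtain w where w: "w \<in> ?X" "\<And>w'. w' \<in> ?X \<Longrightarrow> \<Psi> w \<le> \<Psi> w'"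
    using continuous_attains_inf[OF compact_nat_box _ cont, of B] 0 by blast
  \<comment> \<open>The dual functional grows by c while the mass term drops by c, since the total
    mass is one. Weights may thus be normalised to have minimum 0.\<close>
  have shift: "\<Psi> (\<lambda>i. v i - c) = \<Psi> v" for v c
    using m by (simp add: \<Psi>_def dual_shift N right_diff_distrib sum_subtractf mass_vector_def flip: sum_distrib_right)
  have \<Psi>0: "\<Psi> (\<lambda>_. 0) \<le> Z"
  proof -
    have "dual N z (\<lambda>_. 0) \<le> (LINT x|M. Z)"
      unfolding dual_def
    proof (rule integral_mono)
      fix x assume "x \<in> space M"
      then have "x \<bullet> z i - 0 \<le> Z" if "i < N" for i
        using abs_inner_le[of x "z i"] Z[OF that] by simp
      then show "max_affine N z (\<lambda>_. 0) x \<le> Z" by (intro max_affine_le N)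
    qed (auto simp: integrable_max_affine N)
    then show ?thesis by (simp add: \<Psi>_def measure_M_UNIV)
  qed
  have "\<Psi> w \<le> \<Psi> w'" for w'
  proof -
    define c where "c = Min (w' ` {..<N})"
    define v where "v = (\<lambda>i. w' i - c)"
    have "c \<in> w' ` {..<N}" unfolding c_def using N by (intro Min_in) auto
    then obtain k where k: "k < N" "v k = 0" by (auto simp: v_def)
    have v0: "v i \<ge> 0" if "i < N" for i using that by (auto simp: v_def c_def)
    have "\<Psi> w \<le> \<Psi> v"
    proof (cases "\<exists>j<N. v j > B")
      case False
      \<comment> \<open>The box constrains every entry of the sequence, although only the first
        \<open>N\<close> matter; the others are reset to 0 to enter it.\<close>
      define v' where "v' i = (if i < N then v i else 0)" for i
      have "\<Psi> v' = \<Psi> v"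
      proof -
        have "max_affine N z v' = max_affine N z v" by (rule max_affine_cong) (auto simp: v'_def)
        then show ?thesis by (simp add: \<Psi>_def dual_def v'_def)
      qed
      moreover have "v i \<le> B" if "i < N" for i using False that not_less by blast
      then have "v' \<in> ?X" using v0 B by (auto simp: v'_def)
      ultimately show ?thesis using w(2) by metis
    next
      case True
      then obtain j where j: "j < N" "v j > B" by blast
      have "(LINT x|M. - Z) \<le> dual N z v"
        unfolding dual_def
      proof (rule integral_mono)
        fix x assume "x \<in> space M"
        then have "- Z \<le> x \<bullet> z k - v k"
          using abs_inner_le[of x "z k"] Z[OF k(1)] k by simp
        then show "- Z \<le> max_affine N z v x" using max_affine_ge[OF k(1)] order_trans by blast
      qed (auto simp: integrable_max_affine N)
      then have "- Z \<le> dual N z v" by (simp add: measure_M_UNIV)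
      moreover have "m j * v j \<le> (\<Sum>i<N. m i * v i)"
        using j v0 mp by (intro member_le_sum) (auto intro!: mult_nonneg_nonneg intro: less_imp_le)
      moreover have "\<mu> * B \<le> m j * v j" using \<mu> j B mp[OF j(1)] by (intro mult_mono) auto
      moreover have "\<mu> * B = 2 * Z" using \<mu> by (simp add: B_def)
      ultimately have "Z \<le> \<Psi> v" by (simp add: \<Psi>_def)
      then show ?thesis using w(2)[OF 0] \<Psi>0 by linarith
    qed
    also have "\<Psi> v = \<Psi> w'" unfolding v_def by (rule shift)
    finally show ?thesis .
  qed
  then show thesis using that unfolding \<Psi>_def by blast
qed

text \<open>At a minimiser of \<open>dual\<close> plus the mass term, a change of the single weight
  i by t has the linear term t times (m_i minus the volume of cell i), and the remainder is
  quadratic. Stationarity is therefore the volume constraint.\<close>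

lemma ex_tessellates:
  assumes N: "N > 0" and m: "mass_vector N m" and z: "inj_on z {..<N}"
  shows "\<exists>w. tessellates N m z w"
proof -
  obtain w where w: "\<And>w'. dual N z w + (\<Sum>i<N. m i * w i) \<le> dual N z w' + (\<Sum>i<N. m i * w' i)"
    using dual_has_minimum[OF N m] by blast
  obtain \<delta> where \<delta>: "\<delta> > 0" "\<And>i j. i < N \<Longrightarrow> j < N \<Longrightarrow> i \<noteq> j \<Longrightarrow> norm (z i - z j) \<ge> \<delta>"
    using separation[OF z] by blast
  have "measure lebesgue (cell N z w i) = m i" if i: "i < N" for i
  proof -
    have "0 \<le> t * (m i - measure lebesgue (cell N z w i)) + (32 * (real N)\<^sup>2 * rad\<^sup>2 / \<delta>) * t\<^sup>2" for t
    proof -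
      let ?k = "\<lambda>j. if j = i then t else 0"
      have "dual N (\<lambda>i. z i + 0) (\<lambda>i. w i + ?k i) \<le> dual N z w
     + (\<Sum>i<N. moment N z w i \<bullet> 0 - ?k i * measure lebesgue (cell N z w i)) + 32 * (real N)\<^sup>2 * rad\<^sup>2 * \<bar>t\<bar>\<^sup>2 / \<delta>"
        by (rule dual_perturb[OF N \<delta>]) auto
      moreover have "(\<Sum>j<N. moment N z w j \<bullet> 0 - ?k j * measure lebesgue (cell N z w j)) = - t * measure lebesgue (cell N z w i)"
      proof -
        have "(\<Sum>j<N. moment N z w j \<bullet> 0 - ?k j * measure lebesgue (cell N z w j))
          = (\<Sum>j<N. if j = i then - t * measure lebesgue (cell N z w j) else 0)"
          by (intro sum.cong) auto
        then show ?thesis using i by simp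
      qed
      moreover have "(\<Sum>j<N. m j * (w j + ?k j)) = (\<Sum>j<N. m j * w j) + m i * t"
      proof -
        have "(\<Sum>j<N. m j * (w j + ?k j)) = (\<Sum>j<N. m j * w j + (if j = i then m j * t else 0))"
          by (intro sum.cong) (auto simp: algebra_simps)
        then show ?thesis using i by (simp add: sum.distrib)
      qed
      moreover note w[of "\<lambda>j. w j + ?k j"]
      ultimately show ?thesis by (simp add: algebra_simps)
    qed
    then have "m i - measure lebesgue (cell N z w i) = 0" by (rule quadratic_nonneg_imp_zero)
    then show ?thesis by simp
  qed
  then show ?thesis by (auto simp: tessellates_def)
qed

section \<open>Duality and Lipschitz dependence of the moments on the points\<close>

lemma integral_sum_cells:
  assumes "tessellates N m z' w'"
  shows "(LINT x|M. (\<Sum>i<N. indicator (cell N z' w' i) x * (x \<bullet> z i - w i)))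
    = (\<Sum>i<N. moment N z' w' i \<bullet> z i) - (\<Sum>i<N. m i * w i)"
proof -
  have "(LINT x|M. (\<Sum>i<N. indicator (cell N z' w' i) x * (x \<bullet> z i - w i)))
    = (\<Sum>i<N. LINT x|M. indicator (cell N z' w' i) x * (x \<bullet> z i - w i))"
    by (rule Bochner_Integration.integral_sum) (rule integral_cell_affine)
  also have "\<dots> = (\<Sum>i<N. moment N z' w' i \<bullet> z i - m i * w i)"
    using assms by (intro sum.cong) (auto simp: integral_cell_affine tessellates_def)
  finally show ?thesis by (simp add: sum_subtractf)
qed

text \<open>Using the i-th affine function on the i-th cell of any tessellation never beats the
  maximum. The pair \<open>z\<close>, \<open>w\<close> being independent of the tessellating pair
  \<open>z'\<close>, \<open>w'\<close> is what yields both convexity and semiconcavity of the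
  correlation.\<close>

lemma weak_duality:
  assumes N: "N > 0" and z': "inj_on z' {..<N}" and t: "tessellates N m z' w'"
  shows "(\<Sum>i<N. moment N z' w' i \<bullet> z i) - (\<Sum>i<N. m i * w i) \<le> dual N z w"
proof -
  have "(\<Sum>i<N. moment N z' w' i \<bullet> z i) - (\<Sum>i<N. m i * w i)
      = (LINT x|M. (\<Sum>i<N. indicator (cell N z' w' i) x * (x \<bullet> z i - w i)))"
    by (rule integral_sum_cells[OF t, symmetric])
  also have "\<dots> \<le> dual N z w"
    unfolding dual_def
  proof (rule integral_mono_AE)
    show "AE x in M. (\<Sum>i<N. indicator (cell N z' w' i) x * (x \<bullet> z i - w i)) \<le> max_affine N z w x"
      using AE_cell[OF N z', of w']
    proof (rule AE_mp[OF _ AE_I2], intro impI)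
      fix x assume "\<exists>i<N. x \<in> cell N z' w' i"
      then obtain i where i: "i < N" "x \<in> cell N z' w' i" by blast
      show "(\<Sum>i<N. indicator (cell N z' w' i) x * (x \<bullet> z i - w i)) \<le> max_affine N z w x"
        unfolding sum_indicator_cell_real[OF i(2,1)] by (rule max_affine_ge[OF i(1)])
    qed
  qed (intro Bochner_Integration.integrable_sum integral_cell_affine integrable_max_affine N)+
  finally show ?thesis .
qed

text \<open>Equality case of \<open>weak_duality\<close>: on its own cells each affine function is
  the maximum.\<close>

lemma dual_tessellates:
  assumes N: "N > 0" and z: "inj_on z {..<N}" and t: "tessellates N m z w"
  shows "dual N z w = (\<Sum>i<N. moment N z w i \<bullet> z i) - (\<Sum>i<N. m i * w i)"
proof -
  have "dual N z w = (LINT x|M. (\<Sum>i<N. indicator (cell N z w i) x * (x \<bullet> z i - w i)))"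
    unfolding dual_def
  proof (rule integral_cong_AE)
    show "AE x in M. max_affine N z w x = (\<Sum>i<N. indicator (cell N z w i) x * (x \<bullet> z i - w i))"
      using AE_cell[OF N z, of w]
    proof (rule AE_mp[OF _ AE_I2], intro impI)
      fix x assume "\<exists>i<N. x \<in> cell N z w i"
      then obtain i where i: "i < N" "x \<in> cell N z w i" by blast
      show "max_affine N z w x = (\<Sum>i<N. indicator (cell N z w i) x * (x \<bullet> z i - w i))"
        unfolding sum_indicator_cell_real[OF i(2,1)] by (rule max_affine_cell[OF i(2,1)])
    qed
  qed (intro borel_measurable_integrable Bochner_Integration.integrable_sum integral_cell_affine integrable_max_affine N)+
  also have "\<dots> = (\<Sum>i<N. moment N z w i \<bullet> z i) - (\<Sum>i<N. m i * w i)"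
    by (rule integral_sum_cells[OF t])
  finally show ?thesis by simp
qed

text \<open>The total correlation \<open>\<Sum> c\<^sub>i \<bullet> z\<^sub>i\<close> is convex in \<open>z\<close> with gradient \<open>c\<close> (the first moments of the
  cells); evaluating the dual functional at \<open>z''\<close> with the optimal weights of \<open>z\<close> shows that it is
  also semiconcave.\<close>

lemma correlation_semiconcave:
  assumes N: "N > 0" and t: "tessellates N m z w" and z': "inj_on z' {..<N}" and t': "tessellates N m z' w'"
    and \<delta>: "\<delta> > 0" "\<And>i j. i < N \<Longrightarrow> j < N \<Longrightarrow> i \<noteq> j \<Longrightarrow> norm (z i - z j) \<ge> \<delta>"
    and D: "D \<ge> 0" "\<And>i. i < N \<Longrightarrow> norm (z'' i - z i) \<le> D"
  shows "(\<Sum>i<N. (moment N z' w' i - moment N z w i) \<bullet> z'' i) \<le> 32 * (real N)\<^sup>2 * rad^4 / \<delta> * D\<^sup>2"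
proof -
  have z: "inj_on z {..<N}" using \<delta> by (force intro!: inj_onI)
  \<comment> \<open>On the domain each affine function moves by at most \<open>rad * D\<close>;
    squaring this turns \<open>rad\<^sup>2\<close> of the perturbation bound into
    \<open>rad^4\<close>.\<close>
  have "dual N (\<lambda>i. z i + (z'' i - z i)) (\<lambda>i. w i + 0) \<le> dual N z w
     + (\<Sum>i<N. moment N z w i \<bullet> (z'' i - z i) - 0 * measure lebesgue (cell N z w i)) + 32 * (real N)\<^sup>2 * rad\<^sup>2 * (rad * D)\<^sup>2 / \<delta>"
  proof (rule dual_perturb[OF N \<delta>])
    fix x i assume "x \<in> \<Omega>" "i < N"
    then show "\<bar>x \<bullet> (z'' i - z i) - 0\<bar> \<le> rad * D"
      using abs_inner_le[of x "z'' i - z i"] D rad_pos by (smt (verit) mult_left_mono)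
  qed (use D rad_pos in auto)
  then have "dual N z'' w \<le> (\<Sum>i<N. moment N z w i \<bullet> z'' i) - (\<Sum>i<N. m i * w i) + 32 * (real N)\<^sup>2 * rad\<^sup>2 * (rad * D)\<^sup>2 / \<delta>"
    by (simp add: dual_tessellates[OF N z t] inner_diff_right sum_subtractf)
  with weak_duality[OF N z' t', of z'' w]
  show ?thesis by (simp add: inner_diff_left sum_subtractf power_mult_distrib power4_eq_xxxx power2_eq_square mult_ac)
qed

text \<open>The subgradient inequality: the cells of \<open>z\<close> compete at \<open>z'\<close>
  with the optimal ones.\<close>

lemma correlation_convex:
  assumes "N > 0" "inj_on z {..<N}" "tessellates N m z w" "inj_on z' {..<N}" "tessellates N m z' w'"
  shows "0 \<le> (\<Sum>i<N. (moment N z' w' i - moment N z w i) \<bullet> z' i)"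
  using weak_duality[OF assms(1-3), of z' w'] dual_tessellates[OF assms(1,4,5)]
  by (simp add: inner_diff_left sum_subtractf)

text \<open>Semiconcavity admits an arbitrary probe \<open>z''\<close>. Shifting only the i-th point
  of \<open>z'\<close> by \<open>D\<close> along the difference v of the moments adds
  \<open>D * norm v\<close> to a sum that convexity keeps nonnegative, and dividing by
  \<open>D\<close> gives the bound; 128 is 32 times the square of 2, since the probe is within
  \<open>2 * D\<close> of \<open>z\<close>. Only \<open>z\<close> carries the separation, so along a
  curve \<open>\<delta>\<close> can be taken at one fixed time.\<close>

lemma moment_lipschitz_pos:
  assumes N: "N > 0" and t: "tessellates N m z w" and z': "inj_on z' {..<N}" and t': "tessellates N m z' w'"
    and \<delta>: "\<delta> > 0" "\<And>i j. i < N \<Longrightarrow> j < N \<Longrightarrow> i \<noteq> j \<Longrightarrow> norm (z i - z j) \<ge> \<delta>"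
    and D: "D > 0" "\<And>i. i < N \<Longrightarrow> norm (z' i - z i) \<le> D" and i: "i < N"
  shows "norm (moment N z' w' i - moment N z w i) \<le> 128 * (real N)\<^sup>2 * rad^4 / \<delta> * D"
proof -
  have z: "inj_on z {..<N}" using \<delta> by (force intro!: inj_onI)
  define v where "v = moment N z' w' i - moment N z w i"
  define z'' where "z'' j = (if j = i then z' j + D *\<^sub>R sgn v else z' j)" for j
  have "norm (z'' j - z j) \<le> 2 * D" if "j < N" for j
  proof (cases "j = i")
    case True
    have "norm (z'' j - z j) \<le> norm (z' j - z j) + norm (D *\<^sub>R sgn v)"
      using norm_triangle_ineq[of "z' j - z j" "D *\<^sub>R sgn v"] by (simp add: z''_def True algebra_simps)
    also have "\<dots> \<le> D + D * 1"
      using D that by (intro add_mono) (auto simp: norm_sgn)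
    finally show ?thesis by simp
  qed (use D(2)[OF that] D(1) in \<open>auto simp: z''_def\<close>)
  then have "(\<Sum>j<N. (moment N z' w' j - moment N z w j) \<bullet> z'' j) \<le> 32 * (real N)\<^sup>2 * rad^4 / \<delta> * (2 * D)\<^sup>2"
    using D by (intro correlation_semiconcave[OF N t z' t' \<delta>]) auto
  moreover have "(\<Sum>j<N. (moment N z' w' j - moment N z w j) \<bullet> z'' j)
     = (\<Sum>j<N. (moment N z' w' j - moment N z w j) \<bullet> z' j) + D * norm v"
  proof -
    have "(\<Sum>j<N. (moment N z' w' j - moment N z w j) \<bullet> z'' j)
     = (\<Sum>j<N. (moment N z' w' j - moment N z w j) \<bullet> z' j + (if j = i then D * norm v else 0))"
      by (intro sum.cong)
         (auto simp: z''_def inner_add_right v_def[symmetric] sgn_div_norm dot_square_norm power2_eq_square field_simps)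
    then show ?thesis using i by (simp add: sum.distrib)
  qed
  ultimately have "D * norm v \<le> D * (128 * (real N)\<^sup>2 * rad^4 / \<delta> * D)"
    using correlation_convex[OF N z t z' t'] by (simp add: power2_eq_square mult_ac)
  then show ?thesis using D(1) unfolding v_def by (rule mult_left_le_imp_le)
qed

text \<open>The limit case \<open>D = 0\<close> is the point: it says that the moments are
  independent of the tessellating weights.\<close>

lemma moment_lipschitz:
  assumes N: "N > 0" and t: "tessellates N m z w" and z': "inj_on z' {..<N}" and t': "tessellates N m z' w'"
    and \<delta>: "\<delta> > 0" "\<And>i j. i < N \<Longrightarrow> j < N \<Longrightarrow> i \<noteq> j \<Longrightarrow> norm (z i - z j) \<ge> \<delta>"
    and D: "D \<ge> 0" "\<And>i. i < N \<Longrightarrow> norm (z' i - z i) \<le> D" and i: "i < N"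
  shows "norm (moment N z' w' i - moment N z w i) \<le> 128 * (real N)\<^sup>2 * rad^4 / \<delta> * D"
proof (rule field_le_epsilon)
  fix e :: real assume e: "e > 0"
  define L where "L = 128 * (real N)\<^sup>2 * rad^4 / \<delta>"
  have L: "L > 0" using N rad_pos \<delta> by (simp add: L_def)
  have "norm (moment N z' w' i - moment N z w i) \<le> L * (D + e / L)"
    unfolding L_def by (rule moment_lipschitz_pos[OF N t z' t' \<delta> _ _ i])
      (use D e L in \<open>auto simp flip: L_def intro!: add_nonneg_pos order_trans[OF D(2)]\<close>)
  then show "norm (moment N z' w' i - moment N z w i) \<le> 128 * (real N)\<^sup>2 * rad^4 / \<delta> * D + e"
    using L by (simp add: distrib_left flip: L_def)
qed

text \<open>Tessellating weights are never unique, as adding a constant to all of them leaves the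
  cells unchanged; the moments do not see the choice.\<close>

definition weights :: "nat \<Rightarrow> (nat \<Rightarrow> real) \<Rightarrow> (nat \<Rightarrow> R3) \<Rightarrow> nat \<Rightarrow> real" where
  "weights N m z = (SOME w. tessellates N m z w)"

definition cell_moment :: "nat \<Rightarrow> (nat \<Rightarrow> real) \<Rightarrow> (nat \<Rightarrow> R3) \<Rightarrow> nat \<Rightarrow> R3" where
  "cell_moment N m z i = moment N z (weights N m z) i"

lemma tessellates_weights:
  assumes "N > 0" "mass_vector N m" "inj_on z {..<N}"
  shows "tessellates N m z (weights N m z)"
  unfolding weights_def by (rule someI_ex[OF ex_tessellates[OF assms]])

lemma cell_moment_lipschitz:
  assumes "N > 0" "mass_vector N m" "inj_on z' {..<N}"
    and \<delta>: "\<delta> > 0" "\<And>i j. i < N \<Longrightarrow> j < N \<Longrightarrow> i \<noteq> j \<Longrightarrow> norm (z i - z j) \<ge> \<delta>"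
    and "D \<ge> 0" "\<And>i. i < N \<Longrightarrow> norm (z' i - z i) \<le> D" "i < N"
  shows "norm (cell_moment N m z' i - cell_moment N m z i) \<le> 128 * (real N)\<^sup>2 * rad^4 / \<delta> * D"
proof -
  have z: "inj_on z {..<N}" using \<delta> by (force intro!: inj_onI)
  show ?thesis unfolding cell_moment_def
    using assms by (intro moment_lipschitz[where m=m] tessellates_weights z) auto
qed

end

section \<open>Discrete measures and their Brenier potentials\<close>

lemma space_discr: "space (discr N m z) = UNIV" and sets_discr [measurable_cong]: "sets (discr N m z) = sets borel"
  by (simp_all add: discr_def)

lemma emeasure_discr:
  assumes "mass_vector N m" "A \<in> sets borel"
  shows "emeasure (discr N m z) A = ennreal (\<Sum>i<N. m i * indicator A (z i))"
proof -
  have "emeasure (discr N m z) A = emeasure (density (count_space {..<N}) (\<lambda>i. ennreal (m i))) (z -` A \<inter> {..<N})"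
    unfolding discr_def using assms by (subst emeasure_distr) auto
  also have "\<dots> = (\<Sum>i<N. ennreal (m i) * indicator (z -` A \<inter> {..<N}) i)"
    by (subst emeasure_density) (auto simp: nn_integral_count_space_finite)
  also have "\<dots> = (\<Sum>i<N. ennreal (m i * indicator A (z i)))"
    by (intro sum.cong) (auto simp: indicator_def)
  also have "\<dots> = ennreal (\<Sum>i<N. m i * indicator A (z i))"
    using assms by (intro sum_ennreal) (auto simp: mass_vector_def intro!: mult_nonneg_nonneg intro: less_imp_le)
  finally show ?thesis .
qed

lemma integral_discr:
  fixes f :: "R3 \<Rightarrow> real"
  assumes "mass_vector N m" "f \<in> borel_measurable borel"
  shows "(LINT x|discr N m z. f x) = (\<Sum>i<N. m i * f (z i))"
proof -
  have "(LINT x|discr N m z. f x) = (LINT i|density (count_space {..<N}) (\<lambda>i. ennreal (m i)). f (z i))"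
    unfolding discr_def using assms by (subst integral_distr) auto
  also have "\<dots> = (LINT i|count_space {..<N}. m i *\<^sub>R f (z i))"
    using assms by (subst integral_density) (auto simp: mass_vector_def AE_count_space intro: less_imp_le)
  also have "\<dots> = (\<Sum>i<N. m i * f (z i))" by (simp add: lebesgue_integral_count_space_finite)
  finally show ?thesis .
qed

lemma prob_space_discr:
  assumes "mass_vector N m" shows "prob_space (discr N m z)"
  by standard (use assms in \<open>simp add: emeasure_discr space_discr mass_vector_def\<close>)

lemma Pc_discr:
  assumes "mass_vector N m" shows "Pc (discr N m z)"
  unfolding Pc_def
proof (intro conjI exI)
  show "compact (z ` {..<N})" by (simp add: finite_imp_compact)
  then show "emeasure (discr N m z) (UNIV - z ` {..<N}) = 0"
    using assms by (subst emeasure_discr) (auto simp: borel_closed compact_imp_closed)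
qed (auto simp: prob_space_discr assms sets_discr)

lemma coupling_marginals:
  assumes "\<pi> \<in> Couplings \<mu> \<nu>" "sets \<mu> = sets borel" "sets \<nu> = sets borel"
  shows "distr \<pi> borel fst = \<mu>" "distr \<pi> borel snd = \<nu>"
proof -
  have s: "sets \<pi> = sets (borel :: (R3 \<times> R3) measure)" using assms by (simp add: Couplings_def)
  have sp: "space \<pi> = UNIV" using sets_eq_imp_space_eq[OF s] by simp
  have fm: "fst \<in> \<pi> \<rightarrow>\<^sub>M (borel :: R3 measure)" "snd \<in> \<pi> \<rightarrow>\<^sub>M (borel :: R3 measure)"
    unfolding measurable_cong_sets[OF s refl] by (auto intro!: borel_measurable_continuous_onI continuous_intros)
  have v: "fst -` A \<inter> UNIV = A \<times> (UNIV :: R3 set)" "snd -` A \<inter> UNIV = (UNIV :: R3 set) \<times> A" for A :: "R3 set" by auto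
  show "distr \<pi> borel fst = \<mu>"
    using assms by (intro measure_eqI) (auto simp: emeasure_distr fm sp Couplings_def simp flip: v)
  show "distr \<pi> borel snd = \<nu>"
    using assms by (intro measure_eqI) (auto simp: emeasure_distr fm sp Couplings_def simp flip: v)
qed

lemma dist_sq: "(dist x y)\<^sup>2 = (norm x)\<^sup>2 + (norm y)\<^sup>2 - 2 * (x \<bullet> y)" for x y :: R3
  unfolding dist_norm power2_norm_eq_inner by (simp add: inner_diff_left inner_diff_right inner_commute)

lemma AE_discr:
  assumes m: "mass_vector N m" shows "AE y in discr N m z. y \<in> z ` {..<N}"
proof (rule AE_I')
  have "z ` {..<N} \<in> sets borel" by (auto intro!: borel_closed finite_imp_closed)
  then show "UNIV - z ` {..<N} \<in> null_sets (discr N m z)"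
    using m by (auto simp: null_sets_def sets_discr emeasure_discr)
qed auto

lemma grad_eqI:
  assumes "(f has_derivative (\<lambda>h. g \<bullet> h)) (at x)" shows "grad f x = g"
proof -
  have "(f has_derivative (\<lambda>h. grad f x \<bullet> h)) (at x)"
    unfolding grad_def by (rule someI[where P="\<lambda>g. (f has_derivative (\<lambda>h. g \<bullet> h)) (at x)", OF assms])
  then have "(\<lambda>h. grad f x \<bullet> h) = (\<lambda>h. g \<bullet> h)" using assms by (rule has_derivative_unique)
  then have "\<And>h. grad f x \<bullet> h = g \<bullet> h" by metis
  then show ?thesis by (metis vector_eq_rdot)
qed

text \<open>Riesz representation: the vector behind a real-valued derivative is its adjoint applied
  to 1.\<close>

lemma has_derivative_grad:
  assumes "f differentiable (at x)" shows "(f has_derivative (\<lambda>h. grad f x \<bullet> h)) (at x)"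
proof -
  obtain f' where f': "(f has_derivative f') (at x)" using assms by (auto simp: differentiable_def)
  then have "linear f'" by (rule has_derivative_linear)
  then have "f' h = adjoint f' 1 \<bullet> h" for h
    using adjoint_works[of f' h 1] by (simp add: inner_commute)
  then have "(f has_derivative (\<lambda>h. adjoint f' 1 \<bullet> h)) (at x)" using f' by (metis (no_types, lifting) ext)
  then show ?thesis unfolding grad_def by (rule someI)
qed

text \<open>Along the segment from x to y the difference quotients at x are bounded by f y - f x,
  and so is their limit from the right.\<close>

lemma convex_on_above_tangent_plane:
  assumes S: "open S" "convex_on S f" and f: "(f has_derivative (\<lambda>h. g \<bullet> h)) (at x)" and xy: "x \<in> S" "y \<in> S"
  shows "f x + g \<bullet> (y - x) \<le> f y"
proof -
  define q where "q t = f (x + t *\<^sub>R (y - x))" for t :: real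
  have "(q has_derivative (\<lambda>t. g \<bullet> (t *\<^sub>R (y - x)))) (at 0)"
    unfolding q_def by (rule has_derivative_compose[where g=f]) (auto intro!: derivative_eq_intros f)
  then have "(q has_real_derivative g \<bullet> (y - x)) (at 0)"
    by (simp add: has_field_derivative_def mult_commute_abs)
  then have "((\<lambda>h. (q h - q 0) / h) \<longlongrightarrow> g \<bullet> (y - x)) (at 0)"
    by (simp add: DERIV_def)
  then have lim: "((\<lambda>h. (q h - q 0) / h) \<longlongrightarrow> g \<bullet> (y - x)) (at_right 0)"
    by (rule tendsto_within_subset) auto
  have "eventually (\<lambda>h. (q h - q 0) / h \<le> f y - f x) (at_right (0::real))"
    unfolding eventually_at_right_field
  proof (intro exI[of _ 1] conjI allI impI)
    fix h :: real assume h: "0 < h" "h < 1"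
    have "q h = f ((1 - h) *\<^sub>R x + h *\<^sub>R y)" by (simp add: q_def algebra_simps)
    also have "\<dots> \<le> (1 - h) * f x + h * f y"
      using S(2) xy h by (intro convex_onD) auto
    finally show "(q h - q 0) / h \<le> f y - f x" using h by (simp add: q_def field_simps)
  qed auto
  from tendsto_upperbound[OF lim this] show ?thesis by simp
qed

context source_domain begin

lemma cell_imp_dom: "x \<in> cell N z w i \<Longrightarrow> x \<in> \<Omega>"
  using cell_subset by blast

text \<open>Subtracting \<open>dual N z w\<close> gives mean zero because the domain has measure
  one. The value 0 outside is the normalisation in \<open>is_brenier\<close> that makes the
  potential unique as a total function.\<close>

definition potential :: "nat \<Rightarrow> (nat \<Rightarrow> R3) \<Rightarrow> (nat \<Rightarrow> real) \<Rightarrow> R3 \<Rightarrow> real" where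
  "potential N z w x = (if x \<in> \<Omega> then max_affine N z w x - dual N z w else 0)"

lemma has_derivative_potential:
  assumes "x \<in> cell N z w i" "i < N"
  shows "(potential N z w has_derivative (\<lambda>h. z i \<bullet> h)) (at x)"
proof (rule has_derivative_transform_within_open[OF _ open_cell assms(1)])
  show "((\<lambda>x. x \<bullet> z i - w i - dual N z w) has_derivative (\<lambda>h. z i \<bullet> h)) (at x)"
    by (auto intro!: derivative_eq_intros simp: inner_commute)
  show "y \<bullet> z i - w i - dual N z w = potential N z w y" if "y \<in> cell N z w i" for y
    using max_affine_cell[OF that assms(2)] that cell_imp_dom by (auto simp: potential_def)
qed

lemma grad_potential: "x \<in> cell N z w i \<Longrightarrow> i < N \<Longrightarrow> grad (potential N z w) x = z i"
  by (rule grad_eqI[OF has_derivative_potential])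

text \<open>A Borel representative of the gradient of the potential; \<open>grad\<close> itself is
  an arbitrary choice wherever differentiability fails.\<close>

definition cell_map :: "nat \<Rightarrow> (nat \<Rightarrow> R3) \<Rightarrow> (nat \<Rightarrow> real) \<Rightarrow> R3 \<Rightarrow> R3" where
  "cell_map N z w x = (\<Sum>i<N. indicator (cell N z w i) x *\<^sub>R z i)"

lemma cell_map_cell: "x \<in> cell N z w i \<Longrightarrow> i < N \<Longrightarrow> cell_map N z w x = z i"
  unfolding cell_map_def by (rule sum_indicator_cell)

lemma cell_map_measurable [measurable]: "cell_map N z w \<in> borel \<rightarrow>\<^sub>M borel"
  unfolding cell_map_def by measurable

lemma norm_cell_map_le: "norm (cell_map N z w x) \<le> (\<Sum>i<N. norm (z i))"
  unfolding cell_map_def by (rule order_trans[OF norm_sum], rule sum_mono) (simp add: indicator_def)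

lemma AE_cellI:
  assumes "N > 0" "inj_on z {..<N}" "\<And>x i. x \<in> cell N z w i \<Longrightarrow> i < N \<Longrightarrow> P x"
  shows "AE x in M. P x"
  using AE_cell[OF assms(1,2), of w] by eventually_elim (use assms(3) in blast)

lemma AE_grad_potential:
  assumes "N > 0" "inj_on z {..<N}" shows "AE x in M. grad (potential N z w) x = cell_map N z w x"
  using assms by (rule AE_cellI[where w=w]) (simp add: grad_potential cell_map_cell)

lemma distr_cell_map:
  assumes N: "N > 0" and z: "inj_on z {..<N}" and m: "mass_vector N m" and t: "tessellates N m z w"
  shows "distr M borel (cell_map N z w) = discr N m z"
proof (rule measure_eqI)
  fix A :: "R3 set" assume A: "A \<in> sets (distr M borel (cell_map N z w))"
  then have A [measurable]: "A \<in> sets borel" by simp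
  have me: "cell_map N z w -` A \<inter> space M \<in> sets M"
    by (rule measurable_sets[OF measurable_M A]) simp
  have "emeasure (distr M borel (cell_map N z w)) A = emeasure M (cell_map N z w -` A \<inter> space M)"
    using A by (intro emeasure_distr measurable_M) auto
  also have "\<dots> = ennreal (measure M (cell_map N z w -` A \<inter> space M))"
    by (simp add: M.emeasure_eq_measure)
  also have "measure M (cell_map N z w -` A \<inter> space M) = (LINT x|M. indicator (cell_map N z w -` A \<inter> space M) x)"
    using me by simp
  also have "\<dots> = (LINT x|M. (\<Sum>i<N. indicator (cell N z w i) x * indicator A (z i)))"
  proof (rule integral_cong_AE)
    show "AE x in M. indicat_real (cell_map N z w -` A \<inter> space M) x = (\<Sum>i<N. indicator (cell N z w i) x * indicator A (z i))"
      using N z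
    proof (rule AE_cellI)
      fix x i assume i: "x \<in> cell N z w i" "i < N"
      have "x \<in> \<Omega>" using i cell_imp_dom by auto
      then show "indicat_real (cell_map N z w -` A \<inter> space M) x = (\<Sum>i<N. indicator (cell N z w i) x * indicator A (z i))"
        unfolding sum_indicator_cell_real[OF i] using cell_map_cell[OF i] by (simp add: indicator_def)
    qed
    show "(\<lambda>x. \<Sum>i<N. indicator (cell N z w i) x * indicator A (z i) :: real) \<in> borel_measurable M"
      by (rule measurable_M, rule borel_measurable_sum) measurable
  qed (use me in auto)
  also have "\<dots> = (\<Sum>i<N. (LINT x|M. indicator (cell N z w i) x * indicator A (z i)))"
    by (intro Bochner_Integration.integral_sum integrable_mult_left integrable_indicator_cell)
  also have "\<dots> = (\<Sum>i<N. m i * indicator A (z i))"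
    using t unfolding integral_mult_left_zero integral_indicator_cell
    by (intro sum.cong) (auto simp: tessellates_def)
  also have "ennreal \<dots> = emeasure (discr N m z) A" using emeasure_discr[OF m A] by simp
  finally show "emeasure (distr M borel (cell_map N z w)) A = emeasure (discr N m z) A" .
qed (simp add: sets_discr)

text \<open>Two versions of Lebesgue measure on the domain occur: the completed one for integrals
  and a Borel one for couplings. Pushing forward by the identity passes from the first to the
  second.\<close>

lemma Leb_on_eq: "distr M borel (\<lambda>x. x) = Leb_on \<Omega>"
proof (rule measure_eqI)
  fix A :: "R3 set" assume "A \<in> sets (distr M borel (\<lambda>x. x))"
  then have A: "A \<in> sets borel" by simp
  have "emeasure (distr M borel (\<lambda>x. x)) A = emeasure M (A \<inter> \<Omega>)"
    using A by (subst emeasure_distr) (auto intro!: measurable_M)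
  also have "\<dots> = emeasure lborel (A \<inter> \<Omega>)"
    using A sets_dom by (subst emeasure_M) auto
  also have "\<dots> = emeasure (Leb_on \<Omega>) A"
    unfolding Leb_on_def using A sets_dom
    by (subst emeasure_density) (auto simp: indicator_inter_arith mult.commute simp flip: nn_integral_indicator)
  finally show "emeasure (distr M borel (\<lambda>x. x)) A = emeasure (Leb_on \<Omega>) A" .
qed (simp add: Leb_on_def)

lemma integral_Leb_on:
  fixes f :: "R3 \<Rightarrow> real"
  assumes "f \<in> borel_measurable borel" shows "(LINT x|Leb_on \<Omega>. f x) = (LINT x|M. f x)"
  unfolding Leb_on_eq[symmetric] using assms by (subst integral_distr) (auto intro!: measurable_M)

text \<open>The Kantorovich potentials: \<open>|x - y|\<^sup>2 \<ge> source_pot x + target_pot y\<close> with equality on the cells.\<close>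

definition source_pot :: "nat \<Rightarrow> (nat \<Rightarrow> R3) \<Rightarrow> (nat \<Rightarrow> real) \<Rightarrow> R3 \<Rightarrow> real" where
  "source_pot N z w x = indicator \<Omega> x * ((norm x)\<^sup>2 - 2 * max_affine N z w x)"

definition target_pot :: "nat \<Rightarrow> (nat \<Rightarrow> R3) \<Rightarrow> (nat \<Rightarrow> real) \<Rightarrow> R3 \<Rightarrow> real" where
  "target_pot N z w y = (\<Sum>i<N. indicator {z i} y * ((norm (z i))\<^sup>2 - 2 * w i))"

lemma target_pot_eq:
  assumes "inj_on z {..<N}" "i < N"
  shows "target_pot N z w (z i) = (norm (z i))\<^sup>2 - 2 * w i"
proof -
  have "target_pot N z w (z i) = (\<Sum>j<N. if j = i then (norm (z j))\<^sup>2 - 2 * w j else 0)"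
    unfolding target_pot_def using assms by (intro sum.cong) (auto simp: indicator_def dest: inj_onD)
  then show ?thesis using assms by simp
qed

lemma source_pot_measurable [measurable]: "source_pot N z w \<in> borel_measurable borel"
  unfolding source_pot_def using sets_dom(2) by measurable

lemma target_pot_measurable [measurable]: "target_pot N z w \<in> borel_measurable borel"
  unfolding target_pot_def by measurable

lemma cost_ge_pot:
  assumes "inj_on z {..<N}" "i < N" "x \<in> \<Omega>"
  shows "source_pot N z w x + target_pot N z w (z i) \<le> (dist x (z i))\<^sup>2"
  using max_affine_ge[OF assms(2), of x z w] assms
  by (simp add: source_pot_def target_pot_eq dist_sq)

lemma cost_eq_pot_iff:
  assumes "inj_on z {..<N}" "i < N" "x \<in> \<Omega>"
  shows "source_pot N z w x + target_pot N z w (z i) = (dist x (z i))\<^sup>2 \<longleftrightarrow> max_affine N z w x = x \<bullet> z i - w i"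
  using assms by (auto simp: source_pot_def target_pot_eq dist_sq)

lemma abs_max_affine_le:
  assumes N: "N > 0" and x: "x \<in> \<Omega>"
  shows "\<bar>max_affine N z w x\<bar> \<le> (\<Sum>i<N. rad * norm (z i) + \<bar>w i\<bar>)"
proof -
  obtain i where i: "i < N" "max_affine N z w x = x \<bullet> z i - w i"
    using max_affine_attained[OF N] by blast
  have "\<bar>x \<bullet> z i - w i\<bar> \<le> rad * norm (z i) + \<bar>w i\<bar>" using abs_inner_le[OF x, of "z i"] by linarith
  also have "\<dots> \<le> (\<Sum>i<N. rad * norm (z i) + \<bar>w i\<bar>)" using i rad_pos
    by (intro member_le_sum[where f="\<lambda>i. rad * norm (z i) + \<bar>w i\<bar>"]) auto
  finally show ?thesis using i by simp
qed

lemma pot_bounds: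
  assumes N: "N > 0"
  obtains B where "\<And>x. \<bar>source_pot N z w x\<bar> \<le> B" "\<And>y. \<bar>target_pot N z w y\<bar> \<le> B"
proof -
  let ?A = "rad\<^sup>2 + 2 * (\<Sum>i<N. rad * norm (z i) + \<bar>w i\<bar>)"
  let ?C = "(\<Sum>i<N. \<bar>(norm (z i))\<^sup>2 - 2 * w i\<bar>)"
  have "\<bar>source_pot N z w x\<bar> \<le> ?A" for x
  proof (cases "x \<in> \<Omega>")
    case True
    have 1: "\<bar>max_affine N z w x\<bar> \<le> (\<Sum>i<N. rad * norm (z i) + \<bar>w i\<bar>)"
      by (rule abs_max_affine_le[OF N True])
    have 2: "(norm x)\<^sup>2 \<le> rad\<^sup>2" using norm_le_rad[OF True] by (intro power_mono) auto
    have "\<bar>a - 2 * b\<bar> \<le> c + 2 * d" if "0 \<le> a" "a \<le> c" "\<bar>b\<bar> \<le> d" for a b c d :: real using that by linarith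
    from this[OF _ 2 1] show ?thesis using True by (simp add: source_pot_def)
  next
    case False
    have "0 \<le> (\<Sum>i<N. rad * norm (z i) + \<bar>w i\<bar>)" using rad_pos by (intro sum_nonneg) auto
    then show ?thesis using False by (simp add: source_pot_def)
  qed
  moreover have "\<bar>target_pot N z w y\<bar> \<le> ?C" for y
    unfolding target_pot_def
    by (rule order_trans[OF sum_abs], rule sum_mono) (simp add: abs_mult indicator_def)
  ultimately show thesis using that[of "max ?A ?C"] by (meson max.coboundedI1 max.coboundedI2)
qed

section \<open>Kantorovich duality with a discrete target\<close>

definition dual_cost :: "nat \<Rightarrow> (nat \<Rightarrow> real) \<Rightarrow> (nat \<Rightarrow> R3) \<Rightarrow> (nat \<Rightarrow> real) \<Rightarrow> real" where
  "dual_cost N m z w = (LINT x|M. source_pot N z w x) + (LINT y|discr N m z. target_pot N z w y)"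

text \<open>Weak duality: integrate \<open>cost_ge_pot\<close> over the coupling and split along the
  marginals. The pointwise inequality concerns sources in the domain and targets at the sites, hence
  the two almost-everywhere facts on the support.\<close>

lemma transport_cost_ge:
  assumes N: "N > 0" and z: "inj_on z {..<N}" and m: "mass_vector N m" and \<pi>: "\<pi> \<in> Couplings (Leb_on \<Omega>) (discr N m z)"
  shows "ennreal (dual_cost N m z w) \<le> transport_cost \<pi>"
proof -
  have s: "sets \<pi> = sets (borel :: (R3 \<times> R3) measure)" using \<pi> by (simp add: Couplings_def)
  have mg: "distr \<pi> borel fst = Leb_on \<Omega>" "distr \<pi> borel snd = discr N m z"
    using coupling_marginals[OF \<pi>] by (auto simp: sets_discr Leb_on_def)
  have [measurable]: "fst \<in> \<pi> \<rightarrow>\<^sub>M (borel :: R3 measure)" "snd \<in> \<pi> \<rightarrow>\<^sub>M (borel :: R3 measure)"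
    unfolding measurable_cong_sets[OF s refl] by (auto intro!: borel_measurable_continuous_onI continuous_intros)
  have "prob_space (distr \<pi> borel snd)" unfolding mg by (rule prob_space_discr[OF m])
  then interpret \<pi>: prob_space \<pi> by (rule prob_space_distrD[rotated]) simp
  have AE1: "AE p in \<pi>. fst p \<in> \<Omega>"
  proof -
    have "AE x in Leb_on \<Omega>. x \<in> \<Omega>" unfolding Leb_on_def using sets_dom(2)
      by (subst AE_density) (auto simp: indicator_def)
    then show ?thesis unfolding mg(1)[symmetric] using sets_dom(2) by (subst (asm) AE_distr_iff) auto
  qed
  have AE2: "AE p in \<pi>. snd p \<in> z ` {..<N}"
  proof -
    have "z ` {..<N} \<in> sets borel" by (auto intro!: borel_closed finite_imp_closed)
    then show ?thesis using AE_discr[OF m, of z] unfolding mg(2)[symmetric] by (subst (asm) AE_distr_iff) auto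
  qed
  obtain B where B: "\<And>x. \<bar>source_pot N z w x\<bar> \<le> B" "\<And>y. \<bar>target_pot N z w y\<bar> \<le> B"
    using pot_bounds[OF N] by metis
  have i1: "integrable \<pi> (\<lambda>p. source_pot N z w (fst p))" "integrable \<pi> (\<lambda>p. target_pot N z w (snd p))"
    by (rule \<pi>.integrable_const_bound[of _ B]; use B in auto)+
  let ?Z = "\<Sum>i<N. norm (z i)"
  have i2: "integrable \<pi> (\<lambda>p. (dist (fst p) (snd p))\<^sup>2)"
  proof (rule \<pi>.integrable_const_bound[of _ "(rad + ?Z)\<^sup>2"])
    show "AE p in \<pi>. norm ((dist (fst p) (snd p))\<^sup>2) \<le> (rad + ?Z)\<^sup>2"
      using AE1 AE2
    proof eventually_elim
      fix p assume p: "fst p \<in> \<Omega>" "snd p \<in> z ` {..<N}"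
      then obtain i where i: "i < N" "snd p = z i" by auto
      have "norm (z i) \<le> ?Z" using i by (intro member_le_sum) auto
      then have "dist (fst p) (snd p) \<le> rad + ?Z"
        using norm_triangle_ineq4[of "fst p" "snd p"] norm_le_rad[OF p(1)] i by (simp add: dist_norm)
      then show "norm ((dist (fst p) (snd p))\<^sup>2) \<le> (rad + ?Z)\<^sup>2" by (simp add: power_mono)
    qed
  qed measurable
  have "dual_cost N m z w = (LINT p|\<pi>. source_pot N z w (fst p)) + (LINT p|\<pi>. target_pot N z w (snd p))"
    unfolding dual_cost_def mg(2)[symmetric] integral_Leb_on[symmetric, OF source_pot_measurable] mg(1)[symmetric]
    by (subst (1 2) integral_distr) auto
  also have "\<dots> = (LINT p|\<pi>. source_pot N z w (fst p) + target_pot N z w (snd p))" using i1 by simp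
  also have "\<dots> \<le> (LINT p|\<pi>. (dist (fst p) (snd p))\<^sup>2)"
  proof (rule integral_mono_AE)
    show "AE p in \<pi>. source_pot N z w (fst p) + target_pot N z w (snd p) \<le> (dist (fst p) (snd p))\<^sup>2"
      using AE1 AE2 by eventually_elim (use cost_ge_pot[OF z] in auto)
  qed (use i1 i2 in auto)
  finally have "ennreal (dual_cost N m z w) \<le> ennreal (LINT p|\<pi>. (dist (fst p) (snd p))\<^sup>2)"
    by (rule ennreal_leI)
  also have "\<dots> = transport_cost \<pi>"
    unfolding transport_cost_def using i2 by (subst nn_integral_eq_integral) auto
  finally show ?thesis .
qed

lemma transport_cost_cell_map:
  assumes N: "N > 0" and z: "inj_on z {..<N}" and m: "mass_vector N m" and t: "tessellates N m z w"
  shows "integrable M (\<lambda>x. (dist x (cell_map N z w x))\<^sup>2)"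
    and "(LINT x|M. (dist x (cell_map N z w x))\<^sup>2) = dual_cost N m z w"
proof -
  obtain B where B: "\<And>x. \<bar>source_pot N z w x\<bar> \<le> B" "\<And>y. \<bar>target_pot N z w y\<bar> \<le> B"
    using pot_bounds[OF N] by metis
  let ?Z = "\<Sum>i<N. norm (z i)"
  show "integrable M (\<lambda>x. (dist x (cell_map N z w x))\<^sup>2)"
  proof (rule integrable_M[of _ "(rad + ?Z)\<^sup>2"])
    fix x assume x: "x \<in> \<Omega>"
    have "dist x (cell_map N z w x) \<le> rad + ?Z"
      using norm_triangle_ineq4[of x "cell_map N z w x"] norm_le_rad[OF x] norm_cell_map_le[of N z w x]
      by (simp add: dist_norm)
    then show "norm ((dist x (cell_map N z w x))\<^sup>2) \<le> (rad + ?Z)\<^sup>2" by (simp add: power_mono)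
  qed measurable
  have i1: "integrable M (source_pot N z w)" "integrable M (\<lambda>x. target_pot N z w (cell_map N z w x))"
    by (rule integrable_M[of _ B]; use B in auto)+
  have "(LINT x|M. (dist x (cell_map N z w x))\<^sup>2) = (LINT x|M. source_pot N z w x + target_pot N z w (cell_map N z w x))"
  proof (rule integral_cong_AE)
    show "AE x in M. (dist x (cell_map N z w x))\<^sup>2 = source_pot N z w x + target_pot N z w (cell_map N z w x)"
      using N z
    proof (rule AE_cellI)
      fix x i assume i: "x \<in> cell N z w i" "i < N"
      then show "(dist x (cell_map N z w x))\<^sup>2 = source_pot N z w x + target_pot N z w (cell_map N z w x)"
        using cost_eq_pot_iff[OF z i(2), of x w] max_affine_cell[OF i] cell_imp_dom[OF i(1)]
        by (auto simp: cell_map_cell)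
    qed
  qed (auto intro!: measurable_M)
  also have "\<dots> = (LINT x|M. source_pot N z w x) + (LINT x|M. target_pot N z w (cell_map N z w x))"
    using i1 by simp
  also have "(LINT x|M. target_pot N z w (cell_map N z w x)) = (LINT y|distr M borel (cell_map N z w). target_pot N z w y)"
    by (subst integral_distr) (auto intro!: measurable_M)
  finally show "(LINT x|M. (dist x (cell_map N z w x))\<^sup>2) = dual_cost N m z w"
    by (simp add: dual_cost_def distr_cell_map[OF N z m t])
qed

text \<open>Uses completeness of Lebesgue measure; needed because nothing is known about
  \<open>grad\<close> on the null set outside the cells.\<close>

lemma measurable_M_AE:
  assumes "f \<in> M \<rightarrow>\<^sub>M (borel :: R3 measure)" "AE x in M. g x = f x"
  shows "g \<in> M \<rightarrow>\<^sub>M borel"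
proof (rule measurableI)
  fix A :: "R3 set" assume "A \<in> sets borel"
  from measurable_sets[OF assms(1) this] have "f -` A \<inter> \<Omega> \<in> sets lebesgue"
    using sets_dom by (auto simp: sets_restrict_space_iff)
  then have "g -` A \<inter> \<Omega> \<in> sets lebesgue"
    by (rule completion.in_sets_AE[rotated]) (use assms(2)[unfolded AE_M_iff] in auto)
  then show "g -` A \<inter> space M \<in> sets M" using sets_dom by (auto simp: sets_restrict_space_iff)
qed auto

section \<open>Existence and uniqueness of the Brenier potential\<close>

lemma is_brenier_potential:
  assumes N: "N > 0" and z: "inj_on z {..<N}" and m: "mass_vector N m" and t: "tessellates N m z w"
  shows "is_brenier \<Omega> (discr N m z) (potential N z w)"
proof -
  let ?\<phi> = "potential N z w"
  have [measurable]: "?\<phi> \<in> borel_measurable borel"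
    unfolding potential_def using sets_dom(2) by measurable
  have ae: "AE x in M. grad ?\<phi> x = cell_map N z w x" by (rule AE_grad_potential[OF N z])
  have cm: "cell_map N z w \<in> M \<rightarrow>\<^sub>M borel" by (rule measurable_M) simp
  have gm [measurable]: "grad ?\<phi> \<in> M \<rightarrow>\<^sub>M borel"
    by (rule measurable_M_AE[OF cm ae])
  let ?B = "(\<Sum>i<N. rad * norm (z i) + \<bar>w i\<bar>) + \<bar>dual N z w\<bar>"
  have b: "\<bar>?\<phi> x\<bar> \<le> ?B" if "x \<in> \<Omega>" for x
    using abs_max_affine_le[OF N that, of z w] that by (simp add: potential_def)
  show ?thesis
    unfolding is_brenier_def
  proof (intro conjI allI ballI impI)
    show "convex_on \<Omega> ?\<phi>"
    proof -
      have "convex_on \<Omega> (\<lambda>x. max_affine N z w x + - dual N z w)"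
        by (intro convex_on_add convex_on_max_affine N convex_dom) (auto simp: convex_on_const convex_dom)
      then show ?thesis using convexD[OF convex_dom] by (auto simp: convex_on_def potential_def)
    qed
    show "?\<phi> \<in> borel_measurable M" by (rule measurable_M) simp
    show "integrable M (\<lambda>x. (?\<phi> x)\<^sup>2)"
      by (rule integrable_M[of _ "?B\<^sup>2"]) (use b power_mono[OF b abs_ge_zero, of _ 2] in auto)
    show "integrable M ?\<phi>" by (rule integrable_M[of _ ?B]) (use b in auto)
    show "AE x in M. ?\<phi> differentiable at x"
      using N z by (rule AE_cellI) (auto simp: differentiable_def intro: has_derivative_potential)
    show "grad ?\<phi> \<in> M \<rightarrow>\<^sub>M borel" by (rule gm)
    show "integrable M (\<lambda>x. (grad ?\<phi> x $ i)\<^sup>2)" for i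
    proof (rule integrable_cong_AE[THEN iffD2])
      show "AE x in M. (grad ?\<phi> x $ i)\<^sup>2 = (cell_map N z w x $ i)\<^sup>2" using ae by eventually_elim simp
      show "integrable M (\<lambda>x. (cell_map N z w x $ i)\<^sup>2)"
      proof (rule integrable_M[of _ "(\<Sum>i<N. norm (z i))\<^sup>2"])
        fix x
        have "\<bar>cell_map N z w x $ i\<bar> \<le> (\<Sum>i<N. norm (z i))"
          using component_le_norm_cart norm_cell_map_le order_trans by blast
        from power_mono[OF this abs_ge_zero, of 2] show "norm ((cell_map N z w x $ i)\<^sup>2) \<le> (\<Sum>i<N. norm (z i))\<^sup>2" by simp
        show "(\<lambda>x. (cell_map N z w x $ i)\<^sup>2) \<in> borel_measurable borel"
          by (rule measurable_compose[OF cell_map_measurable, where g="\<lambda>y. (y $ i)\<^sup>2"])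
             (intro borel_measurable_continuous_onI continuous_intros)
      qed
      show "(\<lambda>x. (grad ?\<phi> x $ i)\<^sup>2) \<in> borel_measurable M" "(\<lambda>x. (cell_map N z w x $ i)\<^sup>2) \<in> borel_measurable M"
        by (rule measurable_compose[OF gm, where g="\<lambda>y. (y $ i)\<^sup>2"] measurable_compose[OF cm, where g="\<lambda>y. (y $ i)\<^sup>2"];
            intro borel_measurable_continuous_onI continuous_intros)+
    qed
    show "LINT x|M. ?\<phi> x = 0"
    proof -
      have "(LINT x|M. ?\<phi> x) = (LINT x|M. max_affine N z w x - dual N z w)"
        by (rule Bochner_Integration.integral_cong) (auto simp: potential_def)
      then show ?thesis using N by (simp add: integrable_max_affine measure_M_UNIV dual_def)
    qed
    show "emeasure (discr N m z) A = emeasure lebesgue {x \<in> \<Omega>. grad ?\<phi> x \<in> A}" if "A \<in> sets borel" for A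
    proof -
      have "discr N m z = distr M borel (grad ?\<phi>)"
        unfolding distr_cell_map[OF N z m t, symmetric] using ae gm cm by (intro distr_cong_AE) auto
      then have "emeasure (discr N m z) A = emeasure M (grad ?\<phi> -` A \<inter> \<Omega>)"
        using that gm by (simp add: emeasure_distr)
      also have "\<dots> = emeasure lebesgue {x \<in> \<Omega>. grad ?\<phi> x \<in> A}"
        by (subst emeasure_M) (auto intro!: arg_cong[where f="emeasure lebesgue"])
      finally show ?thesis .
    qed
    show "(\<integral>\<^sup>+ x. ennreal ((dist x (grad ?\<phi> x))\<^sup>2) \<partial>M) \<le> transport_cost \<pi>" if "\<pi> \<in> Couplings (Leb_on \<Omega>) (discr N m z)" for \<pi>
    proof -
      have "(\<integral>\<^sup>+ x. ennreal ((dist x (grad ?\<phi> x))\<^sup>2) \<partial>M) = (\<integral>\<^sup>+ x. ennreal ((dist x (cell_map N z w x))\<^sup>2) \<partial>M)"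
        by (rule nn_integral_cong_AE) (use ae in eventually_elim, simp)
      also have "\<dots> = ennreal (dual_cost N m z w)"
        using transport_cost_cell_map[OF N z m t] by (subst nn_integral_eq_integral) auto
      also have "\<dots> \<le> transport_cost \<pi>" by (rule transport_cost_ge[OF N z m that])
      finally show ?thesis .
    qed
  qed (auto simp: potential_def)
qed

text \<open>Complementary slackness. Tested against the coupling induced by \<open>cell_map\<close>,
  an optimal map costs at most \<open>dual_cost\<close>, so its nonnegative slack in
  \<open>cost_ge_pot\<close> integrates to zero and vanishes almost everywhere. At a point of cell
  i, strictness of the cell inequalities leaves z_i as the only target with zero slack.\<close>

lemma brenier_grad_unique:
  assumes N: "N > 0" and z: "inj_on z {..<N}" and m: "mass_vector N m" and t: "tessellates N m z w"
    and \<psi>: "is_brenier \<Omega> (discr N m z) \<psi>"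
  shows "AE x in M. grad \<psi> x = cell_map N z w x"
proof -
  define T where "T = grad \<psi>"
  have [measurable]: "T \<in> M \<rightarrow>\<^sub>M borel" using \<psi> by (simp add: is_brenier_def T_def)
  have idm [measurable]: "(\<lambda>x. x) \<in> M \<rightarrow>\<^sub>M borel" by (rule measurable_M) simp
  have cm [measurable]: "cell_map N z w \<in> M \<rightarrow>\<^sub>M borel" by (rule measurable_M) simp
  have dT: "distr M borel T = discr N m z"
  proof (rule measure_eqI)
    fix A :: "R3 set" assume "A \<in> sets (distr M borel T)"
    then have A: "A \<in> sets borel" by simp
    have "emeasure (distr M borel T) A = emeasure M (T -` A \<inter> \<Omega>)" using A by (simp add: emeasure_distr)
    also have "\<dots> = emeasure lebesgue {x \<in> \<Omega>. T x \<in> A}"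
      by (subst emeasure_M) (auto intro!: arg_cong[where f="emeasure lebesgue"])
    also have "\<dots> = emeasure (discr N m z) A" using \<psi> A by (simp add: is_brenier_def T_def)
    finally show "emeasure (distr M borel T) A = emeasure (discr N m z) A" .
  qed (simp add: sets_discr)
  have zb: "z ` {..<N} \<in> sets borel" by (auto intro!: borel_closed finite_imp_closed)
  have Tz: "AE x in M. T x \<in> z ` {..<N}"
    using AE_discr[OF m, of z] zb unfolding dT[symmetric] by (subst (asm) AE_distr_iff) auto
  define \<pi> where "\<pi> = distr M (borel :: (R3 \<times> R3) measure) (\<lambda>x. (x, cell_map N z w x))"
  have pm [measurable]: "(\<lambda>x. (x, cell_map N z w x)) \<in> M \<rightarrow>\<^sub>M (borel :: (R3 \<times> R3) measure)"
    unfolding borel_prod[symmetric] by measurable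
  have \<pi>: "\<pi> \<in> Couplings (Leb_on \<Omega>) (discr N m z)"
    unfolding Couplings_def
  proof (intro CollectI conjI ballI)
    show "sets \<pi> = sets borel" by (simp add: \<pi>_def)
    fix A :: "R3 set" assume A: "A \<in> sets borel"
    have AU: "A \<times> (UNIV::R3 set) \<in> sets borel" "(UNIV::R3 set) \<times> A \<in> sets borel"
      unfolding borel_prod[symmetric] using A by auto
    have "emeasure \<pi> (A \<times> UNIV) = emeasure (distr M borel (\<lambda>x. x)) A"
      unfolding \<pi>_def using A AU by (simp add: emeasure_distr vimage_def)
    then show "emeasure \<pi> (A \<times> UNIV) = emeasure (Leb_on \<Omega>) A" by (simp only: Leb_on_eq)
    have "emeasure \<pi> (UNIV \<times> A) = emeasure (distr M borel (cell_map N z w)) A"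
      unfolding \<pi>_def using A AU by (simp add: emeasure_distr vimage_def)
    then show "emeasure \<pi> (UNIV \<times> A) = emeasure (discr N m z) A" by (simp only: distr_cell_map[OF N z m t])
  qed
  have "transport_cost \<pi> = ennreal (dual_cost N m z w)"
    unfolding transport_cost_def \<pi>_def using transport_cost_cell_map[OF N z m t]
    by (subst nn_integral_distr) (auto simp: nn_integral_eq_integral intro!: borel_measurable_continuous_onI continuous_intros)
  moreover have "\<forall>\<pi>\<in>Couplings (Leb_on \<Omega>) (discr N m z). (\<integral>\<^sup>+ x. ennreal ((dist x (T x))\<^sup>2) \<partial>M) \<le> transport_cost \<pi>"
    using \<psi> unfolding is_brenier_def T_def by blast
  ultimately have le: "(\<integral>\<^sup>+ x. ennreal ((dist x (T x))\<^sup>2) \<partial>M) \<le> ennreal (dual_cost N m z w)"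
    using \<pi> by auto
  obtain B where B: "\<And>x. \<bar>source_pot N z w x\<bar> \<le> B" "\<And>y. \<bar>target_pot N z w y\<bar> \<le> B"
    using pot_bounds[OF N] by metis
  have i1: "integrable M (source_pot N z w)" by (rule integrable_M[of _ B]; use B in auto)
  have i2: "integrable M (\<lambda>x. target_pot N z w (T x))" by (rule M.integrable_const_bound[of _ B]; use B in auto)
  have i3: "integrable M (\<lambda>x. (dist x (T x))\<^sup>2)"
    using le by (intro integrableI_nonneg) (auto simp: le_less_trans)
  have "0 \<le> dual_cost N m z w" unfolding transport_cost_cell_map(2)[OF N z m t, symmetric] by simp
  then have "(LINT x|M. (dist x (T x))\<^sup>2) \<le> dual_cost N m z w"
    using le i3 by (simp add: nn_integral_eq_integral)
  also have "\<dots> = (LINT x|M. source_pot N z w x) + (LINT x|M. target_pot N z w (T x))"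
    unfolding dual_cost_def dT[symmetric] by (subst integral_distr) auto
  finally have le0: "(LINT x|M. (dist x (T x))\<^sup>2 - (source_pot N z w x + target_pot N z w (T x))) \<le> 0"
    using i1 i2 i3 by simp
  have ge: "AE x in M. 0 \<le> (dist x (T x))\<^sup>2 - (source_pot N z w x + target_pot N z w (T x))"
    using Tz AE_space by eventually_elim (use cost_ge_pot[OF z] in auto)
  have "(LINT x|M. (dist x (T x))\<^sup>2 - (source_pot N z w x + target_pot N z w (T x))) = 0"
    using integral_nonneg_AE[OF ge] le0 by simp
  then have "AE x in M. (dist x (T x))\<^sup>2 - (source_pot N z w x + target_pot N z w (T x)) = 0"
    using i1 i2 i3 ge by (subst (asm) integral_nonneg_eq_0_iff_AE) auto
  then show ?thesis
    using AE_cell[OF N z, of w] Tz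
  proof eventually_elim
    fix x assume e: "(dist x (T x))\<^sup>2 - (source_pot N z w x + target_pot N z w (T x)) = 0"
      and c: "\<exists>i<N. x \<in> cell N z w i" and Tx: "T x \<in> z ` {..<N}"
    obtain i where i: "i < N" "x \<in> cell N z w i" using c by blast
    obtain j where j: "j < N" "T x = z j" using Tx by auto
    have "x \<in> \<Omega>" using i cell_imp_dom by auto
    then have "max_affine N z w x = x \<bullet> z j - w j"
      using e j cost_eq_pot_iff[OF z j(1), of x w] by simp
    moreover have "max_affine N z w x = x \<bullet> z i - w i" by (rule max_affine_cell[OF i(2,1)])
    ultimately have "\<not> x \<bullet> z j - w j < x \<bullet> z i - w i" by simp
    moreover have "\<forall>j<N. j \<noteq> i \<longrightarrow> x \<bullet> z j - w j < x \<bullet> z i - w i" using i(2) by (simp add: cell_def)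
    ultimately have "j = i" using j(1) by blast
    then show "grad \<psi> x = cell_map N z w x" using j i cell_map_cell T_def by simp
  qed
qed

text \<open>Nonempty open sets are not null; this extracts actual points from almost-everywhere
  information.\<close>

lemma AE_meets_open:
  assumes "AE x in M. P x" "open V" "V \<subseteq> \<Omega>" "V \<noteq> {}"
  obtains x where "x \<in> V" "P x"
proof -
  have "\<exists>x\<in>V. P x"
  proof (rule ccontr)
    assume "\<not> (\<exists>x\<in>V. P x)"
    then have "AE x in lebesgue. x \<notin> V" using assms(1,3) unfolding AE_M_iff by (auto elim!: eventually_mono)
    then have "V \<in> null_sets lebesgue" by (simp add: completion.null_sets_iff_AE)
    then show False using open_not_negligible[OF assms(2,4)] by (simp add: negligible_iff_null_sets)
  qed
  then show thesis using that by blast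
qed

text \<open>Two Brenier potentials have the same gradient a.e., so their difference is constant on each
  cell; being continuous with finite range on a connected set, it is constant.\<close>

lemma brenier_unique:
  assumes N: "N > 0" and z: "inj_on z {..<N}" and m: "mass_vector N m" and t: "tessellates N m z w"
    and \<psi>: "is_brenier \<Omega> (discr N m z) \<psi>"
  shows "\<psi> = potential N z w"
proof -
  let ?\<phi> = "potential N z w"
  have \<phi>: "is_brenier \<Omega> (discr N m z) ?\<phi>" by (rule is_brenier_potential[OF N z m t])
  define D where "D x = \<psi> x - ?\<phi> x" for x
  have cx: "convex_on \<Omega> \<psi>" "convex_on \<Omega> ?\<phi>" using \<psi> \<phi> by (auto simp: is_brenier_def)
  have c\<psi>: "continuous_on \<Omega> \<psi>" by (rule convex_on_continuous[OF open_dom cx(1)])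
  then have cD: "continuous_on \<Omega> D"
    unfolding D_def using convex_on_continuous[OF open_dom cx(2)] by (intro continuous_intros)
  have "AE x in M. \<psi> differentiable at x" using \<psi> by (simp add: is_brenier_def)
  then have tangent: "AE x in M. \<forall>y\<in>\<Omega>. \<psi> x + cell_map N z w x \<bullet> (y - x) \<le> \<psi> y"
    using brenier_grad_unique[OF N z m t \<psi>] AE_space
  proof eventually_elim
    fix x assume d: "\<psi> differentiable at x" and g: "grad \<psi> x = cell_map N z w x" and x: "x \<in> space M"
    then show "\<forall>y\<in>\<Omega>. \<psi> x + cell_map N z w x \<bullet> (y - x) \<le> \<psi> y"
      using convex_on_above_tangent_plane[OF open_dom cx(1) has_derivative_grad[OF d]] by simp
  qed
  \<comment> \<open>The slope is known only almost everywhere, so it is not integrated. If the claim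
    fails, the points of the cell where \<open>\<psi>\<close> minus the linear part exceeds its
    value at y form a nonempty open set, and a tangent plane of slope \<open>z i\<close> at one of
    them contradicts convexity at y.\<close>
  have le: "\<psi> x - x \<bullet> z i \<le> \<psi> y - y \<bullet> z i" if i: "i < N" and xy: "x \<in> cell N z w i" "y \<in> cell N z w i" for i x y
  proof (rule ccontr)
    assume n: "\<not> \<psi> x - x \<bullet> z i \<le> \<psi> y - y \<bullet> z i"
    let ?g = "\<lambda>x. \<psi> x - x \<bullet> z i"
    let ?V = "cell N z w i \<inter> ?g -` {?g y <..}"
    have "continuous_on (cell N z w i) ?g"
      using continuous_on_subset[OF c\<psi> cell_subset] by (intro continuous_intros)
    then have "open ?V" using open_cell by (rule continuous_open_preimage) auto
    moreover have "?V \<subseteq> \<Omega>" using cell_imp_dom by auto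
    moreover have "?V \<noteq> {}" using xy n by auto
    ultimately obtain x' where x': "x' \<in> ?V" "\<forall>y\<in>\<Omega>. \<psi> x' + cell_map N z w x' \<bullet> (y - x') \<le> \<psi> y"
      by (rule AE_meets_open[OF tangent, of ?V]) auto
    have "x' \<in> cell N z w i" using x'(1) by blast
    then have c: "cell_map N z w x' = z i" using i by (rule cell_map_cell)
    have "y \<in> \<Omega>" using xy(2) by (rule cell_imp_dom)
    then have "\<psi> x' + z i \<bullet> (y - x') \<le> \<psi> y" using x'(2) c by metis
    then have "?g x' \<le> ?g y" by (simp add: inner_diff_right inner_commute)
    then show False using x'(1) by simp
  qed
  have Dc: "D x = D y" if i: "i < N" and xy: "x \<in> cell N z w i" "y \<in> cell N z w i" for i x y
  proof -
    have "x \<in> \<Omega>" "y \<in> \<Omega>" using xy cell_imp_dom by auto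
    then show ?thesis
      using le[OF i xy] le[OF i xy(2,1)] max_affine_cell[OF xy(1) i] max_affine_cell[OF xy(2) i]
      by (simp add: D_def potential_def)
  qed
  define F where "F = (\<Union>i<N. D ` cell N z w i)"
  have "finite F"
    unfolding F_def
  proof (intro finite_UN_I finite_lessThan)
    fix i assume "i \<in> {..<N}"
    then have i: "i < N" by simp
    have "D y = D (SOME x. x \<in> cell N z w i)" if "y \<in> cell N z w i" for y
      using Dc[OF i that] someI[of "\<lambda>x. x \<in> cell N z w i", OF that] by blast
    then have "D ` cell N z w i \<subseteq> {D (SOME x. x \<in> cell N z w i)}" by blast
    then show "finite (D ` cell N z w i)" by (rule finite_subset) simp
  qed
  \<comment> \<open>The points with value outside the finite set \<open>F\<close> form an open set
    that misses all cells, so it is empty.\<close>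
  have "D x \<in> F" if x: "x \<in> \<Omega>" for x
  proof (rule ccontr)
    assume n: "D x \<notin> F"
    let ?V = "\<Omega> \<inter> D -` (- F)"
    have "open ?V" using cD open_dom finite_imp_closed[OF \<open>finite F\<close>]
      by (intro continuous_open_preimage) auto
    moreover have "?V \<noteq> {}" using x n by auto
    ultimately obtain x' where x': "x' \<in> ?V" "\<exists>i<N. x' \<in> cell N z w i"
      using AE_meets_open[OF AE_cell[OF N z, of w], of ?V] by auto
    then show False by (auto simp: F_def)
  qed
  then have "finite (D ` \<Omega>)" using \<open>finite F\<close> by (meson finite_subset image_subsetI)
  then have "D constant_on \<Omega>"
    using continuous_finite_range_constant[OF convex_connected[OF convex_dom] cD] by simp
  then obtain c where c: "\<And>x. x \<in> \<Omega> \<Longrightarrow> D x = c" by (auto simp: constant_on_def)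
  have "(LINT x|M. D x) = 0"
    unfolding D_def using \<psi> \<phi> by (simp add: is_brenier_def)
  moreover have "(LINT x|M. D x) = (LINT x|M. c)" by (rule Bochner_Integration.integral_cong) (auto simp: c)
  ultimately have "c = 0" by (simp add: measure_M_UNIV)
  show ?thesis
  proof
    fix x show "\<psi> x = potential N z w x"
      using c[of x] \<open>c = 0\<close> \<psi> \<phi> unfolding D_def is_brenier_def by (cases "x \<in> \<Omega>") auto
  qed
qed

lemma brenier_discr:
  assumes "N > 0" "inj_on z {..<N}" "mass_vector N m"
  shows "brenier \<Omega> (discr N m z) = potential N z (weights N m z)"
  unfolding brenier_def using tessellates_weights[OF assms(1,3,2)] assms
  by (intro the_equality is_brenier_potential brenier_unique)

end

section \<open>Global Picard-Lindelof theorem\<close>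

text \<open>Each slice with fixed index is open in the product, so continuity can be checked slice
  by slice.\<close>

lemma continuous_on_discrete_times:
  fixes f :: "'c discrete \<Rightarrow> 'a::topological_space \<Rightarrow> 'b::topological_space"
  assumes "\<And>i. continuous_on UNIV (f i)"
  shows "continuous_on UNIV (\<lambda>p. f (fst p) (snd p))"
proof -
  have "continuous_on ({i} \<times> UNIV) (\<lambda>p. f (fst p) (snd p))" for i
  proof (rule continuous_on_eq)
    show "continuous_on ({i} \<times> UNIV) (\<lambda>p. f i (snd p))"
      by (rule continuous_on_compose2[OF assms]) (auto intro: continuous_intros)
  qed auto
  then have "continuous_on (\<Union>i\<in>UNIV. {i} \<times> UNIV) (\<lambda>p. f (fst p) (snd p))"
    by (intro continuous_on_open_UN) (auto intro!: open_Times open_discrete)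
  moreover have "(\<Union>i\<in>UNIV. {i} \<times> UNIV) = (UNIV :: ('c discrete \<times> 'a) set)" by auto
  ultimately show ?thesis by simp
qed

text \<open>States are functions on all natural numbers. Phrasing the Lipschitz condition through a
  bound \<open>D\<close> on the first \<open>N\<close> entries makes it a sup-norm condition, and
  \<open>D = 0\<close> forces the field to depend on these entries only.\<close>

locale lipschitz_system =
  fixes N :: nat and F :: "nat \<Rightarrow> (nat \<Rightarrow> 'a::euclidean_space) \<Rightarrow> 'a" and L T :: real
  assumes L: "L > 0" and T: "T > 0"
    and lip: "\<And>y y' D i. D \<ge> 0 \<Longrightarrow> (\<And>j. j < N \<Longrightarrow> norm (y j - y' j) \<le> D) \<Longrightarrow> i < N \<Longrightarrow> norm (F i y - F i y') \<le> L * D"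
begin

definition solution :: "(nat \<Rightarrow> 'a) \<Rightarrow> (nat \<Rightarrow> real \<Rightarrow> 'a) \<Rightarrow> bool" where
  "solution y0 y \<longleftrightarrow> (\<forall>i<N. y i 0 = y0 i \<and>
     (\<forall>t\<in>{0..T}. (y i has_vector_derivative F i (\<lambda>j. y j t)) (at t within {0..T})))"

lemma F_cong: "(\<And>j. j < N \<Longrightarrow> y j = y' j) \<Longrightarrow> i < N \<Longrightarrow> F i y = F i y'"
  using lip[of 0 y y' i] by simp

lemma continuous_on_F:
  assumes "\<And>j. j < N \<Longrightarrow> continuous_on S (y j)" "i < N"
  shows "continuous_on S (\<lambda>s. F i (\<lambda>j. y j s))"
  unfolding continuous_on_def
proof
  fix s assume s: "s \<in> S"
  have "((\<lambda>r. L * (\<Sum>j<N. norm (y j r - y j s))) \<longlongrightarrow> L * (\<Sum>j<N. norm (y j s - y j s))) (at s within S)"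
    using assms(1) s unfolding continuous_on_def by (intro tendsto_intros) auto
  then have "((\<lambda>r. L * (\<Sum>j<N. norm (y j r - y j s))) \<longlongrightarrow> 0) (at s within S)" by simp
  then have "((\<lambda>r. F i (\<lambda>j. y j r) - F i (\<lambda>j. y j s)) \<longlongrightarrow> 0) (at s within S)"
  proof (rule Lim_null_comparison[rotated], intro always_eventually allI)
    fix r
    show "norm (F i (\<lambda>j. y j r) - F i (\<lambda>j. y j s)) \<le> L * (\<Sum>j<N. norm (y j r - y j s))"
      using assms(2) by (intro lip) (auto intro!: sum_nonneg member_le_sum[of _ "{..<N}" "\<lambda>j. norm (y j r - y j s)"])
  qed
  then show "((\<lambda>s. F i (\<lambda>j. y j s)) \<longlongrightarrow> F i (\<lambda>j. y j s)) (at s within S)" by (rule Lim_null[THEN iffD2])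
qed

text \<open>Bounded continuous functions form a Banach space on a whole type, so curves on [0, T]
  are continued by their end values.\<close>

definition clip :: "real \<Rightarrow> real" where "clip t = max 0 (min T t)"

lemma clip: "clip t \<in> {0..T}" "t \<in> {0..T} \<Longrightarrow> clip t = t"
  using T by (auto simp: clip_def)

lemma continuous_on_clip: "continuous_on S clip"
  unfolding clip_def by (intro continuous_intros)

text \<open>The unknown is rescaled by \<open>exp (-2 L t)\<close>, so that the Picard operator contracts on the whole of
  \<open>[0, T]\<close>; the index is made part of the argument, which turns systems into a Banach space of
  bounded continuous functions.\<close>

definition idx :: "nat discrete \<times> real \<Rightarrow> nat" where "idx p = of_discrete (fst p)"

lemma idx_discrete [simp]: "idx (discrete i, t) = i"
  by (simp add: idx_def discrete_inverse)

definition unpack :: "(nat discrete \<times> real \<Rightarrow> 'a) \<Rightarrow> nat \<Rightarrow> real \<Rightarrow> 'a" where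
  "unpack u j s = u (discrete j, s)"

definition rhs :: "(nat \<Rightarrow> real \<Rightarrow> 'a) \<Rightarrow> nat \<Rightarrow> real \<Rightarrow> 'a" where
  "rhs u i s = F i (\<lambda>j. exp (2 * L * s) *\<^sub>R u j s)"

text \<open>The value 0 at indices from \<open>N\<close> on keeps the function bounded over the
  infinite index type and gives each solution one normal form.\<close>

definition picard :: "(nat \<Rightarrow> 'a) \<Rightarrow> (nat discrete \<times> real \<Rightarrow> 'a) \<Rightarrow> nat discrete \<times> real \<Rightarrow> 'a" where
  "picard y0 u p = (if idx p < N then exp (- (2 * L * clip (snd p))) *\<^sub>R
     (y0 (idx p) + integral {0..clip (snd p)} (rhs (unpack u) (idx p))) else 0)"

lemma continuous_on_rhs:
  assumes "continuous_on UNIV u" "i < N" shows "continuous_on S (rhs (unpack u) i)"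
  unfolding rhs_def
proof (rule continuous_on_F[OF _ assms(2)])
  fix j
  have "continuous_on S (\<lambda>s. u (discrete j, s))"
    by (rule continuous_on_compose2[OF assms(1)]) (auto intro!: continuous_intros)
  then show "continuous_on S (\<lambda>s. exp (2 * L * s) *\<^sub>R unpack u j s)"
    by (auto simp: unpack_def intro!: continuous_intros)
qed

lemma picard_bcontfun:
  assumes u: "continuous_on UNIV u" shows "picard y0 u \<in> bcontfun"
proof -
  define g where "g i t = (if i < N then exp (- (2 * L * t)) *\<^sub>R (y0 i + integral {0..t} (rhs (unpack u) i)) else 0)" for i t
  have g: "continuous_on {0..T} (g i)" for i
    unfolding g_def using continuous_on_rhs[OF u, of i "{0..T}"]
    by (cases "i < N") (auto intro!: continuous_intros indefinite_integral_continuous_1 integrable_continuous_real)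
  have p: "picard y0 u = (\<lambda>p. (g (of_discrete (fst p)) \<circ> clip) (snd p))"
    by (auto simp: picard_def g_def idx_def)
  have "continuous_on UNIV (g i \<circ> clip)" for i
    unfolding comp_def by (rule continuous_on_compose2[OF g continuous_on_clip]) (use clip(1) in blast)
  then have "continuous_on UNIV (picard y0 u)" unfolding p by (rule continuous_on_discrete_times)
  moreover have "bounded (range (picard y0 u))"
  proof (rule bounded_subset)
    show "bounded (insert 0 (\<Union>i<N. g i ` {0..T}))"
      using g by (auto intro!: compact_imp_bounded compact_continuous_image)
    show "range (picard y0 u) \<subseteq> insert 0 (\<Union>i<N. g i ` {0..T})"
      unfolding p using clip(1) by (auto simp: g_def)
  qed
  ultimately show ?thesis by (simp add: bcontfun_def)
qed

text \<open>The integral of \<open>L * exp (2 * L * s) * d\<close> over [0, t] is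
  \<open>(exp (2 * L * t) - 1) * d / 2\<close>; the rescaling factor
  \<open>exp (- (2 * L * t))\<close> brings it below \<open>d / 2\<close>, independently of
  T.\<close>

lemma picard_contraction:
  assumes u: "continuous_on UNIV u" and v: "continuous_on UNIV v" and d: "\<And>p. norm (u p - v p) \<le> d"
  shows "norm (picard y0 u p - picard y0 v p) \<le> d / 2"
proof (cases "idx p < N")
  case True
  define i t where "i = idx p" "t = clip (snd p)"
  have t: "0 \<le> t" "t \<le> T" using clip(1)[of "snd p"] by (auto simp: i_t_def)
  have i: "i < N" using True by (simp add: i_t_def)
  have d0: "d \<ge> 0" using d norm_ge_zero order_trans by blast
  note int = integrable_continuous_real[OF continuous_on_rhs[OF u i]] integrable_continuous_real[OF continuous_on_rhs[OF v i]]
  have hi: "((\<lambda>s. L * (exp (2 * L * s) * d)) has_integral (exp (2 * L * t) * d / 2 - exp (2 * L * 0) * d / 2)) {0..t}"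
    using t L by (intro fundamental_theorem_of_calculus) (auto intro!: derivative_eq_intros simp flip: has_real_derivative_iff_has_vector_derivative)
  have "picard y0 u p - picard y0 v p = exp (- (2 * L * t)) *\<^sub>R
     integral {0..t} (\<lambda>s. rhs (unpack u) i s - rhs (unpack v) i s)"
    using True by (simp add: picard_def integral_diff int scaleR_diff_right scaleR_add_right flip: i_t_def)
  also have "norm \<dots> = exp (- (2 * L * t)) * norm (integral {0..t} (\<lambda>s. rhs (unpack u) i s - rhs (unpack v) i s))"
    by simp
  also have "\<dots> \<le> exp (- (2 * L * t)) * integral {0..t} (\<lambda>s. L * (exp (2 * L * s) * d))"
  proof (intro mult_left_mono integral_norm_bound_integral)
    fix s
    show "norm (rhs (unpack u) i s - rhs (unpack v) i s) \<le> L * (exp (2 * L * s) * d)"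
      unfolding rhs_def using d d0 i
      by (intro lip) (auto simp: unpack_def simp flip: scaleR_diff_right)
  qed (use int hi in \<open>auto intro: integrable_diff\<close>)
  also have "\<dots> = exp (- (2 * L * t)) * (exp (2 * L * t) * d / 2 - d / 2)"
    using integral_unique[OF hi] by simp
  also have "\<dots> = d / 2 - exp (- (2 * L * t)) * d / 2"
    by (simp add: algebra_simps diff_divide_distrib flip: exp_add mult.assoc)
  also have "\<dots> \<le> d / 2" using d0 by simp
  finally show ?thesis .
next
  case False
  have "d \<ge> 0" using d norm_ge_zero order_trans by blast
  then show ?thesis using False by (simp add: picard_def)
qed

lemma picard_fixpoint: "\<exists>!u :: (nat discrete \<times> real) \<Rightarrow>\<^sub>C 'a. Bcontfun (picard y0 (apply_bcontfun u)) = u"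
proof (rule banach_fix_type[of "1/2" "\<lambda>u. Bcontfun (picard y0 (apply_bcontfun u))"])
  show "\<forall>u v. dist (Bcontfun (picard y0 (apply_bcontfun u))) (Bcontfun (picard y0 (apply_bcontfun v))) \<le> 1/2 * dist u v"
  proof (intro allI dist_bound)
    fix u v :: "(nat discrete \<times> real) \<Rightarrow>\<^sub>C 'a" and p
    have "norm (picard y0 (apply_bcontfun u) p - picard y0 (apply_bcontfun v) p) \<le> dist u v / 2"
      by (rule picard_contraction) (auto simp flip: dist_norm intro: dist_bounded)
    then show "dist (apply_bcontfun (Bcontfun (picard y0 (apply_bcontfun u))) p) (apply_bcontfun (Bcontfun (picard y0 (apply_bcontfun v))) p) \<le> 1/2 * dist u v"
      by (simp add: Bcontfun_inverse picard_bcontfun dist_norm)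
  qed
qed auto

lemma fixpoint_imp_solution:
  assumes u: "continuous_on UNIV u" "picard y0 u = u"
  shows "solution y0 (\<lambda>i t. exp (2 * L * t) *\<^sub>R u (discrete i, t))"
  unfolding solution_def
proof (intro allI impI conjI ballI)
  fix i assume i: "i < N"
  have eq: "exp (2 * L * t) *\<^sub>R u (discrete i, t) = y0 i + integral {0..t} (rhs (unpack u) i)" if "t \<in> {0..T}" for t
  proof -
    have "u (discrete i, t) = exp (- (2 * L * t)) *\<^sub>R (y0 i + integral {0..t} (rhs (unpack u) i))"
      using arg_cong[OF u(2), of "\<lambda>f. f (discrete i, t)"] i clip(2)[OF that] by (simp add: picard_def)
    then show ?thesis by (simp flip: exp_add)
  qed
  show "exp (2 * L * 0) *\<^sub>R u (discrete i, 0) = y0 i" using eq[of 0] T by simp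
  fix t assume t: "t \<in> {0..T}"
  have "((\<lambda>t. y0 i + integral {0..t} (rhs (unpack u) i)) has_vector_derivative 0 + rhs (unpack u) i t) (at t within {0..T})"
    by (intro has_vector_derivative_add has_vector_derivative_const integral_has_vector_derivative continuous_on_rhs u i t)
  then have "((\<lambda>t. exp (2 * L * t) *\<^sub>R u (discrete i, t)) has_vector_derivative rhs (unpack u) i t) (at t within {0..T})"
    using has_vector_derivative_transform[OF t, of "\<lambda>t. exp (2 * L * t) *\<^sub>R u (discrete i, t)"] eq by simp
  then show "((\<lambda>t. exp (2 * L * t) *\<^sub>R u (discrete i, t)) has_vector_derivative F i (\<lambda>j. exp (2 * L * t) *\<^sub>R u (discrete j, t))) (at t within {0..T})"
    by (simp add: rhs_def unpack_def)
qed

text \<open>Lets uniqueness of solutions follow from uniqueness of the Banach fixed point, with no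
  separate Gronwall argument.\<close>

lemma solution_imp_fixpoint:
  assumes y: "solution y0 y" and u_def: "u = (\<lambda>p. if idx p < N then exp (- (2 * L * clip (snd p))) *\<^sub>R y (idx p) (clip (snd p)) else 0)"
  shows "u \<in> bcontfun" "picard y0 u = u"
proof -
  have yc: "continuous_on {0..T} (y i)" if "i < N" for i
    unfolding continuous_on_eq_continuous_within
    using y that by (auto simp: solution_def intro: has_vector_derivative_continuous)
  define g where "g i t = (if i < N then exp (- (2 * L * t)) *\<^sub>R y i t else 0)" for i t
  have g: "continuous_on {0..T} (g i)" for i
    unfolding g_def using yc by (cases "i < N") (auto intro!: continuous_intros)
  have p: "u = (\<lambda>p. (g (of_discrete (fst p)) \<circ> clip) (snd p))"
    by (auto simp: u_def g_def idx_def)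
  have "continuous_on UNIV (g i \<circ> clip)" for i
    unfolding comp_def by (rule continuous_on_compose2[OF g continuous_on_clip]) (use clip(1) in blast)
  then have uc: "continuous_on UNIV u" unfolding p by (rule continuous_on_discrete_times)
  moreover have "bounded (range u)"
  proof (rule bounded_subset)
    show "bounded (insert 0 (\<Union>i<N. g i ` {0..T}))"
      using g by (auto intro!: compact_imp_bounded compact_continuous_image)
    show "range u \<subseteq> insert 0 (\<Union>i<N. g i ` {0..T})"
      unfolding p using clip(1) by (auto simp: g_def)
  qed
  ultimately show "u \<in> bcontfun" by (simp add: bcontfun_def)
  show "picard y0 u = u"
  proof
    fix p
    show "picard y0 u p = u p"
    proof (cases "idx p < N")
      case True
      define i t where "i = idx p" "t = clip (snd p)"
      have t: "0 \<le> t" "t \<le> T" using clip(1)[of "snd p"] by (auto simp: i_t_def)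
      have i: "i < N" using True by (simp add: i_t_def)
      have "((\<lambda>s. F i (\<lambda>j. y j s)) has_integral (y i t - y i 0)) {0..t}"
      proof (rule fundamental_theorem_of_calculus[OF t(1)])
        fix s assume s: "s \<in> {0..t}"
        then have "(y i has_vector_derivative F i (\<lambda>j. y j s)) (at s within {0..T})"
          using y i t by (simp add: solution_def)
        then show "(y i has_vector_derivative F i (\<lambda>j. y j s)) (at s within {0..t})"
          by (rule has_vector_derivative_within_subset) (use t in auto)
      qed
      moreover have "rhs (unpack u) i s = F i (\<lambda>j. y j s)" if "s \<in> {0..t}" for s
        unfolding rhs_def
      proof (rule F_cong[OF _ i])
        fix j assume "j < N"
        then show "exp (2 * L * s) *\<^sub>R unpack u j s = y j s"
          using that t clip(2)[of s] by (simp add: u_def unpack_def flip: exp_add)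
      qed
      ultimately have "((rhs (unpack u) i) has_integral (y i t - y i 0)) {0..t}"
        by (metis (no_types, lifting) has_integral_eq)
      then have "integral {0..t} (rhs (unpack u) i) = y i t - y0 i"
        using y i by (auto simp: solution_def integral_unique)
      then show ?thesis using True by (simp add: picard_def u_def flip: i_t_def)
    qed (simp add: picard_def u_def)
  qed
qed

theorem picard_lindelof:
  obtains y where "solution y0 y" "\<And>y' i t. solution y0 y' \<Longrightarrow> i < N \<Longrightarrow> t \<in> {0..T} \<Longrightarrow> y' i t = y i t"
proof -
  obtain u :: "(nat discrete \<times> real) \<Rightarrow>\<^sub>C 'a" where u: "Bcontfun (picard y0 (apply_bcontfun u)) = u"
    "\<And>v. Bcontfun (picard y0 (apply_bcontfun v)) = v \<Longrightarrow> v = u"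
    using picard_fixpoint[of y0] by auto
  have "picard y0 (apply_bcontfun u) = apply_bcontfun u"
    using u(1) by (metis Bcontfun_inverse continuous_on_apply_bcontfun picard_bcontfun)
  then have "solution y0 (\<lambda>i t. exp (2 * L * t) *\<^sub>R apply_bcontfun u (discrete i, t))"
    by (intro fixpoint_imp_solution) auto
  moreover have "y' i t = exp (2 * L * t) *\<^sub>R apply_bcontfun u (discrete i, t)"
    if y': "solution y0 y'" and i: "i < N" and t: "t \<in> {0..T}" for y' i t
  proof -
    define v where "v = (\<lambda>p. if idx p < N then exp (- (2 * L * clip (snd p))) *\<^sub>R y' (idx p) (clip (snd p)) else 0)"
    note v = solution_imp_fixpoint[OF y' v_def]
    have "Bcontfun v = u" using v by (intro u(2)) (simp add: Bcontfun_inverse)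
    then have "v = apply_bcontfun u" using v(1) Bcontfun_inverse by metis
    then have "apply_bcontfun u (discrete i, t) = exp (- (2 * L * t)) *\<^sub>R y' i t"
      using i clip(2)[OF t] by (auto simp: v_def dest: fun_cong[of _ _ "(discrete i,t)"])
    then show ?thesis by (simp flip: exp_add)
  qed
  ultimately show thesis by (rule that)
qed

end

section \<open>Bump functions\<close>

lemma Ck_SucI:
  assumes "\<And>p. (f has_derivative f' p) (at p)" "\<And>v. Ck k (\<lambda>p. f' p v)"
  shows "Ck (Suc k) f"
proof -
  have "frechet_derivative f (at p) = f' p" for p
    using frechet_derivative_at[OF assms(1)] by simp
  then show ?thesis unfolding Ck.simps using assms(2) differentiableI[OF assms(1)] by simp
qed

lemma Ck_has_derivative: "Ck (Suc k) f \<Longrightarrow> (f has_derivative frechet_derivative f (at p)) (at p)"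
  and Ck_derivative: "Ck (Suc k) f \<Longrightarrow> Ck k (\<lambda>p. frechet_derivative f (at p) v)"
  unfolding Ck.simps frechet_derivative_works by blast+

lemma Ck_SucD: "Ck (Suc k) f \<Longrightarrow> Ck k f"
proof (induction k arbitrary: f)
  case 0
  then show ?case by (auto intro!: continuous_at_imp_continuous_on differentiable_imp_continuous_within)
qed auto

lemma Ck_const: "Ck k (\<lambda>p. c)"
proof (induction k arbitrary: c)
  case (Suc k)
  show ?case by (rule Ck_SucI[of _ "\<lambda>p v. 0"]) (auto intro: Suc)
qed auto

lemma Ck_linear: "bounded_linear f \<Longrightarrow> Ck k f"
proof (cases k)
  case (Suc l)
  assume "bounded_linear f"
  then show ?thesis unfolding Suc
    by (intro Ck_SucI[of _ "\<lambda>p. f"]) (auto intro: Ck_const bounded_linear_imp_has_derivative)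
qed (auto intro: linear_continuous_on)

lemma Ck_add: "Ck k f \<Longrightarrow> Ck k g \<Longrightarrow> Ck k (\<lambda>p. f p + g p)"
proof (induction k arbitrary: f g)
  case (Suc k)
  show ?case
  proof (rule Ck_SucI)
    show "((\<lambda>p. f p + g p) has_derivative (\<lambda>v. frechet_derivative f (at p) v + frechet_derivative g (at p) v)) (at p)" for p
      using Suc.prems by (intro has_derivative_add Ck_has_derivative)
    show "Ck k (\<lambda>p. frechet_derivative f (at p) v + frechet_derivative g (at p) v)" for v
      using Suc.prems by (intro Suc.IH Ck_derivative)
  qed
qed (auto intro: continuous_intros)

lemma Ck_mult: "Ck k f \<Longrightarrow> Ck k g \<Longrightarrow> Ck k (\<lambda>p. f p * g p)"
proof (induction k arbitrary: f g)
  case (Suc k)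
  show ?case
  proof (rule Ck_SucI)
    show "((\<lambda>p. f p * g p) has_derivative (\<lambda>v. f p * frechet_derivative g (at p) v + frechet_derivative f (at p) v * g p)) (at p)" for p
      using Suc.prems by (intro has_derivative_mult Ck_has_derivative)
    show "Ck k (\<lambda>p. f p * frechet_derivative g (at p) v + frechet_derivative f (at p) v * g p)" for v
      using Suc.prems Suc.prems[THEN Ck_SucD] by (intro Suc.IH Ck_add Ck_derivative)
  qed
qed (auto intro: continuous_intros)

text \<open>This family is closed under differentiation, see \<open>has_derivative_flat\<close>; \<open>flat 0\<close> is the usual
  smooth function \<open>exp (-1/x)\<close>.\<close>

definition flat :: "nat \<Rightarrow> real \<Rightarrow> real" where
  "flat k x = (if x > 0 then (1 / x) ^ k * exp (- (1 / x)) else 0)"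

lemma flat_pos: "x > 0 \<Longrightarrow> flat k x > 0" and flat_zero: "x \<le> 0 \<Longrightarrow> flat k x = 0"
  and flat_nonneg: "flat k x \<ge> 0"
  by (auto simp: flat_def)

lemma flat_tendsto_0: "(flat k \<longlongrightarrow> 0) (at 0)"
proof -
  have "((\<lambda>x. (inverse x) ^ k / exp (inverse x)) \<longlongrightarrow> 0) (at_right (0::real))"
    by (rule filterlim_compose[OF tendsto_power_div_exp_0 filterlim_inverse_at_top_right])
  then have "(flat k \<longlongrightarrow> 0) (at_right 0)"
    by (rule Lim_transform_eventually)
       (auto simp: eventually_at_right_field flat_def exp_minus field_simps intro!: exI[of _ 1])
  moreover have "(flat k \<longlongrightarrow> 0) (at_left 0)"
    by (rule tendsto_eventually) (auto simp: eventually_at_left_field flat_def intro!: exI[of _ "-1"])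
  ultimately show ?thesis by (simp add: filterlim_split_at_real filterlim_split_at)
qed

lemma has_derivative_flat:
  "(flat k has_real_derivative flat (k + 2) x - k * flat (k + 1) x) (at x)"
proof -
  consider "x > 0" | "x < 0" | "x = 0" by linarith
  then show ?thesis
  proof cases
    case 1
    have "((\<lambda>x. (1 / x) ^ k * exp (- (1 / x))) has_real_derivative flat (k + 2) x - k * flat (k + 1) x) (at x)"
    proof -
      define y where "y = 1 / x"
      have d: "((\<lambda>x. 1 / x) has_real_derivative - (y\<^sup>2)) (at x)"
        using 1 by (auto intro!: derivative_eq_intros simp: y_def power2_eq_square)
      have e: "((\<lambda>x. exp (- (1 / x))) has_real_derivative exp (- y) * y\<^sup>2) (at x)"
        using DERIV_fun_exp[OF DERIV_minus[OF d]] by (simp flip: y_def)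
      have p: "((\<lambda>x. (1 / x) ^ k) has_real_derivative - (real k * y ^ (k + 1))) (at x)"
      proof (cases k)
        case (Suc l)
        show ?thesis using DERIV_power_Suc[OF d, of l] by (simp add: Suc power2_eq_square algebra_simps flip: y_def)
      qed simp
      show ?thesis using DERIV_mult[OF p e] 1
        by (simp add: flat_def power2_eq_square algebra_simps flip: y_def)
    qed
    then show ?thesis
      by (rule has_field_derivative_transform_within_open[of _ _ _ "{0<..}"]) (use 1 in \<open>auto simp: flat_def\<close>)
  next
    case 2
    have "((\<lambda>x. 0) has_real_derivative flat (k + 2) x - k * flat (k + 1) x) (at x)"
      using 2 by (simp add: flat_zero)
    then show ?thesis
      by (rule has_field_derivative_transform_within_open[of _ _ _ "{..<0}"]) (use 2 in \<open>auto simp: flat_def\<close>)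
  next
    case 3
    \<comment> \<open>At the origin the difference quotient of \<open>flat k\<close> is
      \<open>flat (Suc k)\<close>, which tends to 0.\<close>
    have "((\<lambda>h. (flat k (0 + h) - flat k 0) / h) \<longlongrightarrow> 0) (at 0)"
      by (rule Lim_transform_eventually[OF flat_tendsto_0[of "Suc k"]])
         (auto simp: eventually_at_filter flat_def field_simps)
    then show ?thesis unfolding 3 DERIV_def by (simp add: flat_zero)
  qed
qed

lemma continuous_on_flat: "continuous_on S (flat k)"
  by (intro continuous_at_imp_continuous_on ballI DERIV_isCont[OF has_derivative_flat])

lemma Ck_flat:
  assumes "\<And>k. Ck k g" shows "Ck k (\<lambda>p. flat n (g p))"
proof (induction k arbitrary: n)
  case 0
  have "continuous_on UNIV g" using assms[of 0] by simp
  then show ?case using continuous_on_compose2[OF continuous_on_flat[of UNIV]] by (metis Ck.simps(1) subset_UNIV)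
next
  case (Suc k)
  show ?case
  proof (rule Ck_SucI)
    fix p
    have "(g has_derivative frechet_derivative g (at p)) (at p)"
      using assms[of "Suc 0"] by (rule Ck_has_derivative)
    from has_derivative_compose[OF this has_derivative_flat[of n "g p", unfolded has_field_derivative_def]]
    show "((\<lambda>p. flat n (g p)) has_derivative (\<lambda>v. (flat (n + 2) (g p) + (- real n) * flat (n + 1) (g p)) * frechet_derivative g (at p) v)) (at p)"
      by simp
  next
    fix v
    have "Ck k (\<lambda>p. frechet_derivative g (at p) v)" using assms[of "Suc k"] by (rule Ck_derivative)
    then show "Ck k (\<lambda>p. (flat (n + 2) (g p) + (- real n) * flat (n + 1) (g p)) * frechet_derivative g (at p) v)"
      by (intro Ck_mult Ck_add Suc.IH Ck_const)
  qed
qed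

text \<open>Built from squared distances, which are polynomials, so that smoothness at the centre is
  no issue.\<close>

definition bump :: "R3 \<Rightarrow> real \<Rightarrow> real \<Rightarrow> real \<Rightarrow> R3 \<times> real \<Rightarrow> real" where
  "bump c \<epsilon> t0 \<tau> p = flat 0 (\<epsilon>\<^sup>2 - (norm (fst p - c))\<^sup>2) * flat 0 (\<tau>\<^sup>2 - (snd p - t0)\<^sup>2)"

lemma Ck_space_part: "Ck k (\<lambda>p. \<epsilon>\<^sup>2 - (norm (fst p - c))\<^sup>2)"
proof (cases k)
  case 0
  then show ?thesis by (auto intro!: continuous_intros)
next
  case (Suc l)
  show ?thesis unfolding Suc power2_norm_eq_inner
  proof (rule Ck_SucI)
    show "((\<lambda>p :: R3 \<times> real. \<epsilon>\<^sup>2 - (fst p - c) \<bullet> (fst p - c)) has_derivative (\<lambda>v. - 2 * (fst p \<bullet> fst v) + 2 * (c \<bullet> fst v))) (at p)" for p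
      by (auto intro!: derivative_eq_intros simp: inner_diff_left inner_diff_right inner_commute)
    show "Ck l (\<lambda>p :: R3 \<times> real. - 2 * (fst p \<bullet> fst v) + 2 * (c \<bullet> fst v))" for v :: "R3 \<times> real"
      by (rule Ck_add[OF Ck_linear[OF bounded_linear_const_mult[OF bounded_linear_inner_left_comp[OF bounded_linear_fst]]] Ck_const])
  qed
qed

lemma has_derivative_time_part:
  "((\<lambda>p :: R3 \<times> real. \<tau>\<^sup>2 - (snd p - t0)\<^sup>2) has_derivative (\<lambda>v. - 2 * (snd p - t0) * snd v)) (at p)"
proof -
  have d: "((\<lambda>p :: R3 \<times> real. snd p - t0) has_derivative snd) (at p)"
    using has_derivative_diff[OF bounded_linear_imp_has_derivative[OF bounded_linear_snd] has_derivative_const, of t0] by simp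
  have eq: "(\<lambda>v :: R3 \<times> real. 0 - ((snd p - t0) * snd v + snd v * (snd p - t0))) = (\<lambda>v. - 2 * (snd p - t0) * snd v)"
    by (rule ext) algebra
  show ?thesis using has_derivative_diff[OF has_derivative_const has_derivative_mult[OF d d], of "\<tau>\<^sup>2"]
    unfolding eq power2_eq_square .
qed

lemma Ck_time_part: "Ck k (\<lambda>p. \<tau>\<^sup>2 - (snd p - t0)\<^sup>2)"
proof (cases k)
  case 0
  show ?thesis unfolding 0 Ck.simps by (intro continuous_intros)
next
  case (Suc l)
  show ?thesis unfolding Suc
  proof (rule Ck_SucI)
    have eq: "(\<lambda>v :: R3 \<times> real. (- 2 * snd v) * snd p + 2 * (t0 * snd v)) = (\<lambda>v. - 2 * (snd p - t0) * snd v)" for p :: "R3 \<times> real"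
      by (rule ext) (simp add: left_diff_distrib)
    show "((\<lambda>p :: R3 \<times> real. \<tau>\<^sup>2 - (snd p - t0)\<^sup>2) has_derivative (\<lambda>v. (- 2 * snd v) * snd p + 2 * (t0 * snd v))) (at p)" for p
      unfolding eq by (rule has_derivative_time_part)
    show "Ck l (\<lambda>p :: R3 \<times> real. (- 2 * snd v) * snd p + 2 * (t0 * snd v))" for v :: "R3 \<times> real"
      by (rule Ck_add[OF Ck_linear[OF bounded_linear_const_mult[OF bounded_linear_snd]] Ck_const])
  qed
qed

lemma test_function_bump:
  assumes "\<epsilon> > 0" "\<tau> > 0" shows "test_function (bump c \<epsilon> t0 \<tau>)"
  unfolding test_function_def
proof (intro conjI allI)
  show "Ck k (bump c \<epsilon> t0 \<tau>)" for k
    unfolding bump_def by (intro Ck_mult Ck_flat Ck_space_part Ck_time_part)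
  have "{p. bump c \<epsilon> t0 \<tau> p \<noteq> 0} \<subseteq> cball c \<epsilon> \<times> cball t0 \<tau>"
  proof
    fix p assume "p \<in> {p. bump c \<epsilon> t0 \<tau> p \<noteq> 0}"
    then have "(norm (fst p - c))\<^sup>2 < \<epsilon>\<^sup>2" "(snd p - t0)\<^sup>2 < \<tau>\<^sup>2"
      by (auto simp: bump_def flat_def split: if_splits)
    then have "norm (fst p - c) < \<epsilon>" "\<bar>snd p - t0\<bar> < \<tau>"
      using assms power2_less_imp_less[of "norm (fst p - c)" \<epsilon>] power2_less_imp_less[of "\<bar>snd p - t0\<bar>" \<tau>] by auto
    then show "p \<in> cball c \<epsilon> \<times> cball t0 \<tau>"
      by (cases p) (auto simp: dist_norm norm_minus_commute)
  qed
  then have "bounded {p. bump c \<epsilon> t0 \<tau> p \<noteq> 0}"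
    by (rule bounded_subset[rotated]) (intro bounded_Times bounded_cball)
  then show "compact (closure {p. bump c \<epsilon> t0 \<tau> p \<noteq> 0})" by simp
qed

text \<open>\<open>flat 2\<close> is the derivative of \<open>flat 0\<close>. Directions with zero
  time component suffice, because the defect tested in \<open>weak_difference\<close> has that
  form.\<close>

lemma frechet_derivative_bump:
  "frechet_derivative (bump c \<epsilon> t0 \<tau>) (at (z, t)) (v, 0) =
     flat 2 (\<epsilon>\<^sup>2 - (norm (z - c))\<^sup>2) * (- 2 * ((z - c) \<bullet> v)) * flat 0 (\<tau>\<^sup>2 - (t - t0)\<^sup>2)"
proof -
  let ?a = "\<lambda>p :: R3 \<times> real. \<epsilon>\<^sup>2 - (norm (fst p - c))\<^sup>2" and ?b = "\<lambda>p :: R3 \<times> real. \<tau>\<^sup>2 - (snd p - t0)\<^sup>2"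
  have f: "(flat 0 has_derivative (\<lambda>h. flat 2 x * h)) (at x)" for x
    using has_derivative_flat[of 0 x] by (simp add: has_field_derivative_def numeral_2_eq_2)
  have a: "(?a has_derivative (\<lambda>v. - 2 * ((z - c) \<bullet> fst v))) (at (z, t))"
    unfolding power2_norm_eq_inner by (auto intro!: derivative_eq_intros simp: inner_commute)
  have b: "(?b has_derivative (\<lambda>v. - 2 * (t - t0) * snd v)) (at (z, t))"
    using has_derivative_time_part[of \<tau> t0 "(z, t)"] by simp
  have "(bump c \<epsilon> t0 \<tau> has_derivative (\<lambda>v. flat 0 (?a (z,t)) * (flat 2 (?b (z,t)) * (- 2 * (t - t0) * snd v))
     + flat 2 (?a (z,t)) * (- 2 * ((z - c) \<bullet> fst v)) * flat 0 (?b (z,t)))) (at (z, t))"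
    unfolding bump_def by (rule has_derivative_mult[OF has_derivative_compose[OF a f] has_derivative_compose[OF b f]])
  from frechet_derivative_at[OF this, symmetric] show ?thesis by simp
qed

section \<open>Derivatives of test functions\<close>

lemma test_function_differentiable: "test_function f \<Longrightarrow> f differentiable (at p)"
  unfolding test_function_def using Ck.simps(2)[of 0 f] by blast

lemma test_function_continuous: "test_function f \<Longrightarrow> continuous_on S f"
  by (auto simp: test_function_def dest!: spec[of _ 0] intro: continuous_on_subset)

lemma test_function_has_derivative: "test_function f \<Longrightarrow> (f has_derivative frechet_derivative f (at p)) (at p)"
  using test_function_differentiable frechet_derivative_works by blast

lemma test_function_linear: "test_function f \<Longrightarrow> linear (frechet_derivative f (at p))"
  using test_function_has_derivative has_derivative_linear by blast

text \<open>\<open>Ck\<close> gives continuity of the derivative only for each fixed direction;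
  expanding a varying direction in the basis reduces to that case.\<close>

lemma continuous_on_frechet_derivative:
  assumes f: "test_function f" and "continuous_on S p" "continuous_on S v"
  shows "continuous_on S (\<lambda>s. frechet_derivative f (at (p s)) (v s))"
proof -
  have "frechet_derivative f (at (p s)) (v s) = (\<Sum>b\<in>Basis. (v s \<bullet> b) * frechet_derivative f (at (p s)) b)" for s
  proof -
    have "frechet_derivative f (at (p s)) (v s) = frechet_derivative f (at (p s)) (\<Sum>b\<in>Basis. (v s \<bullet> b) *\<^sub>R b)"
      by (simp only: euclidean_representation)
    also have "\<dots> = (\<Sum>b\<in>Basis. (v s \<bullet> b) * frechet_derivative f (at (p s)) b)"
      using test_function_linear[OF f] by (simp add: linear_sum linear_cmul)
    finally show ?thesis .
  qed
  moreover have "continuous_on S (\<lambda>s. frechet_derivative f (at (p s)) b)" for b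
  proof -
    have "Ck (Suc 0) f" using f unfolding test_function_def by blast
    then have "continuous_on UNIV (\<lambda>p. frechet_derivative f (at p) b)" using Ck_derivative by fastforce
    then show ?thesis by (rule continuous_on_compose2[OF _ assms(2)]) auto
  qed
  ultimately show ?thesis using assms(3) by (auto intro!: continuous_intros)
qed

section \<open>Weak solutions carried by finitely many trajectories\<close>

lemma Jmat_nth: "(Jmat *v x) $ 1 = - x $ 2" "(Jmat *v x) $ 2 = x $ 1" "(Jmat *v x) $ 3 = 0"
  by (simp_all add: Jmat_def matrix_vector_mult_def sum_3)

lemma bounded_linear_Jmat: "bounded_linear (\<lambda>x. Jmat *v x)"
  by (rule matrix_vector_mul_bounded_linear)

lemma continuous_on_Jmat [continuous_intros]: "continuous_on S f \<Longrightarrow> continuous_on S (\<lambda>s. Jmat *v f s)"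
  by (rule bounded_linear.continuous_on[OF bounded_linear_Jmat])

lemma norm_Jmat_le: "norm (Jmat *v x) \<le> norm x"
proof -
  have "(Jmat *v x) \<bullet> (Jmat *v x) \<le> x \<bullet> x"
    by (simp add: inner_vec_def sum_3 Jmat_nth)
  then show ?thesis by (simp add: norm_le)
qed

lemma inner_3: "x \<bullet> y = x $ 1 * y $ 1 + x $ 2 * y $ 2 + x $ 3 * y $ 3" for x y :: R3
  by (simp add: inner_vec_def sum_3)

lemma set_integral_continuous:
  fixes f :: "real \<Rightarrow> real"
  assumes "continuous_on {a..b} f" shows "(LINT t:{a..b}|lborel. f t) = integral {a..b} f"
  using set_borel_integral_eq_integral(2)[OF borel_integrable_atLeastAtMost'[OF assms]] .

text \<open>The competitor is the coupling that sends each point to the one with the same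
  label.\<close>

lemma W2_discr_le:
  assumes m: "mass_vector N m"
  shows "W2 (discr N m y) (discr N m y') \<le> sqrt (\<Sum>i<N. m i * (dist (y i) (y' i))\<^sup>2)"
proof -
  define P where "P = density (count_space {..<N}) (\<lambda>i. ennreal (m i))"
  define \<pi> where "\<pi> = distr P (borel :: (R3 \<times> R3) measure) (\<lambda>i. (y i, y' i))"
  have pm: "f \<in> P \<rightarrow>\<^sub>M L" if "range f \<subseteq> space L" for f and L :: "'b measure"
    unfolding P_def using that by (auto simp: measurable_def)
  have c: "\<pi> \<in> Couplings (discr N m y) (discr N m y')"
    unfolding Couplings_def
  proof (intro CollectI conjI ballI)
    show "sets \<pi> = sets borel" by (simp add: \<pi>_def)
    fix A :: "R3 set" assume A: "A \<in> sets borel"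
    have AU: "A \<times> (UNIV::R3 set) \<in> sets borel" "(UNIV::R3 set) \<times> A \<in> sets borel"
      unfolding borel_prod[symmetric] using A by auto
    show "emeasure \<pi> (A \<times> UNIV) = emeasure (discr N m y) A"
      unfolding \<pi>_def discr_def P_def[symmetric] using A AU by (simp add: emeasure_distr pm vimage_def)
    show "emeasure \<pi> (UNIV \<times> A) = emeasure (discr N m y') A"
      unfolding \<pi>_def discr_def P_def[symmetric] using A AU by (simp add: emeasure_distr pm vimage_def)
  qed
  have "transport_cost \<pi> = (\<integral>\<^sup>+ i. ennreal ((dist (y i) (y' i))\<^sup>2) \<partial>P)"
    unfolding transport_cost_def \<pi>_def
    by (subst nn_integral_distr) (auto intro!: pm borel_measurable_continuous_onI continuous_intros)
  also have "\<dots> = (\<Sum>i<N. ennreal (m i) * ennreal ((dist (y i) (y' i))\<^sup>2))"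
    unfolding P_def by (subst nn_integral_density) (auto simp: nn_integral_count_space_finite)
  also have "\<dots> = ennreal (\<Sum>i<N. m i * (dist (y i) (y' i))\<^sup>2)"
    using m by (subst sum_ennreal[symmetric])
      (auto simp: mass_vector_def ennreal_mult less_imp_le intro!: sum.cong mult_nonneg_nonneg)
  finally have t: "transport_cost \<pi> = ennreal (\<Sum>i<N. m i * (dist (y i) (y' i))\<^sup>2)" .
  have "(INF \<pi> \<in> Couplings (discr N m y) (discr N m y'). transport_cost \<pi>) \<le> ennreal (\<Sum>i<N. m i * (dist (y i) (y' i))\<^sup>2)"
    unfolding t[symmetric] by (rule INF_lower[OF c])
  then have "enn2real (INF \<pi> \<in> Couplings (discr N m y) (discr N m y'). transport_cost \<pi>) \<le> (\<Sum>i<N. m i * (dist (y i) (y' i))\<^sup>2)"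
    using m by (intro enn2real_leI) (auto simp: mass_vector_def less_imp_le intro!: sum_nonneg mult_nonneg_nonneg)
  then show ?thesis unfolding W2_def by simp
qed

lemma has_real_derivative_zero_squeeze:
  fixes R Q :: "real \<Rightarrow> real"
  assumes "\<And>s. s \<in> S \<Longrightarrow> \<bar>R s\<bar> \<le> C * Q s" "Q t = 0" "(Q has_real_derivative 0) (at t within S)" "t \<in> S"
  shows "(R has_real_derivative 0) (at t within S)"
proof -
  have R: "R t = 0" using assms(1)[OF assms(4)] assms(2) by simp
  have "((\<lambda>s. C * ((Q s - Q t) / (s - t))) \<longlongrightarrow> C * 0) (at t within S)"
    using assms(3) unfolding has_field_derivative_iff by (intro tendsto_intros)
  then have "((\<lambda>s. \<bar>C * ((Q s - Q t) / (s - t))\<bar>) \<longlongrightarrow> 0) (at t within S)"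
    by (intro tendsto_rabs_zero) simp
  then have "((\<lambda>s. (R s - R t) / (s - t)) \<longlongrightarrow> 0) (at t within S)"
  proof (rule Lim_null_comparison[rotated])
    have "\<bar>R s\<bar> / \<bar>s - t\<bar> \<le> \<bar>C * Q s\<bar> / \<bar>s - t\<bar>" if "s \<in> S" for s
      using assms(1)[OF that] by (intro divide_right_mono) auto
    then show "eventually (\<lambda>s. norm ((R s - R t) / (s - t)) \<le> \<bar>C * ((Q s - Q t) / (s - t))\<bar>) (at t within S)"
      by (auto simp: eventually_at_filter R assms(2) abs_mult)
  qed
  then show ?thesis by (simp add: has_field_derivative_iff)
qed

lemma integral_discr_test_function:
  assumes "mass_vector N m" "test_function \<phi>"
  shows "(LINT x|discr N m y. \<phi> (x, s)) = (\<Sum>i<N. m i * \<phi> (y i, s))"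
proof (rule integral_discr[OF assms(1)])
  have "continuous_on UNIV (\<lambda>x. \<phi> (x, s))"
    by (rule continuous_on_compose2[OF test_function_continuous[OF assms(2), of UNIV]]) (auto intro!: continuous_intros)
  then show "(\<lambda>x. \<phi> (x, s)) \<in> borel_measurable borel" by (rule borel_measurable_continuous_onI)
qed

text \<open>A curve of discrete measures without any equation, so that it fits the constructed
  solution as well as a competitor, before and after relabelling.\<close>

locale discrete_curve = source_domain +
  fixes N :: nat and m :: "nat \<Rightarrow> real" and z z' :: "nat \<Rightarrow> real \<Rightarrow> R3" and T :: real
  assumes T: "T > 0" and m: "mass_vector N m"
    and deriv: "\<And>i t. i < N \<Longrightarrow> t \<in> {0..T} \<Longrightarrow> (z i has_vector_derivative z' i t) (at t within {0..T})"
    and cont': "\<And>i. i < N \<Longrightarrow> continuous_on {0..T} (z' i)"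
    and inj: "\<And>t. t \<in> {0..T} \<Longrightarrow> inj_on (\<lambda>i. z i t) {..<N}"
begin

abbreviation cmom :: "nat \<Rightarrow> real \<Rightarrow> R3" where
  "cmom i t \<equiv> cell_moment N m (\<lambda>j. z j t) i"

definition vel :: "nat \<Rightarrow> real \<Rightarrow> R3" where
  "vel i t = Jmat *v (z i t - (1 / m i) *\<^sub>R cmom i t)"

lemma N_pos: "N > 0"
  using m by (cases N) (auto simp: mass_vector_def)

lemma m_pos: "i < N \<Longrightarrow> m i > 0"
  using m by (auto simp: mass_vector_def)

lemma cont: "i < N \<Longrightarrow> continuous_on {0..T} (z i)"
  unfolding continuous_on_eq_continuous_within using deriv has_vector_derivative_continuous by blast

lemma continuous_cmom:
  assumes i: "i < N" shows "continuous_on {0..T} (cmom i)"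
  unfolding continuous_on_def
proof
  fix t assume t: "t \<in> {0..T}"
  obtain \<delta> where \<delta>: "\<delta> > 0" "\<And>i j. i < N \<Longrightarrow> j < N \<Longrightarrow> i \<noteq> j \<Longrightarrow> norm (z i t - z j t) \<ge> \<delta>"
    using separation[OF inj[OF t]] by blast
  let ?C = "128 * (real N)\<^sup>2 * rad^4 / \<delta>" and ?F = "at t within {0..T}"
  have "((\<lambda>s. ?C * (\<Sum>j<N. norm (z j s - z j t))) \<longlongrightarrow> ?C * (\<Sum>j<N. norm (z j t - z j t))) ?F"
    using cont t unfolding continuous_on_def by (intro tendsto_intros) auto
  then have "((\<lambda>s. ?C * (\<Sum>j<N. norm (z j s - z j t))) \<longlongrightarrow> 0) ?F" by simp
  then have "((\<lambda>s. cmom i s - cmom i t) \<longlongrightarrow> 0) ?F"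
  proof (rule Lim_null_comparison[rotated])
    have "norm (cmom i s - cmom i t) \<le> ?C * (\<Sum>j<N. norm (z j s - z j t))" if "s \<in> {0..T}" for s
      using i by (intro cell_moment_lipschitz[OF N_pos m inj[OF that] \<delta>])
        (auto intro!: sum_nonneg member_le_sum[of _ "{..<N}" "\<lambda>j. norm (z j s - z j t)"])
    then show "eventually (\<lambda>s. norm (cmom i s - cmom i t) \<le> ?C * (\<Sum>j<N. norm (z j s - z j t))) ?F"
      by (auto simp: eventually_at_filter)
  qed
  then show "(cmom i \<longlongrightarrow> cmom i t) ?F" by (rule Lim_null[THEN iffD2])
qed

lemma continuous_vel: "i < N \<Longrightarrow> continuous_on {0..T} (vel i)"
  unfolding vel_def by (intro continuous_intros cont continuous_cmom)

lemma integral_discr_test: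
  assumes \<phi>: "test_function \<phi>"
  shows "(LINT x|discr N m y. frechet_derivative \<phi> (at (x, t)) (0, 1) + frechet_derivative \<phi> (at (x, t)) (Jmat *v x, 0))
    = (\<Sum>i<N. m i * (frechet_derivative \<phi> (at (y i, t)) (0, 1) + frechet_derivative \<phi> (at (y i, t)) (Jmat *v y i, 0)))"
  by (rule integral_discr[OF m])
     (intro borel_measurable_continuous_onI continuous_intros continuous_on_frechet_derivative[OF \<phi>])

text \<open>On cell i the gradient is constantly \<open>y i\<close>, so the integrand is a fixed
  linear function of x and its integral depends on the cell through the first moment alone.\<close>

lemma integral_brenier_test:
  assumes \<phi>: "test_function \<phi>" and y: "inj_on y {..<N}"
  shows "(LINT x|M. frechet_derivative \<phi> (at (grad (brenier \<Omega> (discr N m y)) x, t)) (Jmat *v x, 0))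
    = (\<Sum>i<N. frechet_derivative \<phi> (at (y i, t)) (Jmat *v cell_moment N m y i, 0))"
proof -
  define w where "w = weights N m y"
  note tess = tessellates_weights[OF N_pos m y, folded w_def]
  let ?b = "brenier \<Omega> (discr N m y)"
  let ?D = "\<lambda>a x. frechet_derivative \<phi> (at (a, t)) (Jmat *v x, 0)"
  have b: "?b = potential N y w" unfolding w_def by (rule brenier_discr[OF N_pos y m])
  have gm: "grad ?b \<in> M \<rightarrow>\<^sub>M borel"
    using is_brenier_potential[OF N_pos y m tess] unfolding b is_brenier_def by blast
  have idm: "(\<lambda>x. x) \<in> M \<rightarrow>\<^sub>M borel" by (rule measurable_M) simp
  have lin: "bounded_linear (?D a)" for a
  proof -
    have "bounded_linear (frechet_derivative \<phi> (at (a, t)))"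
      using test_function_has_derivative[OF \<phi>] has_derivative_bounded_linear by blast
    moreover have "bounded_linear (\<lambda>x. (Jmat *v x, 0 :: real))"
      by (intro bounded_linear_Pair bounded_linear_Jmat bounded_linear_zero)
    ultimately show ?thesis using bounded_linear_compose by blast
  qed
  have dsc: "?D a (indicator A x *\<^sub>R x) = indicator A x * ?D a x" for a A and x :: R3
    using linear_cmul[OF bounded_linear.linear[OF lin]] by simp
  have int: "integrable M (\<lambda>x. indicator (cell N y w i) x * ?D a x)" for i a
    unfolding dsc[symmetric] by (rule integrable_bounded_linear[OF lin integrable_moment])
  have "(LINT x|M. ?D (grad ?b x) x) = (LINT x|M. (\<Sum>i<N. indicator (cell N y w i) x * ?D (y i) x))"
  proof (rule integral_cong_AE)
    have "continuous_on UNIV (\<lambda>p. ?D (fst p) (snd p))"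
      by (intro continuous_on_frechet_derivative[OF \<phi>] continuous_intros)
    then have "(\<lambda>p. ?D (fst p) (snd p)) \<in> borel_measurable borel" by (rule borel_measurable_continuous_onI)
    moreover have "(\<lambda>x. (grad ?b x, x)) \<in> M \<rightarrow>\<^sub>M borel"
      unfolding borel_prod[symmetric] using gm idm by measurable
    ultimately have "(\<lambda>x. ?D (fst (grad ?b x, x)) (snd (grad ?b x, x))) \<in> borel_measurable M"
      by (rule measurable_compose[rotated])
    then show "(\<lambda>x. ?D (grad ?b x) x) \<in> borel_measurable M" by simp
    show "(\<lambda>x. \<Sum>i<N. indicator (cell N y w i) x * ?D (y i) x) \<in> borel_measurable M"
      by (intro borel_measurable_integrable Bochner_Integration.integrable_sum int)
    show "AE x in M. ?D (grad ?b x) x = (\<Sum>i<N. indicator (cell N y w i) x * ?D (y i) x)"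
      using N_pos y
    proof (rule AE_cellI)
      fix x i assume i: "x \<in> cell N y w i" "i < N"
      show "?D (grad ?b x) x = (\<Sum>i<N. indicator (cell N y w i) x * ?D (y i) x)"
        unfolding sum_indicator_cell_real[OF i] b using grad_potential[OF i] by simp
    qed
  qed
  also have "\<dots> = (\<Sum>i<N. (LINT x|M. indicator (cell N y w i) x * ?D (y i) x))"
    by (intro Bochner_Integration.integral_sum int)
  also have "\<dots> = (\<Sum>i<N. ?D (y i) (cell_moment N m y i))"
    unfolding dsc[symmetric] integral_bounded_linear[OF lin integrable_moment]
    by (simp add: cell_moment_def moment_def w_def)
  finally show ?thesis .
qed

text \<open>With \<open>v = vel\<close> this is the integrand of the weak formulation, with
  \<open>v = z'\<close> the total time derivative of the tested measure; comparing the two is the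
  whole link between weak solutions and the equation.\<close>

definition action :: "(R3 \<times> real \<Rightarrow> real) \<Rightarrow> (nat \<Rightarrow> real \<Rightarrow> R3) \<Rightarrow> real \<Rightarrow> real" where
  "action \<phi> v t = (\<Sum>i<N. m i * frechet_derivative \<phi> (at (z i t, t)) (v i t, 1))"

lemma continuous_action:
  assumes "test_function \<phi>" "\<And>i. i < N \<Longrightarrow> continuous_on {0..T} (v i)"
  shows "continuous_on {0..T} (action \<phi> v)"
  unfolding action_def using assms(2)
  by (intro continuous_intros continuous_on_frechet_derivative[OF assms(1)] cont) auto

lemma weak_form:
  assumes \<phi>: "test_function \<phi>" and \<alpha>: "\<And>t. t \<in> {0..T} \<Longrightarrow> \<alpha> t = discr N m (\<lambda>i. z i t)"
  shows "(LINT t:{0..T}|lborel. LINT x|\<alpha> t. frechet_derivative \<phi> (at (x, t)) (0, 1) + frechet_derivative \<phi> (at (x, t)) (Jmat *v x, 0))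
      - (LINT t:{0..T}|lborel. LINT x|M. frechet_derivative \<phi> (at (grad (brenier \<Omega> (\<alpha> t)) x, t)) (Jmat *v x, 0))
    = integral {0..T} (action \<phi> vel)"
proof -
  let ?D = "\<lambda>i t. frechet_derivative \<phi> (at (z i t, t))"
  define A where "A t = (\<Sum>i<N. m i * (?D i t (0, 1) + ?D i t (Jmat *v z i t, 0)))" for t
  define B where "B t = (\<Sum>i<N. ?D i t (Jmat *v cmom i t, 0))" for t
  have A: "continuous_on {0..T} A" unfolding A_def
    by (intro continuous_intros continuous_on_frechet_derivative[OF \<phi>] cont) auto
  have B: "continuous_on {0..T} B" unfolding B_def
    by (intro continuous_intros continuous_on_frechet_derivative[OF \<phi>] cont continuous_cmom) auto
  have 1: "(LINT t:{0..T}|lborel. LINT x|\<alpha> t. frechet_derivative \<phi> (at (x, t)) (0, 1) + frechet_derivative \<phi> (at (x, t)) (Jmat *v x, 0)) = integral {0..T} A"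
    unfolding set_integral_continuous[OF A, symmetric]
    by (rule set_lebesgue_integral_cong) (auto simp: \<alpha> A_def integral_discr_test[OF \<phi>])
  have 2: "(LINT t:{0..T}|lborel. LINT x|M. frechet_derivative \<phi> (at (grad (brenier \<Omega> (\<alpha> t)) x, t)) (Jmat *v x, 0)) = integral {0..T} B"
    unfolding set_integral_continuous[OF B, symmetric]
    by (rule set_lebesgue_integral_cong) (auto simp: \<alpha> B_def integral_brenier_test[OF \<phi> inj])
  have "A t - B t = action \<phi> vel t" for t
    unfolding A_def B_def action_def sum_subtractf[symmetric]
  proof (rule sum.cong[OF refl])
    fix i assume "i \<in> {..<N}"
    then have mi: "m i \<noteq> 0" using m_pos[of i] by auto
    note l = test_function_linear[OF \<phi>, of "(z i t, t)"]
    have "(vel i t, 1) = (0, 1) + (Jmat *v z i t, 0) - (1 / m i) *\<^sub>R (Jmat *v cmom i t, 0)"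
      by (simp add: vel_def matrix_vector_mult_diff_distrib matrix_vector_mult_scaleR)
    then have "?D i t (vel i t, 1) = ?D i t ((0, 1) + (Jmat *v z i t, 0) - (1 / m i) *\<^sub>R (Jmat *v cmom i t, 0))"
      by (rule arg_cong)
    also have "\<dots> = ?D i t (0, 1) + ?D i t (Jmat *v z i t, 0) - (1 / m i) * ?D i t (Jmat *v cmom i t, 0)"
      unfolding linear_diff[OF l] linear_add[OF l] linear_cmul[OF l] by simp
    finally show "m i * (?D i t (0, 1) + ?D i t (Jmat *v z i t, 0)) - ?D i t (Jmat *v cmom i t, 0) = m i * ?D i t (vel i t, 1)"
      using mi by (simp add: field_simps)
  qed
  then show ?thesis unfolding 1 2
    using integral_diff[OF integrable_continuous_real[OF A] integrable_continuous_real[OF B]] by simp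
qed

lemma integral_action_deriv:
  assumes \<phi>: "test_function \<phi>"
  shows "integral {0..T} (action \<phi> z') = (\<Sum>i<N. m i * \<phi> (z i T, T)) - (\<Sum>i<N. m i * \<phi> (z i 0, 0))"
proof (rule integral_unique, rule fundamental_theorem_of_calculus)
  fix t assume t: "t \<in> {0..T}"
  have "((\<lambda>t. \<phi> (z i t, t)) has_vector_derivative frechet_derivative \<phi> (at (z i t, t)) (z' i t, 1)) (at t within {0..T})" if i: "i < N" for i
  proof -
    have "((\<lambda>t. (z i t, t)) has_vector_derivative (z' i t, 1)) (at t within {0..T})"
      using deriv[OF i t] by (intro has_vector_derivative_Pair has_vector_derivative_id)
    then show ?thesis
      using vector_derivative_diff_chain_within[OF _ has_derivative_at_withinI[OF test_function_has_derivative[OF \<phi>]]]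
      by (simp add: comp_def)
  qed
  then show "((\<lambda>t. \<Sum>i<N. m i * \<phi> (z i t, t)) has_vector_derivative action \<phi> z' t) (at t within {0..T})"
    unfolding action_def
    by (auto intro!: has_vector_derivative_sum has_vector_derivative_mult_right)
qed (use T in auto)

lemma geostrophic_solution_of_ode:
  assumes ode: "\<And>i t. i < N \<Longrightarrow> t \<in> {0..T} \<Longrightarrow> z' i t = vel i t"
    and \<alpha>: "\<And>t. t \<in> {0..T} \<Longrightarrow> \<alpha> t = discr N m (\<lambda>i. z i t)"
  shows "geostrophic_solution \<Omega> T (\<alpha> 0) \<alpha>"
  unfolding geostrophic_solution_def
proof (intro conjI ballI allI impI)
  show "Pc (\<alpha> t)" if "t \<in> {0..T}" for t using that by (simp add: \<alpha> Pc_discr m)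
  show "W2_continuous T \<alpha>"
    unfolding W2_continuous_def
  proof
    fix t assume t: "t \<in> {0..T}"
    have "((\<lambda>s. sqrt (\<Sum>i<N. m i * (dist (z i s) (z i t))\<^sup>2)) \<longlongrightarrow> sqrt (\<Sum>i<N. m i * (dist (z i t) (z i t))\<^sup>2)) (at t within {0..T})"
      using cont t unfolding continuous_on_def by (intro tendsto_intros) auto
    then have "((\<lambda>s. sqrt (\<Sum>i<N. m i * (dist (z i s) (z i t))\<^sup>2)) \<longlongrightarrow> 0) (at t within {0..T})" by simp
    then show "((\<lambda>s. W2 (\<alpha> s) (\<alpha> t)) \<longlongrightarrow> 0) (at t within {0..T})"
      by (rule Lim_null_comparison[rotated])
         (use W2_discr_le[OF m] t in \<open>auto simp: eventually_at_filter \<alpha> W2_def\<close>)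
  qed
  fix \<phi> assume \<phi>: "test_function \<phi>"
  have "integral {0..T} (action \<phi> vel) = integral {0..T} (action \<phi> z')"
    by (intro integral_cong) (simp add: action_def ode)
  moreover have "(LINT x|\<alpha> s. \<phi> (x, s)) = (\<Sum>i<N. m i * \<phi> (z i s, s))" if "s \<in> {0..T}" for s
    unfolding \<alpha>[OF that] by (rule integral_discr_test_function[OF m \<phi>])
  ultimately show "(LINT t:{0..T}|lborel. LINT x|\<alpha> t. frechet_derivative \<phi> (at (x, t)) (0, 1) + frechet_derivative \<phi> (at (x, t)) (Jmat *v x, 0))
      - (LINT t:{0..T}|lborel. LINT x|M. frechet_derivative \<phi> (at (grad (brenier \<Omega> (\<alpha> t)) x, t)) (Jmat *v x, 0))
    = (LINT x|\<alpha> T. \<phi> (x, T)) - (LINT x|\<alpha> 0. \<phi> (x, 0))"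
    using T weak_form[where \<alpha>=\<alpha>, OF \<phi> \<alpha>] by (simp only: integral_action_deriv[OF \<phi>] atLeastAtMost_iff less_imp_le order_refl simp_thms)
qed

text \<open>The time components of the two actions cancel. The right-hand side need not vanish yet,
  since \<open>\<alpha>0\<close> enters only weakly and has not been identified with the measure at
  time 0.\<close>

lemma weak_difference:
  assumes sol: "geostrophic_solution \<Omega> T \<alpha>0 \<alpha>" and \<alpha>: "\<And>t. t \<in> {0..T} \<Longrightarrow> \<alpha> t = discr N m (\<lambda>i. z i t)"
    and \<phi>: "test_function \<phi>"
  shows "integral {0..T} (\<lambda>t. \<Sum>i<N. m i * frechet_derivative \<phi> (at (z i t, t)) (vel i t - z' i t, 0))
    = (\<Sum>i<N. m i * \<phi> (z i 0, 0)) - (LINT x|\<alpha>0. \<phi> (x, 0))"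
proof -
  have "(LINT x|\<alpha> T. \<phi> (x, T)) = (\<Sum>i<N. m i * \<phi> (z i T, T))"
    using T by (simp add: \<alpha> integral_discr_test_function[OF m \<phi>])
  moreover have "integral {0..T} (action \<phi> vel) = (LINT x|\<alpha> T. \<phi> (x, T)) - (LINT x|\<alpha>0. \<phi> (x, 0))"
    using sol[unfolded geostrophic_solution_def, THEN conjunct2, THEN conjunct2, rule_format, OF \<phi>] weak_form[OF \<phi> \<alpha>] by simp
  moreover have "(\<lambda>t. \<Sum>i<N. m i * frechet_derivative \<phi> (at (z i t, t)) (vel i t - z' i t, 0)) = (\<lambda>t. action \<phi> vel t - action \<phi> z' t)"
  proof
    fix t
    show "(\<Sum>i<N. m i * frechet_derivative \<phi> (at (z i t, t)) (vel i t - z' i t, 0)) = action \<phi> vel t - action \<phi> z' t"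
      unfolding action_def sum_subtractf[symmetric] right_diff_distrib[symmetric]
      by (simp flip: linear_diff[OF test_function_linear[OF \<phi>]])
  qed
  moreover have "integral {0..T} (\<lambda>t. action \<phi> vel t - action \<phi> z' t) = integral {0..T} (action \<phi> vel) - integral {0..T} (action \<phi> z')"
    by (intro integral_diff integrable_continuous_real continuous_action \<phi> continuous_vel cont')
  ultimately show ?thesis by (simp add: integral_action_deriv[OF \<phi>])
qed

text \<open>Testing with a bump centred slightly off \<open>z\<^sub>i(t\<^sub>0)\<close>, in the direction of the defect \<open>vel - z'\<close>,
  makes the integrand positive near \<open>t\<^sub>0\<close>.\<close>

lemma ode_interior:
  assumes sol: "geostrophic_solution \<Omega> T \<alpha>0 \<alpha>" and \<alpha>: "\<And>t. t \<in> {0..T} \<Longrightarrow> \<alpha> t = discr N m (\<lambda>i. z i t)"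
    and i: "i < N" and t0: "t0 \<in> {0<..<T}"
  shows "vel i t0 - z' i t0 = 0"
proof (rule ccontr)
  define u where "u j t = vel j t - z' j t" for j t
  assume "vel i t0 - z' i t0 \<noteq> 0"
  then have u0: "norm (u i t0) > 0" by (simp add: u_def)
  have t0': "t0 \<in> {0..T}" using t0 by auto
  obtain \<delta> where \<delta>: "\<delta> > 0" "\<And>i j. i < N \<Longrightarrow> j < N \<Longrightarrow> i \<noteq> j \<Longrightarrow> norm (z i t0 - z j t0) \<ge> \<delta>"
    using separation[OF inj[OF t0']] by blast
  \<comment> \<open>The point i sits at distance \<open>\<delta> / 8\<close> from the centre, within
    the radius \<open>\<delta> / 4\<close>, while every other point is at least
    \<open>7 * \<delta> / 8\<close> away; only the i-th term survives at \<open>t0\<close>.\<close>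
  define c where "c = z i t0 + (\<delta> / 8) *\<^sub>R sgn (u i t0)"
  define \<epsilon> where "\<epsilon> = \<delta> / 4"
  define g where "g t = (\<Sum>j<N. m j * (flat 2 (\<epsilon>\<^sup>2 - (norm (z j t - c))\<^sup>2) * (- 2 * ((z j t - c) \<bullet> u j t))))" for t
  have nc: "norm (z i t0 - c) = \<delta> / 8" using u0 \<delta>(1) by (simp add: c_def norm_sgn)
  have gc: "continuous_on {0..T} g"
    unfolding g_def u_def
    by (intro continuous_intros continuous_on_compose2[OF continuous_on_flat] cont continuous_vel cont' subset_UNIV) auto
  have "g t0 = (\<Sum>j<N. if j = i then m j * (flat 2 (\<epsilon>\<^sup>2 - (norm (z j t0 - c))\<^sup>2) * (- 2 * ((z j t0 - c) \<bullet> u j t0))) else 0)"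
    unfolding g_def
  proof (rule sum.cong[OF refl])
    fix j assume j: "j \<in> {..<N}"
    have "flat 2 (\<epsilon>\<^sup>2 - (norm (z j t0 - c))\<^sup>2) = 0" if "j \<noteq> i"
    proof (rule flat_zero)
      have "\<delta> \<le> norm (z j t0 - z i t0)" using \<delta>(2) i j that by auto
      also have "\<dots> \<le> norm (z j t0 - c) + norm (z i t0 - c)"
        using norm_triangle_ineq4[of "z j t0 - c" "z i t0 - c"] by simp
      finally have "\<epsilon> \<le> norm (z j t0 - c)" using nc \<delta>(1) by (simp add: \<epsilon>_def)
      then show "\<epsilon>\<^sup>2 - (norm (z j t0 - c))\<^sup>2 \<le> 0" using \<delta>(1) by (simp add: \<epsilon>_def power_mono)
    qed
    then show "m j * (flat 2 (\<epsilon>\<^sup>2 - (norm (z j t0 - c))\<^sup>2) * (- 2 * ((z j t0 - c) \<bullet> u j t0)))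
      = (if j = i then m j * (flat 2 (\<epsilon>\<^sup>2 - (norm (z j t0 - c))\<^sup>2) * (- 2 * ((z j t0 - c) \<bullet> u j t0))) else 0)" by simp
  qed
  also have "\<dots> = m i * (flat 2 (\<epsilon>\<^sup>2 - (\<delta> / 8)\<^sup>2) * (- 2 * ((z i t0 - c) \<bullet> u i t0)))"
    using i by (simp flip: nc)
  also have "(z i t0 - c) \<bullet> u i t0 = - (\<delta> / 8) * norm (u i t0)"
    using u0 by (simp add: c_def sgn_div_norm dot_square_norm power2_eq_square)
  also have "- 2 * (- (\<delta> / 8) * norm (u i t0)) = \<delta> / 4 * norm (u i t0)" by simp
  also have "m i * (flat 2 (\<epsilon>\<^sup>2 - (\<delta> / 8)\<^sup>2) * (\<delta> / 4 * norm (u i t0))) > 0"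
    using m_pos[OF i] u0 \<delta>(1) by (intro mult_pos_pos flat_pos) (auto simp: \<epsilon>_def power2_eq_square)
  finally have g0: "g t0 > 0" .
  have "(g \<longlongrightarrow> g t0) (at t0 within {0..T})" using gc t0' by (simp add: continuous_on_def)
  then have "eventually (\<lambda>t. g t > 0) (at t0 within {0..T})" using g0 by (rule order_tendstoD)
  then obtain d where d: "d > 0" "\<And>t. t \<in> {0..T} \<Longrightarrow> t \<noteq> t0 \<Longrightarrow> dist t t0 < d \<Longrightarrow> g t > 0"
    unfolding eventually_at by blast
  \<comment> \<open>The bound \<open>d\<close> keeps \<open>g\<close> positive on the time support;
    the bound \<open>t0\<close> makes the bump vanish at time 0 and so removes the unidentified
    initial terms.\<close>
  define \<tau> where "\<tau> = min d t0"
  have \<tau>: "\<tau> > 0" "\<tau> \<le> d" "\<tau> \<le> t0" using d t0 by (auto simp: \<tau>_def)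
  define \<theta> where "\<theta> t = flat 0 (\<tau>\<^sup>2 - (t - t0)\<^sup>2)" for t
  have tf: "test_function (bump c \<epsilon> t0 \<tau>)" using \<tau> \<delta>(1) by (intro test_function_bump) (auto simp: \<epsilon>_def)
  have zero: "bump c \<epsilon> t0 \<tau> (x, 0) = 0" for x
    using \<tau> power_mono[of \<tau> t0 2] by (simp add: bump_def flat_zero)
  have "(\<Sum>j<N. m j * frechet_derivative (bump c \<epsilon> t0 \<tau>) (at (z j t, t)) (vel j t - z' j t, 0)) = g t * \<theta> t" for t
    unfolding frechet_derivative_bump g_def \<theta>_def u_def sum_distrib_right by (intro sum.cong) auto
  with weak_difference[OF sol \<alpha> tf] have int0: "integral {0..T} (\<lambda>t. g t * \<theta> t) = 0"
    by (simp add: zero)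
  have cg: "continuous_on {0..T} (\<lambda>t. g t * \<theta> t)"
    unfolding \<theta>_def by (intro continuous_intros gc continuous_on_compose2[OF continuous_on_flat[of UNIV]] subset_UNIV)
  have nn: "0 \<le> g t * \<theta> t" if t: "t \<in> {0..T}" for t
  proof (cases "\<bar>t - t0\<bar> < \<tau>")
    case True
    then have "g t > 0" using d(2)[OF t] g0 \<tau> by (cases "t = t0") (auto simp: dist_real_def)
    then show ?thesis by (simp add: \<theta>_def flat_nonneg)
  next
    case False
    then have "\<tau>\<^sup>2 \<le> (t - t0)\<^sup>2" using \<tau> power_mono[of \<tau> "\<bar>t - t0\<bar>" 2] by simp
    then show ?thesis by (simp add: \<theta>_def flat_zero)
  qed
  have "((\<lambda>t. g t * \<theta> t) has_integral 0) (cbox 0 T)"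
    using integrable_integral[OF integrable_continuous_real[OF cg]] int0 by simp
  then have "g t0 * \<theta> t0 = 0"
    using has_integral_0_cbox_imp_0[of 0 T "\<lambda>t. g t * \<theta> t" t0] cg nn t0 t0' T by auto
  moreover have "\<theta> t0 > 0" unfolding \<theta>_def using \<tau> by (intro flat_pos) simp
  ultimately show False using g0 by simp
qed

text \<open>Bumps reach only interior times; continuity of both velocities extends the equation to
  the end points.\<close>

lemma ode_of_geostrophic_solution:
  assumes sol: "geostrophic_solution \<Omega> T \<alpha>0 \<alpha>" and \<alpha>: "\<And>t. t \<in> {0..T} \<Longrightarrow> \<alpha> t = discr N m (\<lambda>i. z i t)"
    and i: "i < N" and t: "t \<in> {0..T}"
  shows "z' i t = vel i t"
proof -
  have cl: "closure {0<..<T} = {0..T}" using T by simp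
  have "continuous_on (closure {0<..<T}) (\<lambda>t. vel i t - z' i t)"
    unfolding cl by (intro continuous_intros continuous_vel cont' i)
  then have "vel i t - z' i t = 0"
    by (rule continuous_constant_on_closure) (use ode_interior[OF sol \<alpha> i] t cl in auto)
  then show ?thesis by simp
qed

text \<open>Once the equation holds, the integral in \<open>weak_difference\<close> vanishes and
  only the initial terms remain.\<close>

lemma initial_of_geostrophic_solution:
  assumes sol: "geostrophic_solution \<Omega> T \<alpha>0 \<alpha>" and \<alpha>: "\<And>t. t \<in> {0..T} \<Longrightarrow> \<alpha> t = discr N m (\<lambda>i. z i t)"
    and \<phi>: "test_function \<phi>"
  shows "(\<Sum>i<N. m i * \<phi> (z i 0, 0)) = (LINT x|\<alpha>0. \<phi> (x, 0))"
proof -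
  have "integral {0..T} (\<lambda>t. \<Sum>i<N. m i * frechet_derivative \<phi> (at (z i t, t)) (vel i t - z' i t, 0)) = integral {0..T} (\<lambda>t. 0)"
  proof (rule integral_cong)
    fix t assume t: "t \<in> {0..T}"
    have "frechet_derivative \<phi> (at (z i t, t)) (vel i t - z' i t, 0) = 0" if "i < N" for i
      using ode_of_geostrophic_solution[OF sol \<alpha> that t] linear_0[OF test_function_linear[OF \<phi>]] by (simp add: zero_prod_def)
    then show "(\<Sum>i<N. m i * frechet_derivative \<phi> (at (z i t, t)) (vel i t - z' i t, 0)) = 0" by simp
  qed
  with weak_difference[OF sol \<alpha> \<phi>] show ?thesis by simp
qed

end

section \<open>Conservation of energy\<close>

text \<open>Expanding the squares merges the two horizontal cross terms with the vertical term into
  -x . a, where a is the gradient; the energy is thus two horizontal second moments minus the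
  optimal correlation.\<close>

lemma (in source_domain) energy_discr:
  assumes N: "N > 0" and y: "inj_on y {..<N}" and m: "mass_vector N m"
  shows "energy \<Omega> (discr N m y) = (LINT x|M. (1/2) * ((x $ 1)\<^sup>2 + (x $ 2)\<^sup>2))
    + (\<Sum>i<N. m i * ((1/2) * ((y i $ 1)\<^sup>2 + (y i $ 2)\<^sup>2))) - (\<Sum>i<N. cell_moment N m y i \<bullet> y i)"
proof -
  define w where "w = weights N m y"
  note tess = tessellates_weights[OF N m y, folded w_def]
  let ?b = "brenier \<Omega> (discr N m y)"
  have b: "?b = potential N y w" unfolding w_def by (rule brenier_discr[OF N y m])
  have gm: "grad ?b \<in> M \<rightarrow>\<^sub>M borel"
    using is_brenier_potential[OF N y m tess] unfolding b is_brenier_def by blast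
  have idm: "(\<lambda>x. x) \<in> M \<rightarrow>\<^sub>M borel" by (rule measurable_M) simp
  define k where "k i = (1/2) * ((y i $ 1)\<^sup>2 + (y i $ 2)\<^sup>2)" for i
  define h where "h a x = (1/2) * ((a $ 1 - x $ 1)\<^sup>2 + (a $ 2 - x $ 2)\<^sup>2) - x $ 3 * a $ 3" for a x :: R3
  define q where "q x = (1/2) * ((x $ 1)\<^sup>2 + (x $ 2)\<^sup>2)" for x :: R3
  define s where "s x = (\<Sum>i<N. indicator (cell N y w i) x * (x \<bullet> y i - k i))" for x
  have q: "integrable M q"
  proof (rule integrable_M[of _ "rad\<^sup>2"])
    show "q \<in> borel_measurable borel"
      unfolding q_def by (intro borel_measurable_continuous_onI continuous_intros)
    fix x assume "x \<in> \<Omega>"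
    then have "x \<bullet> x \<le> rad\<^sup>2" using norm_le_rad[of x] power_mono[of "norm x" rad 2] by (simp add: power2_norm_eq_inner)
    moreover have "(x $ 1)\<^sup>2 + (x $ 2)\<^sup>2 \<le> x \<bullet> x" by (simp add: inner_3 power2_eq_square)
    ultimately have le: "(x $ 1)\<^sup>2 + (x $ 2)\<^sup>2 \<le> rad\<^sup>2" by simp
    have half: "(1/2) * a \<le> c" if "a \<le> c" "0 \<le> c" for a c :: real using that by simp
    have "q x \<le> rad\<^sup>2" unfolding q_def by (rule half[OF le zero_le_power2])
    moreover have "q x \<ge> 0" by (simp add: q_def)
    ultimately show "norm (q x) \<le> rad\<^sup>2" by simp
  qed
  have s: "integrable M s" unfolding s_def by (intro Bochner_Integration.integrable_sum integral_cell_affine)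
  have "energy \<Omega> (discr N m y) = (LINT x|M. h (grad ?b x) x)" by (simp add: energy_def h_def)
  also have "\<dots> = (LINT x|M. q x - s x)"
  proof (rule integral_cong_AE)
    have "continuous_on UNIV (\<lambda>p. h (fst p) (snd p))"
      unfolding h_def by (intro continuous_intros)
    then have "(\<lambda>p. h (fst p) (snd p)) \<in> borel_measurable borel" by (rule borel_measurable_continuous_onI)
    moreover have "(\<lambda>x. (grad ?b x, x)) \<in> M \<rightarrow>\<^sub>M borel"
      unfolding borel_prod[symmetric] using gm idm by measurable
    ultimately have "(\<lambda>x. h (fst (grad ?b x, x)) (snd (grad ?b x, x))) \<in> borel_measurable M"
      by (rule measurable_compose[rotated])
    then show "(\<lambda>x. h (grad ?b x) x) \<in> borel_measurable M" by simp
    show "(\<lambda>x. q x - s x) \<in> borel_measurable M"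
      using q s by (intro borel_measurable_integrable Bochner_Integration.integrable_diff)
    show "AE x in M. h (grad ?b x) x = q x - s x"
      using N y
    proof (rule AE_cellI)
      fix x i assume i: "x \<in> cell N y w i" "i < N"
      have "s x = x \<bullet> y i - k i" unfolding s_def by (rule sum_indicator_cell_real[OF i])
      moreover have "grad ?b x = y i" unfolding b by (rule grad_potential[OF i])
      moreover have "h (y i) x = q x - (x \<bullet> y i - k i)"
        unfolding h_def q_def k_def inner_3 by (simp add: power2_eq_square algebra_simps)
      ultimately show "h (grad ?b x) x = q x - s x" by simp
    qed
  qed
  also have "\<dots> = (LINT x|M. q x) - (LINT x|M. s x)" using q s by simp
  also have "(LINT x|M. s x) = (\<Sum>i<N. cell_moment N m y i \<bullet> y i) - (\<Sum>i<N. m i * k i)"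
    unfolding s_def integral_sum_cells[OF tess] by (simp add: cell_moment_def w_def)
  finally show ?thesis by (simp add: q_def k_def)
qed

context discrete_curve begin

lemma component_deriv:
  assumes "i < N" "t \<in> {0..T}"
  shows "((\<lambda>t. z i t $ k) has_real_derivative z' i t $ k) (at t within {0..T})"
  using bounded_linear.has_vector_derivative[OF bounded_linear_vec_nth deriv[OF assms]]
  by (simp add: has_real_derivative_iff_has_vector_derivative)

text \<open>An envelope argument: the moments are differentiated as if frozen, although they are not
  known to be differentiable. \<open>R\<close> is the first-order remainder of the correlation at
  time t, caught between 0 by convexity and a multiple of the squared displacement \<open>Q\<close>
  by semiconcavity.\<close>

lemma correlation_deriv:
  assumes t: "t \<in> {0..T}"
  shows "((\<lambda>t. \<Sum>i<N. cmom i t \<bullet> z i t) has_real_derivative (\<Sum>i<N. cmom i t \<bullet> z' i t)) (at t within {0..T})"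
proof -
  obtain \<delta> where \<delta>: "\<delta> > 0" "\<And>i j. i < N \<Longrightarrow> j < N \<Longrightarrow> i \<noteq> j \<Longrightarrow> norm (z i t - z j t) \<ge> \<delta>"
    using separation[OF inj[OF t]] by blast
  define R where "R s = (\<Sum>i<N. (cmom i s - cmom i t) \<bullet> z i s)" for s
  define Q where "Q s = (\<Sum>i<N. (z i s - z i t) \<bullet> (z i s - z i t))" for s
  have "(R has_real_derivative 0) (at t within {0..T})"
  proof (rule has_real_derivative_zero_squeeze[OF _ _ _ t])
    fix s assume s: "s \<in> {0..T}"
    have Q0: "Q s \<ge> 0" unfolding Q_def by (intro sum_nonneg) auto
    have "norm (z i s - z i t) \<le> sqrt (Q s)" if "i < N" for i
      unfolding norm_eq_sqrt_inner Q_def using that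
      by (intro real_sqrt_le_mono member_le_sum[of _ _ "\<lambda>i. (z i s - z i t) \<bullet> (z i s - z i t)"]) auto
    then have "R s \<le> 32 * (real N)\<^sup>2 * rad^4 / \<delta> * (sqrt (Q s))\<^sup>2"
      unfolding R_def cell_moment_def using Q0
      by (intro correlation_semiconcave[where m=m] N_pos tessellates_weights m inj s t \<delta>) auto
    moreover have "0 \<le> R s" unfolding R_def cell_moment_def
      by (intro correlation_convex[where m=m] N_pos tessellates_weights m inj s t)
    ultimately show "\<bar>R s\<bar> \<le> 32 * (real N)\<^sup>2 * rad^4 / \<delta> * Q s" using Q0 by simp
  next
    show "Q t = 0" by (simp add: Q_def)
    have "(Q has_vector_derivative (\<Sum>i<N. (z i t - z i t) \<bullet> (z' i t - 0) + (z' i t - 0) \<bullet> (z i t - z i t))) (at t within {0..T})"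
      unfolding Q_def using t
      by (intro has_vector_derivative_sum bounded_bilinear.has_vector_derivative[OF bounded_bilinear_inner]
          has_vector_derivative_diff deriv has_vector_derivative_const) auto
    then show "(Q has_real_derivative 0) (at t within {0..T})"
      by (simp add: has_real_derivative_iff_has_vector_derivative)
  qed
  moreover have "((\<lambda>s. \<Sum>i<N. cmom i t \<bullet> z i s) has_real_derivative (\<Sum>i<N. cmom i t \<bullet> z' i t)) (at t within {0..T})"
    unfolding has_real_derivative_iff_has_vector_derivative using t
    by (intro has_vector_derivative_sum bounded_linear.has_vector_derivative[OF bounded_linear_inner_right] deriv) auto
  ultimately have "((\<lambda>s. R s + (\<Sum>i<N. cmom i t \<bullet> z i s)) has_real_derivative 0 + (\<Sum>i<N. cmom i t \<bullet> z' i t)) (at t within {0..T})"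
    by (rule DERIV_add)
  moreover have "R s + (\<Sum>i<N. cmom i t \<bullet> z i s) = (\<Sum>i<N. cmom i s \<bullet> z i s)" for s
    by (simp add: R_def inner_diff_left sum_subtractf)
  ultimately show ?thesis by simp
qed

lemma energy_conserving_of_ode:
  assumes ode: "\<And>i t. i < N \<Longrightarrow> t \<in> {0..T} \<Longrightarrow> z' i t = vel i t"
    and \<alpha>: "\<And>t. t \<in> {0..T} \<Longrightarrow> \<alpha> t = discr N m (\<lambda>i. z i t)"
  shows "energy_conserving \<Omega> T \<alpha>"
proof -
  define H where "H t = (\<Sum>i<N. m i * ((1/2) * ((z i t $ 1)\<^sup>2 + (z i t $ 2)\<^sup>2))) - (\<Sum>i<N. cmom i t \<bullet> z i t)" for t
  have "(H has_real_derivative 0) (at t within {0..T})" if t: "t \<in> {0..T}" for t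
  proof -
    have "((\<lambda>t. m i * ((1/2) * ((z i t $ 1)\<^sup>2 + (z i t $ 2)\<^sup>2))) has_real_derivative cmom i t \<bullet> z' i t) (at t within {0..T})" if i: "i < N" for i
    proof -
      \<comment> \<open>The horizontal part (a, b) of \<open>z\<close> minus the centroid of the
        cell is orthogonal to the velocity (-b, a), so only the moment contributes to
        \<open>m i\<close> times \<open>z\<close> paired with the velocity.\<close>
      define a b where "a = z i t $ 1 - cmom i t $ 1 / m i" "b = z i t $ 2 - cmom i t $ 2 / m i"
      have mi: "m i \<noteq> 0" using m_pos[OF i] by simp
      have v: "z' i t $ 1 = - b" "z' i t $ 2 = a" "z' i t $ 3 = 0"
        unfolding ode[OF i t] vel_def by (simp_all add: Jmat_nth a_b_def)
      have z: "m i * z i t $ 1 = m i * a + cmom i t $ 1" "m i * z i t $ 2 = m i * b + cmom i t $ 2"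
        using mi by (simp_all add: a_b_def field_simps)
      have "((\<lambda>t. m i * ((1/2) * ((z i t $ 1)\<^sup>2 + (z i t $ 2)\<^sup>2))) has_real_derivative
         m i * z i t $ 1 * z' i t $ 1 + m i * z i t $ 2 * z' i t $ 2) (at t within {0..T})"
        by (auto intro!: derivative_eq_intros component_deriv[OF i t] simp: algebra_simps)
      also have "m i * z i t $ 1 * z' i t $ 1 + m i * z i t $ 2 * z' i t $ 2 = cmom i t \<bullet> z' i t"
        unfolding z inner_3 v by (simp add: algebra_simps)
      finally show ?thesis .
    qed
    then have "((\<lambda>t. \<Sum>i<N. m i * ((1/2) * ((z i t $ 1)\<^sup>2 + (z i t $ 2)\<^sup>2))) has_real_derivative (\<Sum>i<N. cmom i t \<bullet> z' i t)) (at t within {0..T})"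
      by (intro DERIV_sum) auto
    from DERIV_diff[OF this correlation_deriv[OF t]] show ?thesis unfolding H_def by simp
  qed
  then obtain c where c: "\<And>t. t \<in> {0..T} \<Longrightarrow> H t = c"
    using has_field_derivative_zero_constant[of "{0..T}" H] by auto
  have "energy \<Omega> (\<alpha> t) = (LINT x|M. (1/2) * ((x $ 1)\<^sup>2 + (x $ 2)\<^sup>2)) + c" if t: "t \<in> {0..T}" for t
    unfolding \<alpha>[OF t] energy_discr[OF N_pos inj[OF t] m] c[OF t, symmetric] H_def by simp
  then show ?thesis by (simp add: energy_conserving_def)
qed

end

section \<open>Existence and uniqueness of the trajectories\<close>

lemma discr_reindex:
  assumes "mass_vector N m" "mass_vector N' m'" "bij_betw \<sigma> {..<N} {..<N'}" "\<And>j. j < N \<Longrightarrow> m' (\<sigma> j) = m j"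
    "\<And>j. j < N \<Longrightarrow> x' (\<sigma> j) = x j"
  shows "discr N' m' x' = discr N m x"
proof (rule measure_eqI)
  fix A assume "A \<in> sets (discr N' m' x')"
  then have A: "A \<in> sets borel" by (simp add: sets_discr)
  have "(\<Sum>i<N'. m' i * indicator A (x' i)) = (\<Sum>j<N. m' (\<sigma> j) * indicator A (x' (\<sigma> j)) :: real)"
    by (rule sum.reindex_bij_betw[OF assms(3), symmetric])
  also have "\<dots> = (\<Sum>j<N. m j * indicator A (x j))" using assms by (intro sum.cong) auto
  finally show "emeasure (discr N' m' x') A = emeasure (discr N m x) A"
    using assms A by (simp add: emeasure_discr)
qed (simp add: sets_discr)

text \<open>A bump at \<open>y j\<close> whose radius avoids all other atoms of both families reads
  off the mass there. This mass is nonzero, so the other family has an atom at \<open>y j\<close>,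
  and exactly one since its atoms are distinct.\<close>

lemma atom_match:
  fixes N N' :: nat
  assumes m: "mass_vector N m" and y: "inj_on y {..<N}" and y': "inj_on y' {..<N'}"
    and eq: "\<And>\<phi>. test_function \<phi> \<Longrightarrow> (\<Sum>i<N'. m' i * \<phi> (y' i, 0)) = (\<Sum>i<N. m i * \<phi> (y i, 0))"
    and j: "j < N"
  shows "\<exists>i<N'. y' i = y j \<and> m' i = m j"
proof -
  obtain \<epsilon> where \<epsilon>: "\<epsilon> > 0" "\<forall>x\<in>y ` {..<N} \<union> y' ` {..<N'}. x \<noteq> y j \<longrightarrow> \<epsilon> \<le> dist (y j) x"
    using finite_set_avoid[of "y ` {..<N} \<union> y' ` {..<N'}" "y j"] by auto
  define K where "K = flat 0 (\<epsilon>\<^sup>2) * flat 0 1"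
  have K: "K > 0" unfolding K_def using \<epsilon> by (intro mult_pos_pos flat_pos) auto
  have b: "bump (y j) \<epsilon> 0 1 (x, 0) = (if x = y j then K else 0)" if "x \<in> y ` {..<N} \<union> y' ` {..<N'}" for x
  proof (cases "x = y j")
    case False
    then have "\<epsilon> \<le> norm (x - y j)" using \<epsilon>(2) that by (auto simp: dist_norm norm_minus_commute)
    then have "\<epsilon>\<^sup>2 \<le> (norm (x - y j))\<^sup>2" using \<epsilon>(1) by (intro power_mono) auto
    then show ?thesis using False by (simp add: bump_def flat_zero)
  qed (simp add: bump_def K_def)
  have "(\<Sum>i<N. m i * bump (y j) \<epsilon> 0 1 (y i, 0)) = (\<Sum>i<N. if i = j then m i * K else 0)"
    using y j by (intro sum.cong) (auto simp: b dest: inj_onD)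
  also have "\<dots> = m j * K" using j by simp
  finally have sum: "(\<Sum>i<N'. m' i * bump (y j) \<epsilon> 0 1 (y' i, 0)) = m j * K"
    using eq[OF test_function_bump[OF \<epsilon>(1), of 1]] by simp
  have "m j * K \<noteq> 0" using m j K by (auto simp: mass_vector_def)
  then obtain i where i: "i < N'" "y' i = y j"
    using sum b by (metis (no_types, lifting) UnI2 image_eqI lessThan_iff mult_zero_right sum.neutral)
  have "(\<Sum>k<N'. m' k * bump (y j) \<epsilon> 0 1 (y' k, 0)) = (\<Sum>k<N'. if k = i then m' k * K else 0)"
  proof (rule sum.cong[OF refl])
    fix k assume k: "k \<in> {..<N'}"
    then have "y' k = y j \<longleftrightarrow> k = i" using y' i by (metis inj_on_eq_iff lessThan_iff)
    then show "m' k * bump (y j) \<epsilon> 0 1 (y' k, 0) = (if k = i then m' k * K else 0)"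
      using b[of "y' k"] k by simp
  qed
  also have "\<dots> = m' i * K" using i by simp
  finally have "m' i = m j" using sum K by simp
  with i show ?thesis by blast
qed

lemma atoms_match:
  assumes m: "mass_vector N m" and y: "inj_on y {..<N}" and m': "mass_vector N' m'" and y': "inj_on y' {..<N'}"
    and eq: "\<And>\<phi>. test_function \<phi> \<Longrightarrow> (\<Sum>i<N'. m' i * \<phi> (y' i, 0)) = (\<Sum>i<N. m i * \<phi> (y i, 0))"
  obtains \<sigma> where "bij_betw \<sigma> {..<N} {..<N'}" "\<And>j. j < N \<Longrightarrow> m' (\<sigma> j) = m j" "\<And>j. j < N \<Longrightarrow> y' (\<sigma> j) = y j"
proof -
  have "\<forall>j. \<exists>i. j < N \<longrightarrow> i < N' \<and> y' i = y j \<and> m' i = m j" using atom_match[OF m y y' eq] by blast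
  then obtain \<sigma> where \<sigma>: "\<And>j. j < N \<Longrightarrow> \<sigma> j < N' \<and> y' (\<sigma> j) = y j \<and> m' (\<sigma> j) = m j" by metis
  have "bij_betw \<sigma> {..<N} {..<N'}"
    unfolding bij_betw_def
  proof
    show "inj_on \<sigma> {..<N}"
    proof (rule inj_onI)
      fix j k assume jk: "j \<in> {..<N}" "k \<in> {..<N}" "\<sigma> j = \<sigma> k"
      then have "y j = y k" using \<sigma>[of j] \<sigma>[of k] by simp
      then show "j = k" using y jk by (auto dest: inj_onD)
    qed
    show "\<sigma> ` {..<N} = {..<N'}"
    proof
      show "{..<N'} \<subseteq> \<sigma> ` {..<N}"
      proof
        fix i assume i: "i \<in> {..<N'}"
        obtain j where j: "j < N" "y j = y' i"
          using atom_match[OF m' y' y eq[symmetric], of i] i by auto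
        then have "y' (\<sigma> j) = y' i" "\<sigma> j < N'" using \<sigma>[of j] by auto
        then have "\<sigma> j = i" using y' i by (auto dest: inj_onD)
        then show "i \<in> \<sigma> ` {..<N}" using j by auto
      qed
    qed (use \<sigma> in auto)
  qed
  then show thesis using that \<sigma> by blast
qed

lemma constant_of_zero_derivative:
  fixes f :: "real \<Rightarrow> real"
  assumes "\<And>t. t \<in> {0..T} \<Longrightarrow> (f has_real_derivative 0) (at t within {0..T})" "t \<in> {0..T}"
  shows "f t = f 0"
proof -
  obtain c where "\<And>t. t \<in> {0..T} \<Longrightarrow> f t = c"
    using has_field_derivative_zero_constant[of "{0..T}" f] assms(1) by auto
  then show ?thesis using assms(2) by auto
qed

text \<open>Since \<open>J\<close> annihilates the third component, a solution keeps the heights of its initial points.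
  Freezing the heights therefore does not change the equation, but keeps the points separated and
  makes the vector field globally Lipschitz.\<close>

locale well_prepared_data = source_domain +
  fixes N :: nat and m :: "nat \<Rightarrow> real" and z0 :: "nat \<Rightarrow> R3" and r T :: real
  assumes m: "mass_vector N m" and r: "r > 0" and T: "T > 0"
    and sep: "\<And>i j. i < N \<Longrightarrow> j < N \<Longrightarrow> i \<noteq> j \<Longrightarrow> \<bar>z0 i $ 3 - z0 j $ 3\<bar> \<ge> r"
begin

definition freeze :: "(nat \<Rightarrow> R3) \<Rightarrow> nat \<Rightarrow> R3" where
  "freeze y i = (\<chi> k. if k = 3 then z0 i $ 3 else y i $ k)"

definition field :: "nat \<Rightarrow> (nat \<Rightarrow> R3) \<Rightarrow> R3" where
  "field i y = Jmat *v (freeze y i - (1 / m i) *\<^sub>R cell_moment N m (freeze y) i)"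

text \<open>The 1 accounts for the linear term of the field; the sum dominates
  \<open>1 / m i\<close> for every i at once.\<close>

definition lip_const :: real where
  "lip_const = 1 + (\<Sum>j<N. 1 / m j) * (128 * (real N)\<^sup>2 * rad^4 / r)"

lemma N_pos: "N > 0"
  using m by (cases N) (auto simp: mass_vector_def)

lemma freeze_separated: "i < N \<Longrightarrow> j < N \<Longrightarrow> i \<noteq> j \<Longrightarrow> norm (freeze y i - freeze y j) \<ge> r"
  using sep[of i j] component_le_norm_cart[of "freeze y i - freeze y j" 3] by (simp add: freeze_def)

lemma inj_freeze: "inj_on (freeze y) {..<N}"
  using freeze_separated[of _ _ y] r by (force intro!: inj_onI)

lemma norm_freeze_diff: "norm (freeze y i - freeze y' i) \<le> norm (y i - y' i)"
proof -
  have "(freeze y i - freeze y' i) \<bullet> (freeze y i - freeze y' i) \<le> (y i - y' i) \<bullet> (y i - y' i)"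
    by (simp add: inner_3 freeze_def)
  then show ?thesis by (simp add: norm_le)
qed

lemma field_lipschitz:
  assumes "D \<ge> 0" "\<And>j. j < N \<Longrightarrow> norm (y j - y' j) \<le> D" "i < N"
  shows "norm (field i y - field i y') \<le> lip_const * D"
proof -
  let ?C = "128 * (real N)\<^sup>2 * rad^4 / r"
  let ?c = "\<lambda>y. cell_moment N m (freeze y) i"
  have mi: "m i > 0" using m assms(3) by (auto simp: mass_vector_def)
  have fd: "norm (freeze y j - freeze y' j) \<le> D" if "j < N" for j
    using norm_freeze_diff assms(2)[OF that] by (rule order_trans)
  have "field i y - field i y' = Jmat *v ((freeze y i - freeze y' i) - (1 / m i) *\<^sub>R (?c y - ?c y'))"
    by (simp add: field_def matrix_vector_mult_diff_distrib matrix_vector_mult_scaleR algebra_simps)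
  then have "norm (field i y - field i y') \<le> norm ((freeze y i - freeze y' i) - (1 / m i) *\<^sub>R (?c y - ?c y'))"
    using norm_Jmat_le by simp
  also have "\<dots> \<le> norm (freeze y i - freeze y' i) + norm ((1 / m i) *\<^sub>R (?c y - ?c y'))"
    by (rule norm_triangle_ineq4)
  also have "\<dots> \<le> D + (1 / m i) * (?C * D)"
  proof (rule add_mono[OF fd[OF assms(3)]])
    have "norm (?c y - ?c y') \<le> ?C * D"
      by (rule cell_moment_lipschitz[OF N_pos m inj_freeze r freeze_separated assms(1) fd assms(3)])
    then have "(1 / m i) * norm (?c y - ?c y') \<le> (1 / m i) * (?C * D)"
      using mi by (intro mult_left_mono) auto
    then show "norm ((1 / m i) *\<^sub>R (?c y - ?c y')) \<le> (1 / m i) * (?C * D)"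
      using mi by simp
  qed
  also have "\<dots> \<le> D + (\<Sum>j<N. 1 / m j) * (?C * D)"
  proof (intro add_left_mono mult_right_mono member_le_sum)
    show "0 \<le> ?C * D" using r assms(1) rad_pos by simp
  qed (use assms(3) m in \<open>auto simp: mass_vector_def intro: less_imp_le\<close>)
  also have "\<dots> = lip_const * D" by (simp add: lip_const_def algebra_simps)
  finally show ?thesis .
qed

lemma lip_const_pos: "lip_const > 0"
proof -
  have "0 \<le> (\<Sum>j<N. 1 / m j) * (128 * (real N)\<^sup>2 * rad^4 / r)"
    using m r rad_pos by (intro mult_nonneg_nonneg sum_nonneg) (auto simp: mass_vector_def intro: less_imp_le)
  then show ?thesis by (simp add: lip_const_def)
qed

sublocale lipschitz_system N field lip_const T
  by standard (use lip_const_pos T field_lipschitz in auto)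

text \<open>\<open>freeze y\<close> and \<open>y\<close> agree only below \<open>N\<close>, so
  \<open>weights\<close> may choose differently for them; the Lipschitz estimate with
  \<open>D = 0\<close> shows that the moments still coincide.\<close>

lemma field_eq:
  assumes "\<And>j. j < N \<Longrightarrow> y j $ 3 = z0 j $ 3" "i < N"
  shows "field i y = Jmat *v (y i - (1 / m i) *\<^sub>R cell_moment N m y i)"
proof -
  have eq: "freeze y j = y j" if "j < N" for j
    using assms(1)[OF that] by (simp add: freeze_def vec_eq_iff)
  have inj: "inj_on y {..<N}"
    using inj_freeze[of y] inj_on_cong[of "{..<N}" "freeze y" y] eq by simp
  have "norm (cell_moment N m y i - cell_moment N m (freeze y) i) \<le> 128 * (real N)\<^sup>2 * rad^4 / r * 0"
    by (rule cell_moment_lipschitz[OF N_pos m inj r freeze_separated]) (auto simp: eq assms(2))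
  then have "cell_moment N m (freeze y) i = cell_moment N m y i" by simp
  then show ?thesis using eq[OF assms(2)] by (simp add: field_def)
qed

lemma inj_of_heights:
  assumes "\<And>j. j < N \<Longrightarrow> y j $ 3 = z0 j $ 3" shows "inj_on y {..<N}"
proof (rule inj_onI)
  fix i j assume ij: "i \<in> {..<N}" "j \<in> {..<N}" "y i = y j"
  then have "z0 i $ 3 = z0 j $ 3" using assms[of i] assms[of j] by simp
  then show "i = j" using sep[of i j] ij r by force
qed

lemma solution_heights:
  assumes y: "solution z0 y" and j: "j < N" and t: "t \<in> {0..T}"
  shows "y j t $ 3 = z0 j $ 3"
proof -
  have "((\<lambda>t. y j t $ 3) has_real_derivative 0) (at t within {0..T})" if t: "t \<in> {0..T}" for t
  proof -
    have "(y j has_vector_derivative field j (\<lambda>j. y j t)) (at t within {0..T})" using y j t by (simp add: solution_def)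
    from bounded_linear.has_vector_derivative[OF bounded_linear_vec_nth this, of 3] show ?thesis
      by (simp add: has_real_derivative_iff_has_vector_derivative field_def Jmat_nth)
  qed
  from constant_of_zero_derivative[OF this t] show ?thesis using y j by (simp add: solution_def)
qed

lemma discrete_curve_solution:
  assumes y: "solution z0 y"
  shows "discrete_curve \<Omega> N m y (\<lambda>i t. field i (\<lambda>j. y j t)) T"
proof unfold_locales
  fix i assume i: "i < N"
  show d: "(y i has_vector_derivative field i (\<lambda>j. y j t)) (at t within {0..T})" if "t \<in> {0..T}" for t
    using y i that by (simp add: solution_def)
  have "continuous_on {0..T} (y j)" if "j < N" for j
    unfolding continuous_on_eq_continuous_within
    using y that by (auto simp: solution_def intro: has_vector_derivative_continuous)
  then show "continuous_on {0..T} (\<lambda>t. field i (\<lambda>j. y j t))" by (rule continuous_on_F[OF _ i])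
next
  fix t assume "t \<in> {0..T}"
  then show "inj_on (\<lambda>i. y i t) {..<N}" using solution_heights[OF y] by (intro inj_of_heights)
qed (use T m in auto)

lemma vel_solution:
  assumes y: "solution z0 y" and "i < N" "t \<in> {0..T}"
  shows "field i (\<lambda>j. y j t) = discrete_curve.vel \<Omega> N m y i t"
proof -
  interpret c: discrete_curve \<Omega> N m y "\<lambda>i t. field i (\<lambda>j. y j t)" T by (rule discrete_curve_solution[OF y])
  show ?thesis unfolding c.vel_def using assms by (intro field_eq solution_heights)
qed

text \<open>The competitor is first read in its own labels to match its initial atoms with the data,
  then relabelled. Its own equation fixes its heights, which makes it a solution of the system with
  frozen heights, where uniqueness is known.\<close>

lemma unique_solution:
  assumes y: "\<And>y' i t. solution z0 y' \<Longrightarrow> i < N \<Longrightarrow> t \<in> {0..T} \<Longrightarrow> y' i t = y i t"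
    and \<beta>: "C1_discrete_geostrophic_solution \<Omega> T (discr N m z0) \<beta>" and t: "t \<in> {0..T}"
  shows "\<beta> t = discr N m (\<lambda>i. y i t)"
proof -
  obtain N' m' x x' where sol: "geostrophic_solution \<Omega> T (discr N m z0) \<beta>" and m': "mass_vector N' m'"
    and x': "\<And>i. i < N' \<Longrightarrow> continuous_on {0..T} (x' i)"
      "\<And>i t. i < N' \<Longrightarrow> t \<in> {0..T} \<Longrightarrow> (x i has_vector_derivative x' i t) (at t within {0..T})"
    and x: "\<And>t. t \<in> {0..T} \<Longrightarrow> inj_on (\<lambda>i. x i t) {..<N'}" "\<And>t. t \<in> {0..T} \<Longrightarrow> \<beta> t = discr N' m' (\<lambda>i. x i t)"
    using \<beta> unfolding C1_discrete_geostrophic_solution_def by metis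
  interpret c: discrete_curve \<Omega> N' m' x x' T
    by unfold_locales (rule T m' x' x(1); assumption)+
  have e: "(\<Sum>i<N'. m' i * \<phi> (x i 0, 0)) = (\<Sum>i<N. m i * \<phi> (z0 i, 0))" if "test_function \<phi>" for \<phi>
    using c.initial_of_geostrophic_solution[OF sol x(2) that] integral_discr_test_function[OF m that, of z0 0] by simp
  have i0: "inj_on z0 {..<N}" by (rule inj_of_heights) simp
  have ix: "inj_on (\<lambda>i. x i 0) {..<N'}" using x(1)[of 0] T by simp
  obtain \<sigma> where \<sigma>: "bij_betw \<sigma> {..<N} {..<N'}" "\<And>j. j < N \<Longrightarrow> m' (\<sigma> j) = m j" "\<And>j. j < N \<Longrightarrow> x (\<sigma> j) 0 = z0 j"
    using atoms_match[OF m i0 m' ix e] by blast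
  have \<sigma>': "\<sigma> j < N'" if "j < N" for j using \<sigma>(1) that by (auto simp: bij_betw_def)
  have \<beta>': "\<beta> t = discr N m (\<lambda>j. x (\<sigma> j) t)" if "t \<in> {0..T}" for t
    unfolding x(2)[OF that] by (rule discr_reindex[OF m m' \<sigma>(1,2)]) auto
  interpret d: discrete_curve \<Omega> N m "\<lambda>j. x (\<sigma> j)" "\<lambda>j. x' (\<sigma> j)" T
  proof unfold_locales
    show "inj_on (\<lambda>j. x (\<sigma> j) t) {..<N}" if "t \<in> {0..T}" for t
      using comp_inj_on[of \<sigma> "{..<N}" "\<lambda>i. x i t"] \<sigma>(1) x(1)[OF that] by (simp add: bij_betw_def comp_def)
  qed (use T m x' \<sigma>' in auto)
  have ode: "x' (\<sigma> j) t = d.vel j t" if "j < N" "t \<in> {0..T}" for j t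
    by (rule d.ode_of_geostrophic_solution[OF sol _ that]) (rule \<beta>')
  have heights: "x (\<sigma> j) t $ 3 = z0 j $ 3" if j: "j < N" and t: "t \<in> {0..T}" for j t
  proof -
    have "((\<lambda>t. x (\<sigma> j) t $ 3) has_real_derivative 0) (at t within {0..T})" if t: "t \<in> {0..T}" for t
      using d.component_deriv[OF j t, of 3] ode[OF j t] by (simp add: d.vel_def Jmat_nth)
    from constant_of_zero_derivative[OF this t] show ?thesis using \<sigma>(3)[OF j] by simp
  qed
  have "solution z0 (\<lambda>j. x (\<sigma> j))"
    unfolding solution_def
  proof (intro allI impI conjI ballI)
    fix i t assume i: "i < N" and t: "t \<in> {0..T}"
    have "field i (\<lambda>j. x (\<sigma> j) t) = d.vel i t"
      unfolding d.vel_def using i t by (intro field_eq heights)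
    then show "(x (\<sigma> i) has_vector_derivative field i (\<lambda>j. x (\<sigma> j) t)) (at t within {0..T})"
      using d.deriv[OF i t] ode[OF i t] by simp
  qed (use \<sigma> in auto)
  then have eq: "x (\<sigma> i) t = y i t" if "i < N" for i using y that t by blast
  show ?thesis
    unfolding \<beta>'[OF t] by (rule discr_reindex[OF m m, of id]) (auto simp: eq)
qed

end

theorem theorem3p5:
  fixes \<Omega> :: "(real^3) set" and N :: nat and T :: real and \<alpha>0 :: "(real^3) measure"
  assumes "open \<Omega>" and "bounded \<Omega>" and "convex \<Omega>" and "emeasure lebesgue \<Omega> = 1"
    and "N \<ge> 2" and "T > 0"
    and "QN N \<alpha>0" and "well_prepared N \<alpha>0"
  shows "\<exists>\<alpha>. C1_discrete_geostrophic_solution \<Omega> T \<alpha>0 \<alpha>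
            \<and> (\<forall>\<beta>. C1_discrete_geostrophic_solution \<Omega> T \<alpha>0 \<beta> \<longrightarrow> (\<forall>t \<in> {0..T}. \<beta> t = \<alpha> t))
            \<and> energy_conserving \<Omega> T \<alpha>"
proof -
  obtain m z0 r where m: "mass_vector N m" and \<alpha>0: "\<alpha>0 = discr N m z0" and r: "r > 0"
    and sep: "\<forall>i<N. \<forall>j<N. i \<noteq> j \<longrightarrow> \<bar>(z0 i - z0 j) \<bullet> e3\<bar> \<ge> r"
    using assms(8) unfolding well_prepared_def by blast
  interpret well_prepared_data \<Omega> N m z0 r T
    by unfold_locales (use assms m r sep in \<open>auto simp: e3_def inner_axis\<close>)
  obtain y where y: "solution z0 y" "\<And>y' i t. solution z0 y' \<Longrightarrow> i < N \<Longrightarrow> t \<in> {0..T} \<Longrightarrow> y' i t = y i t"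
    using picard_lindelof by blast
  interpret c: discrete_curve \<Omega> N m y "\<lambda>i t. field i (\<lambda>j. y j t)" T by (rule discrete_curve_solution[OF y(1)])
  define \<alpha> where "\<alpha> t = discr N m (\<lambda>i. y i t)" for t
  have "\<alpha> 0 = \<alpha>0"
    unfolding \<alpha>_def \<alpha>0 by (rule discr_reindex[OF m m, of id]) (use y(1) in \<open>auto simp: solution_def\<close>)
  moreover have "geostrophic_solution \<Omega> T (\<alpha> 0) \<alpha>"
    by (rule c.geostrophic_solution_of_ode) (auto simp: \<alpha>_def vel_solution[OF y(1)])
  ultimately have "C1_discrete_geostrophic_solution \<Omega> T \<alpha>0 \<alpha>"
    unfolding C1_discrete_geostrophic_solution_def using m c.deriv c.cont' c.inj
    by (intro conjI exI[of _ N] exI[of _ m] exI[of _ y] exI[of _ "\<lambda>i t. field i (\<lambda>j. y j t)"]) (auto simp: \<alpha>_def)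
  moreover have "\<beta> t = \<alpha> t" if "C1_discrete_geostrophic_solution \<Omega> T \<alpha>0 \<beta>" "t \<in> {0..T}" for \<beta> t
    unfolding \<alpha>_def by (rule unique_solution[OF _ that(1)[unfolded \<alpha>0] that(2)]) (rule y(2))
  moreover have "energy_conserving \<Omega> T \<alpha>"
    by (rule c.energy_conserving_of_ode) (auto simp: \<alpha>_def vel_solution[OF y(1)])
  ultimately show ?thesis by blast
qed

end
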